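(* Let $\sigma=0$. For sufficiently small $\omega$ and $\varepsilon\in\mathbb R^2$ with $|\omega|>|\varepsilon|\ge0$, or for $\omega=|\varepsilon|=0$, the following identities hold on $\partial D$ for every $\phi\in\mathbb L^2(\partial D)$: $$\mathcal S_D^{\varepsilon,\omega}[\phi]=\tilde{\mathcal S}_{\tilde D}^{\alpha_1+\varepsilon,\omega}[\tilde\phi_1^\varepsilon]+\tilde{\mathcal S}_{\tilde D}^{\alpha_2+\varepsilon,\omega}[\tilde\phi_2^\varepsilon]+\tilde{\mathcal S}_{\tilde D}^{\alpha_3+\varepsilon,\omega}[\tilde\phi_3^\varepsilon],$$ $$(\mathcal K_D^{-\varepsilon,\omega})^\ast[\phi]=(\tilde{\mathcal K}_{\tilde D}^{-\alpha_1-\varepsilon,\omega})^\ast[\tilde\phi_1^\varepsilon]+(\tilde{\mathcal K}_{\tilde D}^{-\alpha_2-\varepsilon,\omega})^\ast[\tilde\phi_2^\varepsilon]+(\tilde{\mathcal K}_{\tilde D}^{-\alpha_3-\varepsilon,\omega})^\ast[\tilde\phi_3^\varepsilon].$$ Here $\tilde\phi_j^\varepsilon=\phi_j^\varepsilon|_{\partial\tilde D}$, where $\phi=\phi_1^\varepsilon+\phi_2^\varepsilon+\phi_3^\varepsilon$ is the uniquely determined decomposition with $\phi_j^\varepsilon\in\mathbb L^2_{\alpha_j+\varepsilon}(\partial D)$, $j=1,2,3$.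
   Context: Geometry. Let $l_1=(1/2,-\sqrt3/2)^T$, $l_2=(1/2,\sqrt3/2)^T$, $\Lambda=\{n_1l_1+n_2l_2:n_1,n_2\in\mathbb Z\}$, and let $Y$ be the hexagonal unit cell with vertices $\pm(-l_1+l_2)/3,\ \pm(l_1+2l_2)/3,\ \pm(2l_1+l_2)/3$. Let $R=\begin{pmatrix}1/2&\sqrt3/2\\-\sqrt3/2&1/2\end{pmatrix}$ and $T_x=\mathrm{diag}(1,-1)$. Let $D_0\subset\mathbb R^2$ be a connected open domain containing the origin, with piecewise smooth boundary, such that $R^2D_0=D_0$, $T_xD_0=D_0$ and $\operatorname{diam}(D_0)<1/4$. With $\sigma=0$, put $D_1=D_0-\frac13l_1$, $D_j=R^{j-1}D_1$ ($j=2,\dots,6$), $D=\bigcup_{j=1}^6D_j$, assumed to satisfy $D\Subset Y$ with six connected components, and $\tilde D=D_1\cup D_2$. Let $\tilde l_1=(2l_1+l_2)/3$, $\tilde l_2=(l_1+2l_2)/3$. Let $k_1,k_2$ satisfy $k_i\cdot l_j=2\pi\delta_{ij}$, $\Lambda'=\{n_1k_1+n_2k_2:n_1,n_2\in\mathbb Z\}$, $\tilde k_1=2k_1-k_2$, $\tilde k_2=2k_2-k_1$, $\tilde\Lambda'=\{m_1\tilde k_1+m_2\tilde k_2:m_1,m_2\in\mathbb Z\}$. Put $\alpha_1=\frac23\tilde k_1+\frac13\tilde k_2=k_1$, $\alpha_2=\frac13\tilde k_1+\frac23\tilde k_2=k_2$, $\alpha_3=0$. Green's functions. $$G^{\alpha,\omega}(x)=\frac1{|Y|}\sum_{q\in\Lambda'}\frac{e^{i(\alpha+q)\cdot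 x}}{\omega^2-|\alpha+q|^2},\qquad \tilde G^{\alpha,\omega}(x)=\frac3{|Y|}\sum_{q\in\tilde\Lambda'}\frac{e^{i(\alpha+q)\cdot x}}{\omega^2-|\alpha+q|^2}$$ (whenever no denominator vanishes), and $G^{0,0}(x)=-\frac1{|Y|}\sum_{q\in\Lambda'\setminus\{0\}}\frac{e^{iq\cdot x}}{|q|^2}$, $\tilde G^{0,0}(x)=-\frac3{|Y|}\sum_{q\in\tilde\Lambda'\setminus\{0\}}\frac{e^{iq\cdot x}}{|q|^2}$. Layer potentials. With $n_x$ the outward unit normal to $\partial D$ at $x\in\partial D$, $$\mathcal S_D^{\alpha,\omega}[\phi](x)=\int_{\partial D}G^{\alpha,\omega}(x-y)\phi(y)\,d\sigma(y),\qquad (\mathcal K_D^{-\alpha,\omega})^\ast[\phi](x)=\mathrm{p.v.}\int_{\partial D}n_x\cdot\nabla G^{\alpha,\omega}(x-y)\phi(y)\,d\sigma(y),$$ $$\tilde{\mathcal S}_{\tilde D}^{\alpha,\omega}[\psi](x)=\int_{\partial\tilde D}\tilde G^{\alpha,\omega}(x-y)\psi(y)\,d\sigma(y),\qquad (\tilde{\mathcal K}_{\tilde D}^{-\alpha,\omega})^\ast[\psi](x)=\mathrm{p.v.}\int_{\partial\tilde D}n_x\cdot\nabla\tilde G^{\alpha,\omega}(x-y)\psi(y)\,d\sigma(y).$$ The last two are evaluated at all $x\in\partial D$ (values on $\partial D\setminus\partial\tilde D$ are the quasi-periodic extensions with quasi-periodicity $\alpha$ with respect to $\tilde l_1,\tilde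 l_2$). Quasi-periodic subspaces. For $\tilde\alpha\in\mathbb R^2$, $\mathbb L^2_{\tilde\alpha}(\partial D)$ is the set of functions $$f=\chi_{\partial D_1}f_1(y)+e^{i\tilde\alpha\cdot\tilde l_1}\chi_{\partial D_3}f_1(y-\tilde l_1)+e^{i\tilde\alpha\cdot(\tilde l_1-\tilde l_2)}\chi_{\partial D_5}f_1(y-\tilde l_1+\tilde l_2)+\chi_{\partial D_2}f_2(y)+e^{i\tilde\alpha\cdot(\tilde l_1-\tilde l_2)}\chi_{\partial D_4}f_2(y-\tilde l_1+\tilde l_2)+e^{-i\tilde\alpha\cdot\tilde l_2}\chi_{\partial D_6}f_2(y+\tilde l_2)$$ with $f_1\in\mathbb L^2(\partial D_1)$, $f_2\in\mathbb L^2(\partial D_2)$. One has $\mathbb L^2(\partial D)=\mathbb L^2_{\alpha_1+\varepsilon}(\partial D)\oplus\mathbb L^2_{\alpha_2+\varepsilon}(\partial D)\oplus\mathbb L^2_{\varepsilon}(\partial D)$ for small $|\varepsilon|$. *)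

theory Defs
  imports "HOL-Analysis.Analysis"
begin

section \<open>Arc length: the one-dimensional Hausdorff measure\<close>

definition diam_gauge :: "real \<Rightarrow> 'a::metric_space set \<Rightarrow> ennreal" where
  "diam_gauge \<delta> U = (if bounded U \<and> diameter U \<le> \<delta> then ennreal (diameter U) else top)"

text \<open>
  \<^const>\<open>outer_measure\<close> takes the infimum over countable disjoint covers; the gauge is monotone, so
  this is the infimum over all countable covers by sets of diameter at most \<open>\<delta>\<close>.
\<close>

definition hausdorff1 :: "'a::metric_space set \<Rightarrow> ennreal" where
  "hausdorff1 A = (SUP \<delta>\<in>{0<..}. outer_measure UNIV (diam_gauge \<delta>) A)"

definition arclength :: "'a::metric_space measure" where
  "arclength = measure_of UNIV (sets borel) hausdorff1"

lemma diam_gauge_positive: "0 < \<delta> \<Longrightarrow> positive UNIV (diam_gauge \<delta>)"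
  by (simp add: positive_def diam_gauge_def)

lemma diam_gauge_increasing: "increasing UNIV (diam_gauge \<delta>)"
proof (clarsimp simp: increasing_def)
  fix A B :: "'a set" assume AB: "A \<subseteq> B"
  show "diam_gauge \<delta> A \<le> diam_gauge \<delta> B"
  proof (cases "bounded B \<and> diameter B \<le> \<delta>")
    case True
    then have "bounded A" "diameter A \<le> diameter B"
      using AB bounded_subset diameter_subset by blast+
    then show ?thesis using True by (simp add: diam_gauge_def ennreal_leI)
  next
    case False
    then show ?thesis by (auto simp: diam_gauge_def)
  qed
qed

lemma diam_gauge_antimono: "\<delta> \<le> \<eta> \<Longrightarrow> diam_gauge \<eta> A \<le> diam_gauge \<delta> A"
  by (simp add: diam_gauge_def)

lemma ring_UNIV: "ring_of_sets UNIV (UNIV :: 'a set set)"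
  using ring_of_sets_Pow[of "UNIV :: 'a set"] by simp

lemma outer_gauge_antimono:
  "\<delta> \<le> \<eta> \<Longrightarrow> outer_measure UNIV (diam_gauge \<eta>) A \<le> outer_measure UNIV (diam_gauge \<delta>) A"
  unfolding outer_measure_def
  by (intro INF_superset_mono suminf_le diam_gauge_antimono order_refl allI summableI)

lemma outer_measure_space_hausdorff1: "outer_measure_space UNIV (hausdorff1 :: 'a::metric_space set \<Rightarrow> _)"
proof -
  interpret ring_of_sets UNIV "UNIV :: 'a set set" by (rule ring_UNIV)
  have oms: "outer_measure_space UNIV (outer_measure UNIV (diam_gauge \<delta> :: 'a set \<Rightarrow> _))"
    if "0 < \<delta>" for \<delta>
    using outer_measure_space_outer_measure[OF diam_gauge_positive[OF that] diam_gauge_increasing]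
    by simp
  show ?thesis
    unfolding outer_measure_space_def
  proof (intro conjI)
    have "outer_measure UNIV (diam_gauge \<delta>) ({} :: 'a set) = 0" if "0 < \<delta>" for \<delta>
      using oms[OF that] by (auto simp: outer_measure_space_def positive_def)
    then show "positive UNIV (hausdorff1 :: 'a set \<Rightarrow> _)"
      by (auto simp: positive_def hausdorff1_def)
    show "increasing UNIV (hausdorff1 :: 'a set \<Rightarrow> _)"
      unfolding increasing_def hausdorff1_def
    proof safe
      fix x y :: "'a set" assume "x \<subseteq> y"
      then show "(SUP \<delta>\<in>{0<..}. outer_measure UNIV (diam_gauge \<delta>) x)
        \<le> (SUP \<delta>\<in>{0<..}. outer_measure UNIV (diam_gauge \<delta>) y)"
        using oms by (intro SUP_subset_mono order_refl) (auto simp: outer_measure_space_def increasing_def)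
    qed
    show "countably_subadditive UNIV (hausdorff1 :: 'a set \<Rightarrow> _)"
      unfolding countably_subadditive_def
    proof safe
      fix A :: "nat \<Rightarrow> 'a set" assume d: "disjoint_family A"
      show "hausdorff1 (\<Union>i. A i) \<le> (\<Sum>i. hausdorff1 (A i))"
        unfolding hausdorff1_def[of "\<Union>i. A i"]
      proof (rule SUP_least)
        fix \<delta> :: real assume "\<delta> \<in> {0<..}"
        then have \<delta>: "0 < \<delta>" by simp
        have "outer_measure UNIV (diam_gauge \<delta>) (\<Union>i. A i) \<le> (\<Sum>i. outer_measure UNIV (diam_gauge \<delta>) (A i))"
          using oms[OF \<delta>] d by (auto simp: outer_measure_space_def countably_subadditive_def)
        also have "\<dots> \<le> (\<Sum>i. hausdorff1 (A i))"
          unfolding hausdorff1_def using \<delta>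
          by (intro suminf_le summableI allI SUP_upper) auto
        finally show "outer_measure UNIV (diam_gauge \<delta>) (\<Union>i. A i) \<le> (\<Sum>i. hausdorff1 (A i))" .
      qed
    qed
  qed
qed

lemma hausdorff1_mono: "A \<subseteq> B \<Longrightarrow> hausdorff1 A \<le> hausdorff1 B"
  using outer_measure_space_hausdorff1 by (auto simp: outer_measure_space_def increasing_def)

lemma hausdorff1_separated:
  fixes A B :: "'a::metric_space set"
  assumes \<delta>: "0 < \<delta>" and sep: "\<And>x y. x \<in> A \<Longrightarrow> y \<in> B \<Longrightarrow> \<delta> \<le> dist x y"
  shows "hausdorff1 A + hausdorff1 B \<le> hausdorff1 (A \<union> B)"
proof -
  interpret ring_of_sets UNIV "UNIV :: 'a set set" by (rule ring_UNIV)
  let ?o = "\<lambda>\<eta>. outer_measure UNIV (diam_gauge \<eta>)"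
  have small: "?o \<eta> A + ?o \<eta> B \<le> ?o \<eta> (A \<union> B)" if \<eta>: "0 < \<eta>" "\<eta> < \<delta>" for \<eta>
    unfolding outer_measure_def[of _ _ "A \<union> B"]
  proof (rule INF_greatest, clarify)
    fix C :: "nat \<Rightarrow> 'a set" assume C: "A \<union> B \<subseteq> (\<Union>i. C i)"
    note le = outer_measure_le[OF diam_gauge_positive[OF \<eta>(1)] diam_gauge_increasing]
    have "?o \<eta> A + ?o \<eta> B
      \<le> (\<Sum>i. diam_gauge \<eta> (C i \<inter> A)) + (\<Sum>i. diam_gauge \<eta> (C i \<inter> B))"
      using C by (intro add_mono le) auto
    also have "\<dots> = (\<Sum>i. diam_gauge \<eta> (C i \<inter> A) + diam_gauge \<eta> (C i \<inter> B))"
      by (intro suminf_add summableI)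
    also have "\<dots> \<le> (\<Sum>i. diam_gauge \<eta> (C i))"
    proof (intro suminf_le summableI)
      fix i
      show "diam_gauge \<eta> (C i \<inter> A) + diam_gauge \<eta> (C i \<inter> B) \<le> diam_gauge \<eta> (C i)"
      proof (cases "bounded (C i) \<and> diameter (C i) \<le> \<eta>")
        case True
        have "C i \<inter> A = {} \<or> C i \<inter> B = {}"
        proof (rule ccontr)
          assume "\<not> ?thesis"
          then obtain x y where "x \<in> C i" "x \<in> A" "y \<in> C i" "y \<in> B" by auto
          with True sep[of x y] \<eta> diameter_bounded_bound[of "C i" x y] show False by auto
        qed
        moreover have "diam_gauge \<eta> (C i \<inter> X) \<le> diam_gauge \<eta> (C i)" for X
          by (rule increasingD[OF diam_gauge_increasing]) auto
        moreover have "diam_gauge \<eta> ({} :: 'a set) = 0"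
          using \<eta> by (simp add: diam_gauge_def)
        ultimately show ?thesis by auto
      next
        case False
        then have "diam_gauge \<eta> (C i) = top" by (simp only: diam_gauge_def if_False)
        then show ?thesis by simp
      qed
    qed
    finally show "?o \<eta> A + ?o \<eta> B \<le> (\<Sum>i. diam_gauge \<eta> (C i))" .
  qed
  have "hausdorff1 A + hausdorff1 B = (SUP \<eta>\<in>{0<..}. ?o \<eta> A + ?o \<eta> B)"
    unfolding hausdorff1_def
  proof (rule SUP_add_directed_ennreal[symmetric])
    fix i j :: real assume "i \<in> {0<..}" "j \<in> {0<..}"
    then show "\<exists>k\<in>{0<..}. ?o i A + ?o j B \<le> ?o k A + ?o k B"
      by (intro bexI[of _ "min i j"] add_mono outer_gauge_antimono) auto
  qed
  also have "\<dots> \<le> hausdorff1 (A \<union> B)"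
  proof (rule SUP_least)
    fix \<eta> :: real assume \<eta>: "\<eta> \<in> {0<..}"
    define \<eta>' where "\<eta>' = min \<eta> (\<delta>/2)"
    have \<eta>': "0 < \<eta>'" "\<eta>' < \<delta>" "\<eta>' \<le> \<eta>" using \<eta> \<delta> by (auto simp: \<eta>'_def)
    have "?o \<eta> A + ?o \<eta> B \<le> ?o \<eta>' A + ?o \<eta>' B"
      using \<eta>' by (intro add_mono outer_gauge_antimono)
    also have "\<dots> \<le> ?o \<eta>' (A \<union> B)" using \<eta>' by (intro small)
    also have "\<dots> \<le> hausdorff1 (A \<union> B)"
      unfolding hausdorff1_def using \<eta>' by (intro SUP_upper) auto
    finally show "?o \<eta> A + ?o \<eta> B \<le> hausdorff1 (A \<union> B)" .
  qed
  finally show ?thesis .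
qed

lemma closed_in_lambda_hausdorff1:
  fixes F :: "'a::metric_space set"
  assumes "closed F"
  shows "hausdorff1 (A \<inter> F) + hausdorff1 (A - F) \<le> hausdorff1 A"
proof (cases "F = {} \<or> hausdorff1 A = top")
  case True
  have "hausdorff1 ({} :: 'a set) = 0"
    using outer_measure_space_hausdorff1 by (auto simp: outer_measure_space_def positive_def)
  then show ?thesis using True by auto
next
  case False
  then have F: "F \<noteq> {}" and fin: "hausdorff1 A \<noteq> top" by auto
  have oms: "positive UNIV (hausdorff1 :: 'a set \<Rightarrow> _)" "countably_subadditive UNIV (hausdorff1 :: 'a set \<Rightarrow> _)"
    using outer_measure_space_hausdorff1 by (auto simp: outer_measure_space_def)
  have H0: "hausdorff1 ({} :: 'a set) = 0" using oms by (auto simp: positive_def)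
  define E where "E n = {x \<in> A. 1 / real (n + 1) \<le> infdist x F}" for n
  define R where "R n = {x \<in> A. 1 / real (n + 2) \<le> infdist x F \<and> infdist x F < 1 / real (n + 1)}" for n
  have inf_dist: "infdist x F - infdist y F \<le> dist x y" for x y
    using infdist_triangle_abs[of x F y] by linarith
  have first: "hausdorff1 (A \<inter> F) + hausdorff1 (E n) \<le> hausdorff1 A" for n
  proof -
    have "hausdorff1 (A \<inter> F) + hausdorff1 (E n) \<le> hausdorff1 ((A \<inter> F) \<union> E n)"
    proof (rule hausdorff1_separated)
      show "0 < 1 / real (n + 1)" by simp
      fix x y assume "x \<in> A \<inter> F" "y \<in> E n"
      then show "1 / real (n + 1) \<le> dist x y"
        using infdist_le[of x F y] by (auto simp: E_def dist_commute)
    qed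
    also have "\<dots> \<le> hausdorff1 A" by (rule hausdorff1_mono) (auto simp: E_def)
    finally show ?thesis .
  qed
  have parity: "(\<Sum>k<N. hausdorff1 (R (2 * k + p))) \<le> hausdorff1 (\<Union>k<N. R (2 * k + p))" for N p
  proof (induction N)
    case 0 then show ?case by simp
  next
    case (Suc N)
    have "hausdorff1 (\<Union>k<N. R (2 * k + p)) + hausdorff1 (R (2 * N + p))
      \<le> hausdorff1 ((\<Union>k<N. R (2 * k + p)) \<union> R (2 * N + p))"
    proof (cases "N = 0")
      case False
      show ?thesis
      proof (rule hausdorff1_separated)
        show "0 < 1 / real (2 * N + p) - 1 / real (2 * N + p + 1)"
          using False by (simp add: divide_strict_left_mono)
        fix x y assume "x \<in> (\<Union>k<N. R (2 * k + p))" and y: "y \<in> R (2 * N + p)"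
        then obtain k where k: "k < N" "x \<in> R (2 * k + p)" by auto
        have "1 / real (2 * N + p) \<le> 1 / real (2 * k + p + 2)"
          using k(1) by (intro divide_left_mono) auto
        also have "\<dots> \<le> infdist x F" using k(2) by (simp add: R_def)
        finally show "1 / real (2 * N + p) - 1 / real (2 * N + p + 1) \<le> dist x y"
          using y inf_dist[of x y] by (simp add: R_def)
      qed
    qed (simp add: H0)
    also have "(\<Union>k<N. R (2 * k + p)) \<union> R (2 * N + p) = (\<Union>k<Suc N. R (2 * k + p))"
      by (auto simp: less_Suc_eq)
    finally show ?case using Suc by (simp add: add.commute) (meson add_left_mono order_trans)
  qed
  define f where "f k = hausdorff1 (R k)" for k
  have par: "(\<Sum>k<N. f (2 * k + p)) \<le> hausdorff1 A" for N p
    unfolding f_def by (rule order_trans[OF parity hausdorff1_mono]) (auto simp: R_def)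
  have split_sum: "(\<Sum>k<2 * N. f k) = (\<Sum>k<N. f (2 * k + 0)) + (\<Sum>k<N. f (2 * k + 1))" for N
    by (induction N) (auto simp: ac_simps)
  have part: "(\<Sum>k<n. f k) \<le> hausdorff1 A + hausdorff1 A" for n
  proof -
    have "(\<Sum>k<n. f k) \<le> (\<Sum>k<2 * n. f k)" by (intro sum_mono2) auto
    also have "\<dots> \<le> hausdorff1 A + hausdorff1 A"
      unfolding split_sum by (intro add_mono par)
    finally show ?thesis .
  qed
  have total: "(\<Sum>k. f k) \<noteq> top"
  proof -
    have "(\<Sum>k. f k) \<le> hausdorff1 A + hausdorff1 A"
      by (intro suminf_le_const summableI part)
    also have "\<dots> < top" using fin by (simp add: less_top)
    finally show ?thesis by simp
  qed
  have tail: "(\<lambda>n. \<Sum>k. f (k + n)) \<longlonglongrightarrow> 0"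
  proof -
    have ftop: "f k \<noteq> top" for k
      using total by (metis ennreal_suminf_lessD less_top)
    then have fe: "f k = ennreal (enn2real (f k))" for k by (simp add: less_top)
    have sm: "summable (\<lambda>k. enn2real (f k))"
      by (rule summable_suminf_not_top) (use fe total in auto)
    have "(\<lambda>n. \<Sum>k. enn2real (f (k + n))) \<longlonglongrightarrow> 0"
      by (rule suminf_exist_split2[OF sm])
    then have "(\<lambda>n. ennreal (\<Sum>k. enn2real (f (k + n)))) \<longlonglongrightarrow> ennreal 0"
      by (intro tendsto_ennrealI)
    moreover have "ennreal (\<Sum>k. enn2real (f (k + n))) = (\<Sum>k. f (k + n))" for n
    proof -
      have "(\<Sum>k. ennreal (enn2real (f (k + n)))) = ennreal (\<Sum>k. enn2real (f (k + n)))"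
        using sm by (intro suminf_ennreal2) (auto simp: summable_iff_shift[of "\<lambda>k. enn2real (f k)"])
      then show ?thesis using fe by simp
    qed
    ultimately show ?thesis by simp
  qed
  have cover: "A - F \<subseteq> E n \<union> (\<Union>k. R (k + n))" for n
  proof
    fix x assume x: "x \<in> A - F"
    then have pos: "0 < infdist x F"
      using assms F by (simp add: infdist_pos_not_in_closed)
    show "x \<in> E n \<union> (\<Union>k. R (k + n))"
    proof (cases "x \<in> E n")
      case False
      obtain m where m: "1 / real (m + 1) \<le> infdist x F"
        using reals_Archimedean[OF pos] by (metis Suc_eq_plus1 inverse_eq_divide less_imp_le)
      define l where "l = (LEAST m. 1 / real (m + 1) \<le> infdist x F)"
      have l: "1 / real (l + 1) \<le> infdist x F" unfolding l_def by (rule LeastI, rule m)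
      have lt: "infdist x F < 1 / real (j + 1)" if "j < l" for j
        using not_less_Least[of j "\<lambda>m. 1 / real (m + 1) \<le> infdist x F"] that
        by (auto simp: l_def)
      have "n < l"
      proof (rule ccontr)
        assume "\<not> n < l"
        then have "1 / real (n + 1) \<le> 1 / real (l + 1)" by (intro divide_left_mono) auto
        with l False x show False by (auto simp: E_def)
      qed
      then obtain j where j: "l = Suc (j + n)" by (metis add.commute less_iff_Suc_add)
      have "x \<in> R (j + n)"
        using l lt[of "j + n"] x j by (auto simp: R_def add.commute)
      then show ?thesis by blast
    qed simp
  qed
  have bound: "hausdorff1 (A \<inter> F) + hausdorff1 (A - F) \<le> hausdorff1 A + (\<Sum>k. f (k + n))" for n
  proof -
    have disj: "disjoint_family (\<lambda>k. R (k + n))"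
      unfolding disjoint_family_on_def
    proof (intro ballI impI)
      have *: "R a \<inter> R b = {}" if "a < b" for a b
      proof -
        have "1 / real (b + 1) \<le> 1 / real (a + 2)" using that by (intro divide_left_mono) auto
        then show ?thesis by (auto simp: R_def)
      qed
      fix a b :: nat assume "a \<noteq> b"
      then show "R (a + n) \<inter> R (b + n) = {}"
        using *[of "a + n" "b + n"] *[of "b + n" "a + n"] by (cases "a < b") auto
    qed
    have sub: "subadditive UNIV (hausdorff1 :: 'a set \<Rightarrow> _)"
    proof -
      interpret ring_of_sets UNIV "UNIV :: 'a set set" by (rule ring_UNIV)
      show ?thesis by (rule countably_subadditive_subadditive[OF oms])
    qed
    have "hausdorff1 (A - F) \<le> hausdorff1 (E n \<union> (\<Union>k. R (k + n)))"
      by (rule hausdorff1_mono[OF cover])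
    also have "\<dots> \<le> hausdorff1 (E n) + hausdorff1 (\<Union>k. R (k + n))"
    proof (rule subadditiveD[OF sub])
      have "R (k + n) \<inter> E n = {}" for k
      proof -
        have "1 / real (k + n + 1) \<le> 1 / real (n + 1)" by (intro divide_left_mono) auto
        then show ?thesis by (auto simp: R_def E_def)
      qed
      then show "E n \<inter> (\<Union>k. R (k + n)) = {}" by blast
    qed auto
    also have "hausdorff1 (\<Union>k. R (k + n)) \<le> (\<Sum>k. f (k + n))"
      using oms(2) disj unfolding countably_subadditive_def f_def by blast
    finally have "hausdorff1 (A - F) \<le> hausdorff1 (E n) + (\<Sum>k. f (k + n))"
      by (simp add: add_left_mono)
    then have "hausdorff1 (A \<inter> F) + hausdorff1 (A - F)
      \<le> (hausdorff1 (A \<inter> F) + hausdorff1 (E n)) + (\<Sum>k. f (k + n))"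
      by (simp add: add_left_mono add.assoc)
    also have "\<dots> \<le> hausdorff1 A + (\<Sum>k. f (k + n))"
      by (intro add_right_mono first)
    finally show ?thesis .
  qed
  have "(\<lambda>n. hausdorff1 A + (\<Sum>k. f (k + n))) \<longlonglongrightarrow> hausdorff1 A + 0"
    by (intro tendsto_add tendsto_const tail)
  then show ?thesis
    using bound by (intro LIMSEQ_le_const[of _ "hausdorff1 A"]) auto
qed

lemma measure_space_hausdorff1: "measure_space UNIV (sets borel) (hausdorff1 :: 'a::metric_space set \<Rightarrow> _)"
proof -
  let ?L = "lambda_system UNIV UNIV (hausdorff1 :: 'a set \<Rightarrow> _)"
  interpret sigma_algebra UNIV "UNIV :: 'a set set"
    using sigma_algebra_Pow[of "UNIV :: 'a set"] by simp
  have ms: "measure_space UNIV ?L hausdorff1"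
    by (rule caratheodory_lemma[OF outer_measure_space_hausdorff1])
  then interpret L: sigma_algebra UNIV ?L by (simp add: measure_space_def)
  have "F \<in> ?L" if "closed F" for F
  proof -
    have "hausdorff1 (A \<inter> F) + hausdorff1 (A - F) = hausdorff1 A" for A
    proof (rule antisym[OF closed_in_lambda_hausdorff1[OF that]])
      have "subadditive UNIV (hausdorff1 :: 'a set \<Rightarrow> _)"
        using outer_measure_space_hausdorff1 countably_subadditive_subadditive
        by (auto simp: outer_measure_space_def)
      from subadditiveD[OF this, of "A \<inter> F" "A - F"]
      have "hausdorff1 ((A \<inter> F) \<union> (A - F)) \<le> hausdorff1 (A \<inter> F) + hausdorff1 (A - F)"
        by auto
      then show "hausdorff1 A \<le> hausdorff1 (A \<inter> F) + hausdorff1 (A - F)"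
        by (simp add: Int_Diff_Un)
    qed
    then show ?thesis by (simp add: lambda_system_eq)
  qed
  then have "sets borel \<subseteq> ?L"
    unfolding borel_eq_closed using L.sigma_sets_subset[of "Collect closed"] by auto
  moreover have "sigma_algebra UNIV (sets (borel :: 'a measure))"
    using sets.sigma_algebra_axioms[of "borel :: 'a measure"] by simp
  ultimately show ?thesis using measure_down[OF ms] by blast
qed

lemma sets_arclength [measurable_cong]: "sets arclength = sets borel"
  and space_arclength [simp]: "space arclength = UNIV"
  by (simp_all add: arclength_def sets.sigma_sets_eq[of borel, simplified])

lemma emeasure_arclength: "A \<in> sets borel \<Longrightarrow> emeasure arclength A = hausdorff1 A"
  unfolding arclength_def using measure_space_hausdorff1
  by (intro emeasure_measure_of_sigma) (auto simp: measure_space_def)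


section \<open>The honeycomb geometry\<close>

definition l1 :: "real^2" where "l1 = vector [1/2, - sqrt 3 / 2]"
definition l2 :: "real^2" where "l2 = vector [1/2, sqrt 3 / 2]"

definition lattice :: "real^2 \<Rightarrow> real^2 \<Rightarrow> (real^2) set" where
  "lattice a b = {of_int m *\<^sub>R a + of_int n *\<^sub>R b | (m::int) (n::int). True}"

definition hexY :: "(real^2) set" where
  "hexY = convex hull
     {(1/3) *\<^sub>R (- l1 + l2), - ((1/3) *\<^sub>R (- l1 + l2)),
      (1/3) *\<^sub>R (l1 + 2 *\<^sub>R l2), - ((1/3) *\<^sub>R (l1 + 2 *\<^sub>R l2)),
      (1/3) *\<^sub>R (2 *\<^sub>R l1 + l2), - ((1/3) *\<^sub>R (2 *\<^sub>R l1 + l2))}"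

definition rotR :: "real^2^2" where
  "rotR = vector [vector [1/2, sqrt 3 / 2], vector [- sqrt 3 / 2, 1/2]]"

definition reflTx :: "real^2^2" where
  "reflTx = vector [vector [1, 0], vector [0, -1]]"

definition tl1 :: "real^2" where "tl1 = (1/3) *\<^sub>R (2 *\<^sub>R l1 + l2)"
definition tl2 :: "real^2" where "tl2 = (1/3) *\<^sub>R (l1 + 2 *\<^sub>R l2)"

text \<open>\<open>inclusion D0 j\<close> is \<open>D\<^sub>j\<close>, meant for \<open>1 \<le> j \<le> 6\<close>.\<close>

definition inclusion :: "(real^2) set \<Rightarrow> nat \<Rightarrow> (real^2) set" where
  "inclusion D0 j = (((*v) rotR) ^^ (j - 1)) ` ((\<lambda>x. x - (1/3) *\<^sub>R l1) ` D0)"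

definition honeycomb :: "(real^2) set \<Rightarrow> (real^2) set" where
  "honeycomb D0 = (\<Union>j\<in>{1..6}. inclusion D0 j)"

definition honeycomb_red :: "(real^2) set \<Rightarrow> (real^2) set" where
  "honeycomb_red D0 = inclusion D0 1 \<union> inclusion D0 2"

definition smooth_arc :: "(real \<Rightarrow> real^2) \<Rightarrow> bool" where
  "smooth_arc g \<longleftrightarrow> arc g \<and>
     (\<exists>d :: nat \<Rightarrow> real \<Rightarrow> real^2. d 0 = g \<and>
        (\<forall>k. \<forall>t\<in>{0..1}. (d k has_vector_derivative d (Suc k) t) (at t within {0..1})) \<and>
        (\<forall>t\<in>{0..1}. d 1 t \<noteq> 0))"

text \<open>
  The boundary consists of finitely many regular \<open>C\<^sup>\<infinity>\<close> arcs meeting only at end points;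
  \<open>interior (closure D) = D\<close> says that \<open>D\<close> lies on one side of each of them (no slits).
\<close>

definition piecewise_smooth_boundary :: "(real^2) set \<Rightarrow> bool" where
  "piecewise_smooth_boundary D \<longleftrightarrow> interior (closure D) = D \<and>
     (\<exists>\<Gamma>. finite \<Gamma> \<and> (\<forall>g\<in>\<Gamma>. smooth_arc g) \<and> frontier D = (\<Union>g\<in>\<Gamma>. path_image g) \<and>
        (\<forall>g\<in>\<Gamma>. \<forall>h\<in>\<Gamma>. g \<noteq> h \<longrightarrow>
           path_image g \<inter> path_image h \<subseteq> {pathstart g, pathfinish g} \<inter> {pathstart h, pathfinish h}))"

text \<open>
  Near \<open>x\<close>, the set \<open>D\<close> agrees with the half-plane \<open>(y - x) \<bullet> n < 0\<close> outside every cone around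
  the line through \<open>x\<close> orthogonal to \<open>n\<close>. This holds for at most one unit vector \<open>n\<close>; for a
  piecewise smooth boundary the only points without normal are the corners.
\<close>

definition is_outward_normal :: "(real^2) set \<Rightarrow> real^2 \<Rightarrow> real^2 \<Rightarrow> bool" where
  "is_outward_normal D x n \<longleftrightarrow> norm n = 1 \<and>
     (\<forall>\<eta>>0. \<exists>\<delta>>0. \<forall>y. norm (y - x) < \<delta> \<longrightarrow>
        ((y - x) \<bullet> n < - \<eta> * norm (y - x) \<longrightarrow> y \<in> D) \<and>
        ((y - x) \<bullet> n > \<eta> * norm (y - x) \<longrightarrow> y \<notin> D))"

definition outward_normal :: "(real^2) set \<Rightarrow> real^2 \<Rightarrow> real^2" where
  "outward_normal D x = (THE n. is_outward_normal D x n)"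

section \<open>Green's functions\<close>

text \<open>
  The series over the dual lattice \<open>L\<close> converges only conditionally; it is summed in the order of
  increasing \<open>|\<alpha> + q|\<close>. For \<open>\<alpha> = 0\<close>, \<open>\<omega> = 0\<close> the term \<open>q = 0\<close> is left out.
\<close>

definition green :: "real \<Rightarrow> (real^2) set \<Rightarrow> real^2 \<Rightarrow> complex \<Rightarrow> real^2 \<Rightarrow> complex" where
  "green c L \<alpha> \<omega> x = Lim at_top (\<lambda>r::real. of_real c *
     (\<Sum>q \<in> {q \<in> L. norm (\<alpha> + q) \<le> r \<and> (\<alpha> = 0 \<and> \<omega> = 0 \<longrightarrow> q \<noteq> 0)}.
        cis ((\<alpha> + q) \<bullet> x) / (\<omega>\<^sup>2 - of_real ((norm (\<alpha> + q))\<^sup>2))))"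

definition green_qp :: "real^2 \<Rightarrow> real^2 \<Rightarrow> real^2 \<Rightarrow> complex \<Rightarrow> real^2 \<Rightarrow> complex" where
  "green_qp k1 k2 = green (1 / measure lborel hexY) (lattice k1 k2)"

definition green_red :: "real^2 \<Rightarrow> real^2 \<Rightarrow> real^2 \<Rightarrow> complex \<Rightarrow> real^2 \<Rightarrow> complex" where
  "green_red k1 k2 = green (3 / measure lborel hexY) (lattice (2 *\<^sub>R k1 - k2) (2 *\<^sub>R k2 - k1))"

section \<open>Layer potentials\<close>

definition single_layer ::
  "(real^2 \<Rightarrow> complex) \<Rightarrow> (real^2) set \<Rightarrow> (real^2 \<Rightarrow> complex) \<Rightarrow> real^2 \<Rightarrow> complex" where
  "single_layer g \<Gamma> \<phi> x = (LINT y:\<Gamma>|arclength. g (x - y) * \<phi> y)"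

text \<open>
  The kernel \<open>n \<cdot> \<nabla>g(x - y)\<close> is singular where \<open>x - y\<close> lies in the period lattice \<open>P\<close> of \<open>g\<close>, and
  the principal value removes \<open>\<delta>\<close>-discs around these points. Using all of \<open>x + P\<close> rather than \<open>x\<close>
  alone matters when \<open>x\<close> is not itself on \<open>\<Gamma>\<close> but has a translate there: since \<open>g\<close> is
  quasi-periodic, the value at \<open>x\<close> is then the quasi-periodic extension of the value on \<open>\<Gamma>\<close>.
\<close>

definition normal_layer_pv ::
  "(real^2 \<Rightarrow> complex) \<Rightarrow> (real^2) set \<Rightarrow> (real^2) set \<Rightarrow> real^2 \<Rightarrow> (real^2 \<Rightarrow> complex) \<Rightarrow> real^2 \<Rightarrow> complex"
  where
  "normal_layer_pv g P \<Gamma> n \<phi> x = Lim (at_right 0) (\<lambda>\<delta>.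
     LINT y:{y \<in> \<Gamma>. \<forall>p\<in>P. \<delta> \<le> norm (x - y - p)}|arclength.
       frechet_derivative g (at (x - y)) n * \<phi> y)"

definition S_D where
  "S_D k1 k2 D0 \<alpha> \<omega> = single_layer (green_qp k1 k2 \<alpha> \<omega>) (frontier (honeycomb D0))"

definition S_red where
  "S_red k1 k2 D0 \<alpha> \<omega> = single_layer (green_red k1 k2 \<alpha> \<omega>) (frontier (honeycomb_red D0))"

text \<open>
  Sign convention: \<open>K_adj k1 k2 D0 \<beta> \<omega>\<close> is the operator with superscripts \<open>\<beta>, \<omega>\<close>, whose kernel is
  built from the Green's function with quasi-momentum \<open>- \<beta>\<close>.
\<close>

definition K_adj where
  "K_adj k1 k2 D0 \<beta> \<omega> \<phi> x =
     normal_layer_pv (green_qp k1 k2 (- \<beta>) \<omega>) (lattice l1 l2) (frontier (honeycomb D0))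
       (outward_normal (honeycomb D0) x) \<phi> x"

definition K_adj_red where
  "K_adj_red k1 k2 D0 \<beta> \<omega> \<psi> x =
     normal_layer_pv (green_red k1 k2 (- \<beta>) \<omega>) (lattice tl1 tl2) (frontier (honeycomb_red D0))
       (outward_normal (honeycomb D0) x) \<psi> x"

section \<open>Quasi-periodic subspaces\<close>

text \<open>
  Elements of \<open>L\<^sup>2\<close> are represented by functions on the whole plane whose values off \<open>\<Gamma>\<close> are
  irrelevant, and equality in \<open>L\<^sup>2\<close> is equality almost everywhere on \<open>\<Gamma>\<close>. In particular
  restriction to \<open>\<Gamma>' \<subseteq> \<Gamma>\<close> does not change the representative.
\<close>

definition L2 :: "(real^2) set \<Rightarrow> (real^2 \<Rightarrow> complex) set" where
  "L2 \<Gamma> = {f. set_borel_measurable arclength \<Gamma> f \<and>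
              set_integrable arclength \<Gamma> (\<lambda>y. (norm (f y))\<^sup>2)}"

definition eq_ae_on :: "(real^2) set \<Rightarrow> (real^2 \<Rightarrow> complex) \<Rightarrow> (real^2 \<Rightarrow> complex) \<Rightarrow> bool" where
  "eq_ae_on \<Gamma> f g \<longleftrightarrow> (AE y in arclength. y \<in> \<Gamma> \<longrightarrow> f y = g y)"

definition L2_qp :: "(real^2) set \<Rightarrow> real^2 \<Rightarrow> (real^2 \<Rightarrow> complex) set" where
  "L2_qp D0 \<alpha> = {f \<in> L2 (frontier (honeycomb D0)).
     \<exists>f1 \<in> L2 (frontier (inclusion D0 1)). \<exists>f2 \<in> L2 (frontier (inclusion D0 2)).
       eq_ae_on (frontier (honeycomb D0)) f (\<lambda>y.
           indicator (frontier (inclusion D0 1)) y * f1 y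
         + cis (\<alpha> \<bullet> tl1) * indicator (frontier (inclusion D0 3)) y * f1 (y - tl1)
         + cis (\<alpha> \<bullet> (tl1 - tl2)) * indicator (frontier (inclusion D0 5)) y * f1 (y - tl1 + tl2)
         + indicator (frontier (inclusion D0 2)) y * f2 y
         + cis (\<alpha> \<bullet> (tl1 - tl2)) * indicator (frontier (inclusion D0 4)) y * f2 (y - tl1 + tl2)
         + cis (- (\<alpha> \<bullet> tl2)) * indicator (frontier (inclusion D0 6)) y * f2 (y + tl2))}"

definition qp_decomposition ::
  "real^2 \<Rightarrow> real^2 \<Rightarrow> (real^2) set \<Rightarrow> real^2 \<Rightarrow> (real^2 \<Rightarrow> complex) \<Rightarrow>
   (real^2 \<Rightarrow> complex) \<Rightarrow> (real^2 \<Rightarrow> complex) \<Rightarrow> (real^2 \<Rightarrow> complex) \<Rightarrow> bool" where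
  "qp_decomposition k1 k2 D0 \<epsilon> \<phi> \<phi>1 \<phi>2 \<phi>3 \<longleftrightarrow>
     \<phi>1 \<in> L2_qp D0 (k1 + \<epsilon>) \<and> \<phi>2 \<in> L2_qp D0 (k2 + \<epsilon>) \<and> \<phi>3 \<in> L2_qp D0 (0 + \<epsilon>) \<and>
     eq_ae_on (frontier (honeycomb D0)) \<phi> (\<lambda>y. \<phi>1 y + \<phi>2 y + \<phi>3 y)"

end

theory Submission
  imports Defs
begin

text \<open>
  For \<open>q\<close> in the dual lattice, the characters \<open>cis ((\<alpha> - q) \<bullet> t)\<close>, summed over three representatives
  \<open>t\<close> of the finer lattice modulo the period lattice, give 3 or 0, according to whether \<open>q\<close> lies in the
  class of \<open>\<alpha>\<close> modulo the coarser dual lattice. Hence the reduced Green's function is a combination of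
  three translates of \<open>G\<close>, disc sum by disc sum, and both identities follow by translating the boundary
  pieces, provided that the series converge and the integrals exist.

  Convergence and regularity come from summation by parts: multiplying a lattice series by
  \<open>cis (k \<bullet> z) - 1\<close> replaces its coefficients by their differences, which decay faster by one power.
  Differences sum to zero, so a Hoelder estimate bounds \<open>G\<close> and its gradient near the origin by
  \<open>|z|\<close> to the power \<open>-1/4\<close> and \<open>-5/4\<close>; for the angular derivative the power is even \<open>3/4\<close>, because
  the coefficients are radial. As \<open>n \<bullet> (x - y)\<close> is quadratically small along the boundary, both kernels
  are square integrable, and the principal value is an ordinary integral.
\<close>

section \<open>Trigonometric series over a lattice\<close>

text \<open>The gradient bound with exponent -5/4 is not integrable along a curve, so size alone
  does not tame the normal kernel. For \<open>x\<close>, \<open>y\<close> on one arc the difference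
  \<open>z = x - y\<close> is almost tangential, and the normal derivative is then almost the
  angular one, in direction \<open>rot90 z\<close>. This derivative is, to leading order, a series
  of first differences; its value at the origin cannot be removed by telescoping, because gradient
  coefficients are so large that the boundary terms of a disc need not vanish. It is removed by
  periodicity on circles instead. The fractional exponents come from one number. The common majorant
  is \<open>wt\<close> to the power -9/8, just beyond the power -1 at which absolute convergence in
  the plane begins. Coefficients of decay 3/2 leave a surplus of 3/8, that is Hoelder exponent 3/4,
  and division by one or two factors of size |z| gives -1/4 and -5/4. The exponent -1/4 suffices,
  since its double -1/2 is still integrable on a curve. The reduced Green's functions need no
  analysis of their own: every estimate concerns the lattice of \<open>k1\<close>, \<open>k2\<close>
  shifted by the single vector \<open>e\<close>.\<close>

lemma norm_cis_minus_1_le: "norm (cis t - 1) \<le> \<bar>t\<bar>"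
  using Taylor_exp[of "\<i> * of_real t" 0] by (simp add: cis_conv_exp norm_mult)

lemma norm_cis_taylor_le: "norm (cis t - 1 - \<i> * of_real t) \<le> t\<^sup>2"
  using Taylor_exp[of "\<i> * of_real t" 1] by (simp add: cis_conv_exp norm_mult power2_eq_square diff_diff_eq)

text \<open>Interpolation between the Lipschitz bound |t| and the trivial bound 2. A small exponent
  \<open>s\<close> costs little decay when the bound is summed over frequencies.\<close>

lemma norm_cis_minus_1_powr_le:
  assumes "0 < s" "s \<le> 1"
  shows "norm (cis t - 1) \<le> 2 * \<bar>t\<bar> powr s"
proof (cases "\<bar>t\<bar> \<le> 1")
  case True
  have "\<bar>t\<bar> powr 1 \<le> \<bar>t\<bar> powr s" using True assms by (cases "t = 0") (use powr_mono'[of s 1 "\<bar>t\<bar>"] in auto)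
  then show ?thesis using norm_cis_minus_1_le[of t] powr_ge_zero[of "\<bar>t\<bar>" s] by simp
next
  case False
  then have "1 \<le> \<bar>t\<bar> powr s" using assms by (intro ge_one_powr_ge_zero) auto
  moreover have "norm (cis t - 1) \<le> 2" using norm_triangle_ineq4[of "cis t" 1] by simp
  ultimately show ?thesis by linarith
qed

text \<open>Interpolation between the quadratic Taylor bound near 0 and linear growth far out. Any
  exponent above 1 yields differentiability; 5/4 is used.\<close>

lemma norm_cis_taylor_powr_le:
  assumes "1 \<le> s" "s \<le> 2"
  shows "norm (cis t - 1 - \<i> * of_real t) \<le> 3 * \<bar>t\<bar> powr s"
proof (cases "\<bar>t\<bar> \<le> 1")
  case True
  have "\<bar>t\<bar> powr 2 \<le> \<bar>t\<bar> powr s" using True assms by (cases "t = 0") (use powr_mono'[of s 2 "\<bar>t\<bar>"] in auto)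
  then have "t\<^sup>2 \<le> \<bar>t\<bar> powr s" by (simp add: powr_numeral)
  then show ?thesis using norm_cis_taylor_le[of t] powr_ge_zero[of "\<bar>t\<bar>" s] by linarith
next
  case False
  then have "\<bar>t\<bar> powr 1 \<le> \<bar>t\<bar> powr s" using assms by (intro powr_mono) auto
  moreover have "norm (cis t - 1 - \<i> * of_real t) \<le> 2 + \<bar>t\<bar>"
    using norm_triangle_ineq4[of "cis t - 1" "\<i> * of_real t"] norm_triangle_ineq4[of "cis t" 1]
    by (simp add: norm_mult)
  ultimately show ?thesis using False by simp
qed

text \<open>Peetre's inequality: the weight \<open>1 + x^2\<close> changes under a displacement of
  length \<open>b\<close> by at most a factor depending on \<open>b\<close> alone.\<close>

lemma one_plus_sq_le:
  fixes x :: real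
  assumes "0 \<le> x" "x \<le> y + b"
  shows "1 + x\<^sup>2 \<le> 2 * (1 + b\<^sup>2) * (1 + y\<^sup>2)"
proof -
  have "x\<^sup>2 \<le> (y + b)\<^sup>2" using assms by (intro power_mono)
  also have "\<dots> \<le> 2 * y\<^sup>2 + 2 * b\<^sup>2"
    using sum_squares_bound[of y b] by (simp add: power2_sum)
  finally have "x\<^sup>2 \<le> 2 * y\<^sup>2 + 2 * b\<^sup>2" .
  moreover have "0 \<le> b\<^sup>2 * y\<^sup>2" by simp
  moreover have "2 * (1 + b\<^sup>2) * (1 + y\<^sup>2) = 2 + 2 * y\<^sup>2 + 2 * b\<^sup>2 + 2 * (b\<^sup>2 * y\<^sup>2)"
    by (simp add: algebra_simps)
  ultimately show ?thesis by linarith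
qed

lemma summable_on_diff_complex:
  fixes f g :: "_ \<Rightarrow> complex"
  assumes "f summable_on A" "g summable_on A"
  shows "(\<lambda>x. f x - g x) summable_on A"
  using summable_on_add[of f A "\<lambda>x. - g x"] assms by (simp add: summable_on_uminus)

lemma infsum_diff_complex:
  fixes f g :: "_ \<Rightarrow> complex"
  assumes "f summable_on A" "g summable_on A"
  shows "infsum (\<lambda>x. f x - g x) A = infsum f A - infsum g A"
  using infsum_add[of f A "\<lambda>x. - g x"] assms by (simp add: infsum_uminus summable_on_uminus)

text \<open>In powers of |m| the exponent is -9/8. The product of two such series majorizes the
  series over the planar lattice.\<close>

lemma summable_on_int_one_plus_sq_powr:
  "(\<lambda>m::int. (1 + (real_of_int m)\<^sup>2) powr (-9/16)) summable_on UNIV"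
proof -
  let ?f = "\<lambda>m::int. (1 + (real_of_int m)\<^sup>2) powr (-9/16)"
  have "summable (\<lambda>n. real n powr (-9/8))" by (simp add: summable_real_powr_iff)
  then have "summable (\<lambda>n. 1 * norm (?f (int n)))"
  proof (rule summable_comparison_test_ev[rotated])
    have "1 * norm (?f (int n)) \<le> real n powr (-9/8)" if "1 \<le> n" for n
    proof -
      have "real n powr (-9/8) = ((real n)\<^sup>2) powr (-9/16)"
        using that powr_powr[of "real n" 2 "-9/16"] by (simp add: powr_numeral)
      moreover have "(1 + (real n)\<^sup>2) powr (-9/16) \<le> ((real n)\<^sup>2) powr (-9/16)"
        using that by (intro powr_mono2') auto
      ultimately show ?thesis by simp
    qed
    then show "\<forall>\<^sub>F n in sequentially. norm (1 * norm (?f (int n))) \<le> real n powr (-9/8)"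
      unfolding eventually_sequentially by (intro exI[of _ 1]) auto
  qed
  then have nat: "(\<lambda>n. ?f (int n)) summable_on UNIV"
    by (intro summable_nonneg_imp_summable_on) auto
  have pos: "?f summable_on range int"
    using nat by (subst summable_on_reindex) (auto simp: o_def)
  have neg: "?f summable_on range (\<lambda>n. - int n)"
    using nat by (subst summable_on_reindex) (auto simp: o_def inj_def)
  have "UNIV = range int \<union> range (\<lambda>n. - int n)"
    by (auto simp: image_iff) (metis int_cases2)
  then show ?thesis
    using summable_on_Un_disjoint[of ?f "range int" "range (\<lambda>n. - int n) - range int"]
      summable_on_subset_banach[OF neg, of "range (\<lambda>n. - int n) - range int"] pos
    by (metis Diff_disjoint Diff_subset Un_Diff_cancel)
qed

section \<open>Dual lattices, decay classes and absolutely convergent series\<close>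

definition rot90 :: "real^2 \<Rightarrow> real^2" where "rot90 v = vector [- v$2, v$1]"

lemma rot90_component [simp]: "rot90 v $ 1 = - v$2" "rot90 v $ 2 = v$1"
  by (simp_all add: rot90_def)

lemma linear_rot90: "linear rot90"
  by (rule linearI) (simp_all add: vec_eq_iff forall_2)

lemma inner_real2: "(v::real^2) \<bullet> w = v$1 * w$1 + v$2 * w$2"
  by (simp add: inner_vec_def sum_2)

lemma inner_rot90_self [simp]: "v \<bullet> rot90 v = 0"
  by (simp add: inner_real2)

lemma norm_rot90 [simp]: "norm (rot90 v) = norm v"
  by (simp add: norm_eq_sqrt_inner inner_real2)

text \<open>Here \<open>a1\<close>, \<open>a2\<close> span the period lattice, \<open>k1\<close>,
  \<open>k2\<close> its dual, and \<open>e\<close> is the quasi-momentum. A second instance, with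
  the finer period lattice, is used for closedness of that lattice.\<close>

locale dual_lattice =
  fixes a1 a2 k1 k2 e :: "real^2"
  assumes dual: "k1 \<bullet> a1 = 2 * pi" "k1 \<bullet> a2 = 0" "k2 \<bullet> a1 = 0" "k2 \<bullet> a2 = 2 * pi"
begin

text \<open>Both sides have the same inner products with \<open>k1\<close> and \<open>k2\<close>,
  and these are independent: the determinants of the two bases multiply to
  \<open>(2 * pi)^2\<close>.\<close>

lemma dual_expand: "(2 * pi) *\<^sub>R z = (k1 \<bullet> z) *\<^sub>R a1 + (k2 \<bullet> z) *\<^sub>R a2"
proof -
  define w where "w = (2 * pi) *\<^sub>R z - ((k1 \<bullet> z) *\<^sub>R a1 + (k2 \<bullet> z) *\<^sub>R a2)"
  have 1: "k1 \<bullet> w = 0" "k2 \<bullet> w = 0"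
    unfolding w_def inner_diff_right inner_add_right inner_scaleR_right dual by simp_all
  define D where "D = k1$1 * k2$2 - k1$2 * k2$1"
  have "D * (a1$1 * a2$2 - a1$2 * a2$1) = (k1 \<bullet> a1) * (k2 \<bullet> a2) - (k1 \<bullet> a2) * (k2 \<bullet> a1)"
    unfolding inner_real2 D_def by algebra
  then have "D \<noteq> 0" unfolding dual by auto
  moreover have "D * w$1 = k2$2 * (k1 \<bullet> w) - k1$2 * (k2 \<bullet> w)" "D * w$2 = k1$1 * (k2 \<bullet> w) - k2$1 * (k1 \<bullet> w)"
    unfolding inner_real2 D_def by algebra+
  ultimately have "w = 0" using 1 by (simp add: vec_eq_iff forall_2)
  then show ?thesis by (simp add: w_def)
qed

definition dvec :: "int \<times> int \<Rightarrow> real^2" where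
  "dvec i = of_int (fst i) *\<^sub>R k1 + of_int (snd i) *\<^sub>R k2"

definition xi :: "int \<times> int \<Rightarrow> real^2" where "xi i = e + dvec i"

definition wt :: "int \<times> int \<Rightarrow> real" where "wt i = 1 + (norm (xi i))\<^sup>2"

definition wave :: "int \<times> int \<Rightarrow> real^2 \<Rightarrow> complex" where "wave i z = cis (xi i \<bullet> z)"

definition series :: "(int \<times> int \<Rightarrow> complex) \<Rightarrow> real^2 \<Rightarrow> complex" where
  "series a z = (\<Sum>\<^sub>\<infinity>i. a i * wave i z)"

text \<open>The exponent counts powers of \<open>1 + |\<xi>|\<^sup>2\<close>: \<open>decays (3/2)\<close> means \<open>O(|\<xi>|\<^sup>-\<^sup>3)\<close>.\<close>

definition decays :: "real \<Rightarrow> (int \<times> int \<Rightarrow> complex) \<Rightarrow> bool" where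
  "decays s a \<longleftrightarrow> (\<exists>C. \<forall>i. norm (a i) \<le> C * wt i powr (-s))"

text \<open>The sign and the direction of the shift are chosen so that the series of
  \<open>bdiff d a\<close> is \<open>wdiff d z\<close> times the series of \<open>a\<close>.\<close>

definition bdiff :: "int \<times> int \<Rightarrow> (int \<times> int \<Rightarrow> complex) \<Rightarrow> int \<times> int \<Rightarrow> complex" where
  "bdiff d a i = a (i - d) - a i"

definition wdiff :: "int \<times> int \<Rightarrow> real^2 \<Rightarrow> complex" where "wdiff d z = cis (dvec d \<bullet> z) - 1"

lemma dvec_diff: "dvec (i - d) = dvec i - dvec d"
  by (simp add: dvec_def algebra_simps)

lemma dvec_add: "dvec (i + d) = dvec i + dvec d"
  by (simp add: dvec_def algebra_simps)

lemma xi_diff: "xi (i - d) = xi i - dvec d"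
  by (simp add: xi_def dvec_diff)

lemma xi_add: "xi (i + d) = xi i + dvec d"
  by (simp add: xi_def dvec_add)

lemma wt_ge_1: "1 \<le> wt i" and wt_pos: "0 < wt i" and wt_nonneg: "0 \<le> wt i"
  and wt_nonzero: "wt i \<noteq> 0"
  by (auto simp: wt_def add_pos_nonneg intro: add_nonneg_nonneg)
    (smt (verit) zero_le_power2)

lemma norm_xi_le: "norm (xi i) \<le> wt i powr (1/2)"
proof -
  have "norm (xi i) \<le> sqrt (wt i)" by (rule real_le_rsqrt) (simp add: wt_def)
  then show ?thesis by (simp add: powr_half_sqrt wt_nonneg)
qed

lemma norm_wave [simp]: "norm (wave i z) = 1"
  by (simp add: wave_def)

lemma coord_dvec: "dvec i \<bullet> a1 = 2 * pi * of_int (fst i)" "dvec i \<bullet> a2 = 2 * pi * of_int (snd i)"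
  by (simp_all add: dvec_def inner_add_left dual)

text \<open>The sum of squared norms comes from Cauchy-Schwarz against \<open>a1\<close> or
  \<open>a2\<close>, the factor in front of it from passing from \<open>dvec i\<close> to
  \<open>xi i = e + dvec i\<close>.\<close>

definition cbound :: real where "cbound = 1 + 2 * (1 + (norm e)\<^sup>2) * ((norm a1)\<^sup>2 + (norm a2)\<^sup>2)"

lemma cbound_ge_1: "1 \<le> cbound"
  by (simp add: cbound_def)

text \<open>The integer coordinates of \<open>i\<close> are the inner products of
  \<open>dvec i\<close> with \<open>a1\<close> and \<open>a2\<close>, divided by
  \<open>2 * pi\<close>; hence large coordinates force a large frequency.\<close>

lemma coord_sq_le:
  "1 + (real_of_int (fst i))\<^sup>2 \<le> cbound * wt i" "1 + (real_of_int (snd i))\<^sup>2 \<le> cbound * wt i"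
proof -
  have gen: "1 + (real_of_int m)\<^sup>2 \<le> cbound * wt i"
    if m: "dvec i \<bullet> a = 2 * pi * of_int m" and a: "(norm a)\<^sup>2 \<le> (norm a1)\<^sup>2 + (norm a2)\<^sup>2" for m a
  proof -
    have "\<bar>real_of_int m\<bar> * 1 \<le> \<bar>real_of_int m\<bar> * (2 * pi)" using pi_ge_two by (intro mult_left_mono) auto
    also have "\<dots> = \<bar>dvec i \<bullet> a\<bar>" by (simp add: m abs_mult)
    also have "\<dots> \<le> norm (dvec i) * norm a" by (rule Cauchy_Schwarz_ineq2)
    also have "norm (dvec i) = norm (xi i - e)" by (simp add: xi_def)
    finally have "\<bar>real_of_int m\<bar> \<le> norm (xi i - e) * norm a" by simp
    then have "\<bar>real_of_int m\<bar>\<^sup>2 \<le> (norm (xi i - e) * norm a)\<^sup>2" by (intro power_mono) auto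
    also have "\<dots> = (norm (xi i - e))\<^sup>2 * (norm a)\<^sup>2" by (rule power_mult_distrib)
    also have "(norm (xi i - e))\<^sup>2 \<le> (norm (xi i) + norm e)\<^sup>2"
      by (intro power_mono norm_triangle_ineq4) auto
    also have "(norm (xi i) + norm e)\<^sup>2 \<le> 2 * (1 + (norm e)\<^sup>2) * wt i"
      using one_plus_sq_le[of "norm (xi i) + norm e" "norm (xi i)" "norm e"] by (simp add: wt_def)
    finally have "(real_of_int m)\<^sup>2 \<le> 2 * (1 + (norm e)\<^sup>2) * wt i * (norm a)\<^sup>2"
      by (simp add: mult_right_mono)
    also have "\<dots> \<le> 2 * (1 + (norm e)\<^sup>2) * wt i * ((norm a1)\<^sup>2 + (norm a2)\<^sup>2)"
      using a wt_nonneg by (intro mult_left_mono) (auto simp: add_nonneg_nonneg)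
    finally show ?thesis using wt_ge_1[of i] by (simp add: cbound_def algebra_simps)
  qed
  show "1 + (real_of_int (fst i))\<^sup>2 \<le> cbound * wt i" by (rule gen[OF coord_dvec(1)]) simp
  show "1 + (real_of_int (snd i))\<^sup>2 \<le> cbound * wt i" by (rule gen[OF coord_dvec(2)]) simp
qed

text \<open>Since \<open>wt\<close> dominates the weights of both coordinates, half of the exponent
  can be given to each: the majorant is a product of two convergent series over the
  integers.\<close>

lemma summable_wt_powr: "(\<lambda>i. wt i powr (-9/8)) summable_on UNIV"
proof -
  define f where "f m = (1 + (real_of_int m)\<^sup>2) powr (-9/16)" for m
  have f: "f summable_on UNIV" unfolding f_def by (rule summable_on_int_one_plus_sq_powr)
  have f0: "0 \<le> f m" for m by (simp add: f_def)
  have "(\<lambda>i. norm ((\<lambda>(x, y). f x * f y) i)) summable_on UNIV \<times> UNIV"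
    using f f0 by (intro Infinite_Sum.abs_summable_on_Sigma_iff[THEN iffD2])
      (auto intro!: summable_on_cmult_right summable_on_cmult_left
        simp: abs_mult infsum_cmult_right' infsum_nonneg)
  then have "(\<lambda>i. norm (f (fst i) * f (snd i))) summable_on UNIV"
    by (simp add: case_prod_beta')
  then have "(\<lambda>i. cbound powr (9/8) * norm (f (fst i) * f (snd i))) summable_on UNIV"
    by (rule summable_on_cmult_right)
  then show ?thesis
  proof (rule summable_on_comparison_test)
    fix i
    have *: "wt i powr (-9/16) \<le> cbound powr (9/16) * f m"
      if "1 + (real_of_int m)\<^sup>2 \<le> cbound * wt i" for m
    proof -
      have "(cbound * wt i) powr (-9/16) \<le> f m"
        unfolding f_def using that by (intro powr_mono2') (auto simp: add_pos_nonneg)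
      then have "cbound powr (9/16) * ((cbound * wt i) powr (-9/16)) \<le> cbound powr (9/16) * f m"
        by (intro mult_left_mono) auto
      moreover have "cbound powr (9/16) * ((cbound * wt i) powr (-9/16)) = wt i powr (-9/16)"
        using cbound_ge_1 wt_pos[of i] by (simp add: powr_mult powr_minus field_simps)
      ultimately show ?thesis by simp
    qed
    have "wt i powr (-9/8) = wt i powr (-9/16) * wt i powr (-9/16)"
      by (simp add: powr_add[symmetric])
    also have "\<dots> \<le> (cbound powr (9/16) * f (fst i)) * (cbound powr (9/16) * f (snd i))"
      by (intro mult_mono * coord_sq_le) (auto simp: f0)
    also have "\<dots> = cbound powr (9/8) * norm (f (fst i) * f (snd i))"
      using f0 by (simp add: powr_add[symmetric] abs_mult mult_ac flip: mult.assoc)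
    finally show "wt i powr (-9/8) \<le> cbound powr (9/8) * norm (f (fst i) * f (snd i))" .
  qed auto
qed

lemma decI: "(\<And>i. norm (a i) \<le> C * wt i powr (-s)) \<Longrightarrow> decays s a"
  unfolding decays_def by blast

lemma decE:
  assumes "decays s a"
  obtains C where "0 \<le> C" "\<And>i. norm (a i) \<le> C * wt i powr (-s)"
proof -
  obtain C where C: "\<And>i. norm (a i) \<le> C * wt i powr (-s)" using assms unfolding decays_def by blast
  have "norm (a i) \<le> max 0 C * wt i powr (-s)" for i
    by (rule order_trans[OF C]) (intro mult_right_mono, auto)
  then show ?thesis using that[of "max 0 C"] by auto
qed

lemma decays_bound:
  assumes "decays s a" shows "\<exists>C. 0 \<le> C \<and> (\<forall>i. norm (a i) \<le> C * wt i powr (-s))"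
  by (rule decE[OF assms]) auto

lemma decays_mono: "decays s a \<Longrightarrow> t \<le> s \<Longrightarrow> decays t a"
proof (elim decE)
  fix C assume C: "0 \<le> C" "\<And>i. norm (a i) \<le> C * wt i powr (-s)" and t: "t \<le> s"
  show "decays t a"
  proof (rule decI)
    fix i
    have "wt i powr (-s) \<le> wt i powr (-t)" using t wt_ge_1 by (intro powr_mono) auto
    then show "norm (a i) \<le> C * wt i powr (-t)"
      using C(1) by (intro order_trans[OF C(2)] mult_left_mono)
  qed
qed

lemma decays_add: "decays s a \<Longrightarrow> decays s b \<Longrightarrow> decays s (\<lambda>i. a i + b i)"
proof (elim decE)
  fix C D assume C: "\<And>i. norm (a i) \<le> C * wt i powr (-s)" and D: "\<And>i. norm (b i) \<le> D * wt i powr (-s)"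
  show ?thesis
  proof (rule decI)
    fix i show "norm (a i + b i) \<le> (C + D) * wt i powr (-s)"
      using C[of i] D[of i] norm_triangle_ineq[of "a i" "b i"] by (simp add: algebra_simps)
  qed
qed

lemma decays_mult: "decays s a \<Longrightarrow> decays t b \<Longrightarrow> u = s + t \<Longrightarrow> decays u (\<lambda>i. a i * b i)"
proof (elim decE)
  fix C D assume C: "0 \<le> C" "\<And>i. norm (a i) \<le> C * wt i powr (-s)"
    and D: "\<And>i. norm (b i) \<le> D * wt i powr (-t)" and u: "u = s + t"
  show ?thesis
  proof (rule decI)
    fix i
    have "norm (a i * b i) \<le> (C * wt i powr (-s)) * (D * wt i powr (-t))"
      unfolding norm_mult using C by (intro mult_mono C D) auto
    also have "\<dots> = (C * D) * wt i powr (-u)" by (simp add: u powr_add[symmetric])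
    finally show "norm (a i * b i) \<le> (C * D) * wt i powr (-u)" .
  qed
qed

lemma decays_const: "decays 0 (\<lambda>i. c)"
  by (rule decI[of _ "norm c"]) (use wt_nonzero in auto)

lemma decays_cmult: "decays s a \<Longrightarrow> decays s (\<lambda>i. c * a i)"
  using decays_mult[OF decays_const] by simp

lemma decays_uminus: "decays s a \<Longrightarrow> decays s (\<lambda>i. - a i)"
  by (simp add: decays_def)

lemma decays_diff: "decays s a \<Longrightarrow> decays s b \<Longrightarrow> decays s (\<lambda>i. a i - b i)"
  using decays_add[OF _ decays_uminus] by simp

lemma wt_shift_le: "wt i \<le> 2 * (1 + (norm (dvec d))\<^sup>2) * wt (i - d)"
proof -
  have "norm (xi i) \<le> norm (xi (i - d)) + norm (dvec d)"
    using norm_triangle_ineq[of "xi i - dvec d" "dvec d"] by (simp add: xi_diff)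
  then show ?thesis unfolding wt_def by (intro one_plus_sq_le) auto
qed

lemma wt_shift_le': "wt (i - d) \<le> 2 * (1 + (norm (dvec d))\<^sup>2) * wt i"
  using wt_shift_le[of "i - d" "- d"] dvec_diff[of 0 d] by (simp add: dvec_def[of 0])

lemma decays_shift:
  assumes "decays s a" shows "decays s (\<lambda>i. a (i - d))"
proof -
  obtain C where C: "0 \<le> C" "\<And>i. norm (a i) \<le> C * wt i powr (-s)" using decays_bound[OF assms] by blast
  define L where "L = 2 * (1 + (norm (dvec d))\<^sup>2)"
  have L: "1 \<le> L" by (simp add: L_def)
  show ?thesis
  proof (rule decI)
    fix i
    have "wt (i - d) powr (-s) \<le> L powr \<bar>s\<bar> * wt i powr (-s)"
    proof (cases "0 \<le> s")
      case True
      have "(L * wt (i - d)) powr (-s) \<le> wt i powr (-s)"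
        using True wt_pos wt_shift_le[of i d] by (intro powr_mono2') (auto simp: L_def)
      then have "L powr s * (L * wt (i - d)) powr (-s) \<le> L powr s * wt i powr (-s)"
        by (intro mult_left_mono) auto
      moreover have "L powr s * (L * wt (i - d)) powr (-s) = wt (i - d) powr (-s)"
        using L wt_pos[of "i - d"] by (simp add: powr_mult powr_minus field_simps)
      ultimately show ?thesis using True by simp
    next
      case False
      then have "wt (i - d) powr (-s) \<le> (L * wt i) powr (-s)"
        using wt_nonneg wt_shift_le'[of i d] by (intro powr_mono2) (auto simp: L_def)
      then show ?thesis using False L wt_nonneg by (simp add: powr_mult)
    qed
    then have "C * wt (i - d) powr (-s) \<le> C * (L powr \<bar>s\<bar> * wt i powr (-s))"
      using C(1) by (rule mult_left_mono)
    then show "norm (a (i - d)) \<le> (C * L powr \<bar>s\<bar>) * wt i powr (-s)"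
      using C(2)[of "i - d"] by simp
  qed
qed

lemma decays_bdiff: "decays s a \<Longrightarrow> decays s (bdiff d a)"
  unfolding bdiff_def by (intro decays_diff decays_shift)

text \<open>Decay only concerns large frequencies, as finitely many values are absorbed in the
  constant. This is how small or vanishing denominators of the Helmholtz series are disposed
  of.\<close>

lemma decays_finite:
  assumes "finite F" "\<And>i. i \<notin> F \<Longrightarrow> norm (a i) \<le> C * wt i powr (-s)"
  shows "decays s a"
proof (rule decI)
  fix i
  define D where "D = (\<Sum>i\<in>F. norm (a i) * wt i powr s)"
  have D: "0 \<le> D" unfolding D_def by (intro sum_nonneg) auto
  have "norm (a i) \<le> max C D * wt i powr (-s)"
  proof (cases "i \<in> F")
    case True
    have "norm (a i) * wt i powr s \<le> D"
      unfolding D_def by (rule member_le_sum) (use assms True in auto)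
    then have "norm (a i) * wt i powr s * wt i powr (-s) \<le> D * wt i powr (-s)"
      by (intro mult_right_mono) auto
    then have "norm (a i) \<le> D * wt i powr (-s)" using wt_pos[of i] by (simp add: mult.assoc powr_add[symmetric])
    also have "\<dots> \<le> max C D * wt i powr (-s)" by (intro mult_right_mono) auto
    finally show ?thesis .
  next
    case False
    show ?thesis by (rule order_trans[OF assms(2)[OF False]]) (intro mult_right_mono, auto)
  qed
  then show "norm (a i) \<le> max C D * wt i powr (-s)" .
qed

lemma decays_summable_norm:
  assumes "decays s a" "9/8 \<le> s" shows "(\<lambda>i. norm (a i)) summable_on UNIV"
proof -
  obtain C where C: "\<And>i. norm (a i) \<le> C * wt i powr (-(9/8))"
    using decays_bound[OF decays_mono[OF assms]] by auto
  have "(\<lambda>i. C * wt i powr (-9/8)) summable_on UNIV"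
    by (intro summable_on_cmult_right summable_wt_powr)
  then show ?thesis by (rule summable_on_comparison_test) (use C in auto)
qed

lemma decays_summable_wave:
  assumes "decays s a" "9/8 \<le> s" shows "(\<lambda>i. a i * wave i z) summable_on UNIV"
proof (rule abs_summable_summable)
  show "(\<lambda>i. norm (a i * wave i z)) summable_on UNIV"
    using decays_summable_norm[OF assms] by (simp add: norm_mult)
qed

lemma norm_series_le:
  assumes "\<And>i. norm (a i) \<le> C * wt i powr (-9/8)"
  shows "norm (series a z) \<le> C * (\<Sum>\<^sub>\<infinity>i. wt i powr (-9/8))"
proof -
  have a: "decays (9/8) a" by (rule decI) (use assms in auto)
  have "norm (series a z) \<le> (\<Sum>\<^sub>\<infinity>i. norm (a i * wave i z))"
    unfolding series_def using decays_summable_norm[OF a] by (intro norm_infsum_bound) (simp add: norm_mult)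
  also have "\<dots> \<le> (\<Sum>\<^sub>\<infinity>i. C * wt i powr (-9/8))"
    using decays_summable_norm[OF a] assms
    by (intro infsum_mono summable_on_cmult_right summable_wt_powr) (auto simp: norm_mult)
  also have "\<dots> = C * (\<Sum>\<^sub>\<infinity>i. wt i powr (-9/8))" by (rule infsum_cmult_right')
  finally show ?thesis .
qed

lemma series_add: "decays s a \<Longrightarrow> decays s b \<Longrightarrow> 9/8 \<le> s \<Longrightarrow> series (\<lambda>i. a i + b i) z = series a z + series b z"
  unfolding series_def distrib_right by (intro infsum_add decays_summable_wave)

lemma series_cmult: "series (\<lambda>i. c * a i) z = c * series a z"
  unfolding series_def mult.assoc by (rule infsum_cmult_right')

lemma series_diff: "decays s a \<Longrightarrow> decays s b \<Longrightarrow> 9/8 \<le> s \<Longrightarrow> series (\<lambda>i. a i - b i) z = series a z - series b z"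
  using series_add[of s a "\<lambda>i. (-1) * b i" z] series_cmult[of "-1" b z] decays_uminus[of s b] by simp

lemma wave_shift: "wave (i + d) z = cis (dvec d \<bullet> z) * wave i z"
  by (simp add: wave_def xi_add inner_add_left cis_mult) (simp add: add.commute)

lemma series_shift: "series (\<lambda>i. a (i - d)) z = cis (dvec d \<bullet> z) * series a z"
proof -
  have "series (\<lambda>i. a (i - d)) z = (\<Sum>\<^sub>\<infinity>i. a ((i + d) - d) * wave (i + d) z)"
    unfolding series_def
    by (rule infsum_reindex_bij_betw[symmetric]) (auto intro!: bij_betwI[of _ _ _ "\<lambda>i. i - d"])
  also have "\<dots> = (\<Sum>\<^sub>\<infinity>i. cis (dvec d \<bullet> z) * (a i * wave i z))" by (simp add: wave_shift mult_ac)
  finally show ?thesis unfolding series_def infsum_cmult_right' .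
qed

text \<open>Summation by parts without boundary terms: the sum is absolutely convergent over the
  whole lattice, and the index shift is a bijection of it.\<close>

lemma series_bdiff: "decays s a \<Longrightarrow> 9/8 \<le> s \<Longrightarrow> series (bdiff d a) z = wdiff d z * series a z"
  unfolding bdiff_def by (simp add: series_diff[of s] decays_shift series_shift[of a d] wdiff_def left_diff_distrib)

text \<open>A Hoelder exponent \<open>s\<close> costs \<open>wt\<close> to the power
  \<open>s/2\<close>. Decay 3/2 exceeds the summable 9/8 by 3/8, which pays for exponent
  3/4.\<close>

lemma series_Hoelder:
  assumes "decays (3/2) a"
  obtains C where "0 \<le> C" "\<And>z w. norm (series a z - series a w) \<le> C * norm (z - w) powr (3/4)"
proof -
  obtain C where C: "0 \<le> C" "\<And>i. norm (a i) \<le> C * wt i powr (-(3/2))" using decays_bound[OF assms] by blast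
  let ?psum = "\<Sum>\<^sub>\<infinity>i. wt i powr (-9/8)"
  have "norm (series a z - series a w) \<le> (2 * C * ?psum) * norm (z - w) powr (3/4)" for z w
  proof -
    have "norm (a i * (wave i (z - w) - 1)) \<le> (2 * C * norm (z - w) powr (3/4)) * wt i powr (-9/8)" for i
    proof -
      have "norm (wave i (z - w) - 1) \<le> 2 * \<bar>xi i \<bullet> (z - w)\<bar> powr (3/4)"
        unfolding wave_def by (rule norm_cis_minus_1_powr_le) auto
      also have "\<bar>xi i \<bullet> (z - w)\<bar> powr (3/4) \<le> (wt i powr (1/2) * norm (z - w)) powr (3/4)"
        by (intro powr_mono2 order_trans[OF Cauchy_Schwarz_ineq2] mult_right_mono norm_xi_le) auto
      also have "\<dots> = wt i powr (3/8) * norm (z - w) powr (3/4)"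
        by (simp add: powr_mult powr_powr wt_nonneg)
      finally have "norm (a i) * norm (wave i (z - w) - 1)
        \<le> (C * wt i powr (-(3/2))) * (2 * (wt i powr (3/8) * norm (z - w) powr (3/4)))"
        using C by (intro mult_mono C) auto
      also have "\<dots> = (2 * C * norm (z - w) powr (3/4)) * (wt i powr (-(3/2)) * wt i powr (3/8))" by simp
      also have "wt i powr (-(3/2)) * wt i powr (3/8) = wt i powr (-9/8)"
        unfolding powr_add[symmetric] by simp
      finally show ?thesis by (simp add: norm_mult)
    qed
    then have "norm (series (\<lambda>i. a i * (wave i (z - w) - 1)) w) \<le> (2 * C * norm (z - w) powr (3/4)) * ?psum"
      by (rule norm_series_le)
    moreover have "series (\<lambda>i. a i * (wave i (z - w) - 1)) w = series a z - series a w"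
    proof -
      have "series (\<lambda>i. a i * (wave i (z - w) - 1)) w = (\<Sum>\<^sub>\<infinity>i. a i * wave i z - a i * wave i w)"
        unfolding series_def
        by (intro infsum_cong) (simp add: wave_def inner_diff_right cis_mult algebra_simps)
      also have "\<dots> = series a z - series a w"
        unfolding series_def by (intro infsum_diff_complex decays_summable_wave[OF assms]) auto
      finally show ?thesis .
    qed
    ultimately show ?thesis by (simp add: mult_ac)
  qed
  moreover have "0 \<le> 2 * C * ?psum" using C by (intro mult_nonneg_nonneg infsum_nonneg) auto
  ultimately show ?thesis by (rule that[rotated])
qed

lemma continuous_series: "decays (3/2) a \<Longrightarrow> isCont (series a) z"
proof (elim series_Hoelder)
  fix C assume C: "\<And>z w. norm (series a z - series a w) \<le> C * norm (z - w) powr (3/4)"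
  have lim: "((\<lambda>w. C * norm (w - z) powr (3/4)) \<longlongrightarrow> C * norm (z - z) powr (3/4)) (at z)"
    by (intro tendsto_intros tendsto_powr') auto
  have "((\<lambda>w. series a w - series a z) \<longlongrightarrow> 0) (at z)"
    by (rule Lim_null_comparison[where g = "\<lambda>w. C * norm (w - z) powr (3/4)"])
      (use lim in \<open>auto intro!: always_eventually C\<close>)
  then show ?thesis unfolding isCont_def LIM_zero_iff .
qed

lemma has_derivativeI_powr:
  fixes f :: "real^2 \<Rightarrow> complex"
  assumes "linear D" "\<And>h. norm (f (z + h) - f z - D h) \<le> C * norm h powr (5/4)"
  shows "(f has_derivative D) (at z)"
  unfolding has_derivative_at
proof (intro conjI)
  show "bounded_linear D" using assms(1) by (simp add: linear_conv_bounded_linear)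
  have lim: "((\<lambda>h::real^2. C * norm h powr (1/4)) \<longlongrightarrow> C * norm (0::real^2) powr (1/4)) (at 0)"
    by (intro tendsto_intros tendsto_powr') auto
  show "((\<lambda>h. norm (f (z + h) - f z - D h) / norm h) \<longlongrightarrow> 0) (at 0)"
  proof (rule Lim_null_comparison[of _ "\<lambda>h. C * norm h powr (1/4)"])
    have "norm (norm (f (z + h) - f z - D h) / norm h) \<le> C * norm h powr (1/4)" if "h \<noteq> 0" for h
    proof -
      have "norm h powr (5/4) = norm h * norm h powr (1/4)"
        using that powr_add[of "norm h" 1 "1/4"] by simp
      with assms(2)[of h] that show ?thesis by (simp add: field_simps)
    qed
    then show "\<forall>\<^sub>F h in at 0. norm (norm (f (z + h) - f z - D h) / norm h) \<le> C * norm h powr (1/4)"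
      by (simp add: eventually_at_filter)
  qed (use lim in simp)
qed

definition grad :: "real^2 \<Rightarrow> (int \<times> int \<Rightarrow> complex) \<Rightarrow> int \<times> int \<Rightarrow> complex" where
  "grad h a i = \<i> * of_real (xi i \<bullet> h) * a i"

lemma decays_xi: "decays (-1/2) (\<lambda>i. of_real (xi i \<bullet> h))"
proof (rule decI)
  fix i
  have "\<bar>xi i \<bullet> h\<bar> \<le> wt i powr (1/2) * norm h"
    by (intro order_trans[OF Cauchy_Schwarz_ineq2] mult_right_mono norm_xi_le) auto
  then show "norm (complex_of_real (xi i \<bullet> h)) \<le> norm h * wt i powr - (-1/2)"
    by (simp add: mult.commute)
qed

lemma decays_grad: "decays s a \<Longrightarrow> t = s - 1/2 \<Longrightarrow> decays t (grad h a)"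
  unfolding grad_def by (intro decays_mult[OF decays_cmult[OF decays_xi]]) auto

lemma linear_series_grad:
  assumes "decays s a" "13/8 \<le> s" shows "linear (\<lambda>h. series (grad h a) z)"
proof (rule linearI)
  fix x y :: "real^2" and c :: real
  have d: "decays (s - 1/2) (grad h a)" for h by (rule decays_grad[OF assms(1)]) simp
  have "grad (x + y) a = (\<lambda>i. grad x a i + grad y a i)"
    by (rule ext) (simp add: grad_def inner_add_right algebra_simps)
  then show "series (grad (x + y) a) z = series (grad x a) z + series (grad y a) z"
    using assms series_add[OF d[of x] d[of y]] by simp
  have "grad (c *\<^sub>R x) a = (\<lambda>i. of_real c * grad x a i)"
    by (rule ext) (simp add: grad_def mult_ac)
  then show "series (grad (c *\<^sub>R x) a) z = c *\<^sub>R series (grad x a) z"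
    by (simp add: series_cmult scaleR_conv_of_real)
qed

lemma series_has_derivative:
  assumes "decays 2 a" shows "(series a has_derivative (\<lambda>h. series (grad h a) z)) (at z)"
proof -
  obtain C where C: "0 \<le> C" "\<And>i. norm (a i) \<le> C * wt i powr (-2)" using decays_bound[OF assms] by blast
  let ?psum = "\<Sum>\<^sub>\<infinity>i. wt i powr (-9/8)"
  have g: "decays (3/2) (grad h a)" for h by (rule decays_grad[OF assms]) simp
  show ?thesis
  proof (rule has_derivativeI_powr[where C = "3 * C * ?psum"])
    show "linear (\<lambda>h. series (grad h a) z)" by (rule linear_series_grad[OF assms]) simp
    fix h
    let ?r = "\<lambda>i. wave i h - 1 - \<i> * of_real (xi i \<bullet> h)"
    have "norm (a i * ?r i) \<le> (3 * C * norm h powr (5/4)) * wt i powr (-9/8)" for i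
    proof -
      have "norm (?r i) \<le> 3 * \<bar>xi i \<bullet> h\<bar> powr (5/4)"
        unfolding wave_def by (rule norm_cis_taylor_powr_le) auto
      also have "\<bar>xi i \<bullet> h\<bar> powr (5/4) \<le> (wt i powr (1/2) * norm h) powr (5/4)"
        by (intro powr_mono2 order_trans[OF Cauchy_Schwarz_ineq2] mult_right_mono norm_xi_le) auto
      also have "\<dots> = wt i powr (5/8) * norm h powr (5/4)"
        by (simp add: powr_mult powr_powr wt_nonneg)
      \<comment> \<open>The exponent 5/4 costs only 5/8; rounding up to 7/8 makes the total exactly
        the exponent -9/8 of the standard majorant.\<close>
      also have "wt i powr (5/8) \<le> wt i powr (7/8)" by (intro powr_mono wt_ge_1) auto
      finally have "norm (a i) * norm (?r i)
        \<le> (C * wt i powr (-2)) * (3 * (wt i powr (7/8) * norm h powr (5/4)))"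
        using C by (intro mult_mono C) (auto simp: mult_right_mono)
      also have "\<dots> = (3 * C * norm h powr (5/4)) * (wt i powr (-2) * wt i powr (7/8))" by simp
      also have "wt i powr (-2) * wt i powr (7/8) = wt i powr (-9/8)"
        unfolding powr_add[symmetric] by simp
      finally show ?thesis by (simp add: norm_mult)
    qed
    then have "norm (series (\<lambda>i. a i * ?r i) z) \<le> (3 * C * norm h powr (5/4)) * ?psum"
      by (rule norm_series_le)
    moreover have "series (\<lambda>i. a i * ?r i) z = series a (z + h) - series a z - series (grad h a) z"
    proof -
      have "series (\<lambda>i. a i * ?r i) z = (\<Sum>\<^sub>\<infinity>i. a i * wave i (z + h) - a i * wave i z - grad h a i * wave i z)"
        unfolding series_def
        by (intro infsum_cong) (simp add: grad_def wave_def inner_add_right cis_mult[symmetric] algebra_simps)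
      also have "\<dots> = series a (z + h) - series a z - series (grad h a) z"
        unfolding series_def
        using decays_summable_wave[OF assms] decays_summable_wave[OF g]
        by (simp add: infsum_diff_complex summable_on_diff_complex)
      finally show ?thesis .
    qed
    ultimately show "norm (series a (z + h) - series a z - series (grad h a) z) \<le> 3 * C * ?psum * norm h powr (5/4)"
      by (simp add: mult_ac)
  qed
qed

end

section \<open>Summation by parts over discs\<close>

lemma norm_segment_le:
  fixes x v :: "'a::real_normed_vector"
  assumes "norm (x + \<alpha> *\<^sub>R v) \<le> r" "norm (x + \<beta> *\<^sub>R v) \<le> r" "\<alpha> \<le> \<gamma>" "\<gamma> \<le> \<beta>"
  shows "norm (x + \<gamma> *\<^sub>R v) \<le> r"
proof (cases "\<alpha> = \<beta>")
  case True
  then show ?thesis using assms by simp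
next
  case False
  define u where "u = (\<gamma> - \<alpha>) / (\<beta> - \<alpha>)"
  have u: "0 \<le> u" "u \<le> 1" using assms False by (auto simp: u_def field_simps)
  have "u * (\<beta> - \<alpha>) = \<gamma> - \<alpha>" using False by (simp add: u_def)
  then have "\<gamma> = (1 - u) * \<alpha> + u * \<beta>" by (simp add: algebra_simps)
  moreover have "(1 - u) *\<^sub>R (x + \<alpha> *\<^sub>R v) + u *\<^sub>R (x + \<beta> *\<^sub>R v)
      = x + ((1 - u) * \<alpha> + u * \<beta>) *\<^sub>R v"
    by (simp add: algebra_simps)
  ultimately have "x + \<gamma> *\<^sub>R v = (1 - u) *\<^sub>R (x + \<alpha> *\<^sub>R v) + u *\<^sub>R (x + \<beta> *\<^sub>R v)" by simp
  also have "norm \<dots> \<le> (1 - u) * r + u * r"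
    using u assms by (intro norm_triangle_le add_mono) (auto intro!: mult_left_mono)
  finally show ?thesis by (simp add: algebra_simps)
qed

context dual_lattice
begin

definition disc :: "real \<Rightarrow> (int \<times> int) set" where "disc r = {i. norm (xi i) \<le> r}"

definition psum :: "(int \<times> int \<Rightarrow> complex) \<Rightarrow> real \<Rightarrow> real^2 \<Rightarrow> complex" where
  "psum a r z = (\<Sum>i\<in>disc r. a i * wave i z)"

definition dirs :: "(int \<times> int) set" where "dirs = {(1, 0), (0, 1)}"

lemma coord_le_disc:
  assumes "i \<in> disc r" "0 \<le> r"
  shows "\<bar>real_of_int (fst i)\<bar> \<le> cbound * (1 + r)" "\<bar>real_of_int (snd i)\<bar> \<le> cbound * (1 + r)"
proof -
  have *: "\<bar>real_of_int m\<bar> \<le> cbound * (1 + r)" if m: "1 + (real_of_int m)\<^sup>2 \<le> cbound * wt i" for m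
  proof -
    have "wt i \<le> 1 + r\<^sup>2" using assms by (simp add: wt_def disc_def)
    then have "cbound * wt i \<le> cbound * (1 + r\<^sup>2)" using cbound_ge_1 by (intro mult_left_mono) auto
    also have "\<dots> \<le> cbound * ((1 + r)\<^sup>2)" using cbound_ge_1 assms by (intro mult_left_mono) (auto simp: power2_sum)
    also have "\<dots> \<le> cbound * (cbound * (1 + r)\<^sup>2)"
      using cbound_ge_1 mult_right_mono[of 1 cbound "(1 + r)\<^sup>2"] by (intro mult_left_mono) auto
    also have "\<dots> = (cbound * (1 + r))\<^sup>2" by (simp add: power2_eq_square)
    finally have "\<bar>real_of_int m\<bar>\<^sup>2 \<le> (cbound * (1 + r))\<^sup>2" using m by simp
    then show ?thesis using cbound_ge_1 assms by (auto simp: abs_le_square_iff[symmetric])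
  qed
  show "\<bar>real_of_int (fst i)\<bar> \<le> cbound * (1 + r)" "\<bar>real_of_int (snd i)\<bar> \<le> cbound * (1 + r)"
    by (intro * coord_sq_le)+
qed

lemma finite_disc: "finite (disc r)"
proof (cases "0 \<le> r")
  case True
  define M where "M = \<lceil>cbound * (1 + r)\<rceil>"
  have "disc r \<subseteq> {-M..M} \<times> {-M..M}"
  proof
    fix i assume "i \<in> disc r"
    from coord_le_disc[OF this True] have "\<bar>fst i\<bar> \<le> M" "\<bar>snd i\<bar> \<le> M" unfolding M_def by linarith+
    then show "i \<in> {-M..M} \<times> {-M..M}" by (cases i) auto
  qed
  then show ?thesis by (rule finite_subset) auto
next
  case False
  then have "disc r = {}" by (auto simp: disc_def) (smt (verit) norm_ge_zero)
  then show ?thesis by simp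
qed

text \<open>Discs exhaust the index set, so for absolutely convergent series the disc sums agree in
  the limit with the unordered sum.\<close>

lemma filterlim_disc: "filterlim disc (finite_subsets_at_top UNIV) at_top"
  unfolding filterlim_finite_subsets_at_top
proof (intro allI impI)
  fix X :: "(int \<times> int) set" assume "finite X \<and> X \<subseteq> UNIV"
  then have X: "finite X" by simp
  have "X \<subseteq> disc r" if "(\<Sum>i\<in>X. norm (xi i)) \<le> r" for r
  proof
    fix i assume "i \<in> X"
    then have "norm (xi i) \<le> (\<Sum>i\<in>X. norm (xi i))" using X by (intro member_le_sum) auto
    with that show "i \<in> disc r" by (simp add: disc_def)
  qed
  then show "\<forall>\<^sub>F r in at_top. finite (disc r) \<and> X \<subseteq> disc r \<and> disc r \<subseteq> UNIV"
    using finite_disc unfolding eventually_at_top_linorder by blast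
qed

lemma psum_tendsto_series:
  assumes "decays s a" "9/8 \<le> s" shows "((\<lambda>r. psum a r z) \<longlongrightarrow> series a z) at_top"
  unfolding psum_def series_def
  by (rule filterlim_compose[OF infsum_tendsto[OF decays_summable_wave[OF assms]] filterlim_disc])

text \<open>A line in direction \<open>dvec d\<close> meets the disc in a segment and so has at most one such point.\<close>

lemma card_disc_boundary:
  assumes d: "d \<in> dirs" and r: "0 \<le> r"
    and X: "X = {j. j - d \<in> disc r \<and> j \<notin> disc r} \<or> X = {j. j \<in> disc r \<and> j - d \<notin> disc r}"
  shows "finite X" "real (card X) \<le> 2 * (cbound * (1 + r)) + 3"
proof -
  \<comment> \<open>\<open>\<rho>\<close> is constant in direction \<open>d\<close> and equals up to
    sign the other coordinate, so it numbers the lines parallel to \<open>d\<close>. Only O(r) of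
    its values occur.\<close>
  define \<rho> where "\<rho> i = fst i * snd d - snd i * fst d" for i :: "int \<times> int"
  define M where "M = \<lceil>cbound * (1 + r)\<rceil>"
  have sub: "\<rho> ` X \<subseteq> {-M..M}"
  proof clarify
    fix j assume "j \<in> X"
    with X obtain i where i: "i \<in> disc r" "i = j \<or> i = j - d" by blast
    have "\<rho> j = \<rho> i" using i(2) by (auto simp: \<rho>_def algebra_simps)
    moreover have "\<bar>fst i\<bar> \<le> M" "\<bar>snd i\<bar> \<le> M"
      using coord_le_disc[OF i(1) r] unfolding M_def by linarith+
    ultimately show "\<rho> j \<in> {-M..M}" using d by (auto simp: \<rho>_def dirs_def)
  qed
  have inj: "inj_on \<rho> X"
  proof (rule inj_onI, rule ccontr)
    fix j j' assume j: "j \<in> X" "j' \<in> X" "\<rho> j = \<rho> j'" "j \<noteq> j'"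
    \<comment> \<open>Two members on one line would place a point outside the disc between two
      points inside it, against convexity.\<close>
    have False if h: "j \<in> X" "j' \<in> X" "xi j' = xi j + of_int t *\<^sub>R dvec d" "1 \<le> t" for j j' t
    proof -
      have t: "(1::real) \<le> of_int t" using h(4) by simp
      have e: "xi (j - d) = xi j + (-1) *\<^sub>R dvec d" "xi (j' - d) = xi j + (of_int t - 1) *\<^sub>R dvec d"
        "xi j = xi j + 0 *\<^sub>R dvec d"
        by (simp_all add: xi_diff h(3) algebra_simps)
      from X show False
      proof
        assume "X = {j. j - d \<in> disc r \<and> j \<notin> disc r}"
        with h have "norm (xi j + (-1) *\<^sub>R dvec d) \<le> r" "norm (xi j + (of_int t - 1) *\<^sub>R dvec d) \<le> r"
          "\<not> norm (xi j + 0 *\<^sub>R dvec d) \<le> r"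
          unfolding e(1,2)[symmetric] by (auto simp: disc_def)
        then show False using norm_segment_le[of "xi j" "-1" "dvec d" r "of_int t - 1" 0] t by auto
      next
        assume "X = {j. j \<in> disc r \<and> j - d \<notin> disc r}"
        with h have "norm (xi j + 0 *\<^sub>R dvec d) \<le> r" "\<not> norm (xi j + (of_int t - 1) *\<^sub>R dvec d) \<le> r"
          "norm (xi j + of_int t *\<^sub>R dvec d) \<le> r"
          unfolding e(2)[symmetric] by (auto simp: disc_def)
        then show False using norm_segment_le[of "xi j" 0 "dvec d" r "of_int t" "of_int t - 1"] t by auto
      qed
    qed
    note * = this
    obtain t where t: "j' = (fst j + t * fst d, snd j + t * snd d)"
    proof (cases "d = (1, 0)")
      case True
      then show ?thesis using j that[of "fst j' - fst j"] by (cases j, cases j') (auto simp: \<rho>_def)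
    next
      case False
      then have "d = (0, 1)" using d by (auto simp: dirs_def)
      then show ?thesis using j that[of "snd j' - snd j"] by (cases j, cases j') (auto simp: \<rho>_def)
    qed
    have x: "xi j' = xi j + of_int t *\<^sub>R dvec d" "xi j = xi j' + of_int (- t) *\<^sub>R dvec d"
      by (simp_all add: t xi_def dvec_def algebra_simps)
    have "t \<noteq> 0" using j(4) t by auto
    then show False using *[OF j(1,2) x(1)] *[OF j(2,1) x(2)] by linarith
  qed
  show "finite X" using finite_subset[OF sub] inj finite_imageD by auto
  have "card X = card (\<rho> ` X)" using inj by (simp add: card_image)
  also have "\<dots> \<le> card {-M..M}" using sub by (intro card_mono) auto
  finally have "real (card X) \<le> real (nat (2 * M + 1))" by simp
  moreover have "0 \<le> cbound * (1 + r)" using cbound_ge_1 r by (intro mult_nonneg_nonneg) auto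
  then have "0 \<le> M" unfolding M_def by linarith
  moreover have "real_of_int M \<le> cbound * (1 + r) + 1" unfolding M_def by linarith
  ultimately show "real (card X) \<le> 2 * (cbound * (1 + r)) + 3" by simp
qed

text \<open>The left side compares one and the same summand over the disc and over the disc shifted
  by \<open>d\<close>. The common part cancels and the two lunes remain.\<close>

lemma psum_bdiff_bound:
  "norm (wdiff d z * psum a r z - psum (bdiff d a) r z)
    \<le> (\<Sum>j\<in>{j. j - d \<in> disc r \<and> j \<notin> disc r}. norm (a (j - d)))
     + (\<Sum>j\<in>{j. j \<in> disc r \<and> j - d \<notin> disc r}. norm (a (j - d)))"
proof -
  define g where "g j = a (j - d) * wave j z" for j
  define D where "D = {j. j - d \<in> disc r}"
  have D: "D = (\<lambda>i. i + d) ` disc r"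
  proof (rule set_eqI)
    fix j show "j \<in> D \<longleftrightarrow> j \<in> (\<lambda>i. i + d) ` disc r"
      by (auto simp: D_def intro!: image_eqI[of _ _ "j - d"])
  qed
  have fin: "finite D" unfolding D using finite_disc by simp
  have "cis (dvec d \<bullet> z) * psum a r z = (\<Sum>i\<in>disc r. g (i + d))"
    unfolding psum_def sum_distrib_left g_def by (intro sum.cong) (auto simp: wave_shift)
  also have "\<dots> = sum g D" unfolding D by (subst sum.reindex) (auto simp: inj_on_def)
  finally have 1: "cis (dvec d \<bullet> z) * psum a r z = sum g D" .
  have 2: "psum a r z + psum (bdiff d a) r z = sum g (disc r)"
    unfolding psum_def sum.distrib[symmetric] g_def bdiff_def by (intro sum.cong) (auto simp: algebra_simps)
  have "wdiff d z * psum a r z - psum (bdiff d a) r z = sum g D - sum g (disc r)"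
    using 1 2 by (simp add: wdiff_def algebra_simps)
  also have "\<dots> = sum g (D - disc r) - sum g (disc r - D)"
    using sum.Int_Diff[OF fin, of g "disc r"] sum.Int_Diff[OF finite_disc, of g r D]
    by (simp add: Int_commute)
  also have "norm \<dots> \<le> norm (sum g (D - disc r)) + norm (sum g (disc r - D))" by (rule norm_triangle_ineq4)
  also have "\<dots> \<le> (\<Sum>j\<in>D - disc r. norm (g j)) + (\<Sum>j\<in>disc r - D. norm (g j))"
    by (intro add_mono norm_sum)
  also have "D - disc r = {j. j - d \<in> disc r \<and> j \<notin> disc r}" by (auto simp: D_def)
  also have "disc r - D = {j. j \<in> disc r \<and> j - d \<notin> disc r}" by (auto simp: D_def)
  finally show ?thesis by (simp add: g_def norm_mult)
qed

text \<open>The lunes contain O(r) indices whose coefficients are O(r^-2). The bound is uniform in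
  \<open>z\<close>, so it is also available at \<open>z = 0\<close>, where it is used for
  telescoping.\<close>

lemma psum_bdiff_tendsto:
  assumes a: "decays 1 a" and d: "d \<in> dirs"
  shows "((\<lambda>r. wdiff d z * psum a r z - psum (bdiff d a) r z) \<longlongrightarrow> 0) at_top"
proof -
  obtain C where C: "0 \<le> C" "\<And>i. norm (a i) \<le> C * wt i powr (-1)" using decays_bound[OF a] by blast
  define \<kappa> where "\<kappa> = norm (dvec d)"
  \<comment> \<open>At most one step \<open>\<kappa>\<close> away from the outside of the disc, the
    frequency of \<open>j - d\<close> is at least \<open>r - \<kappa>\<close>, hence at least
    \<open>r/2\<close>; squaring produces the 4.\<close>
  have small: "norm (a (j - d)) \<le> 4 * C / r\<^sup>2"
    if r: "2 * \<kappa> + 1 \<le> r" and j: "j \<notin> disc r \<or> j - d \<notin> disc r" for j r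
  proof -
    have "r - \<kappa> \<le> norm (xi (j - d))"
    proof (cases "j \<in> disc r")
      case False
      have "norm (xi j) \<le> norm (xi (j - d)) + \<kappa>"
        using norm_triangle_ineq[of "xi j - dvec d" "dvec d"] by (simp add: xi_diff \<kappa>_def)
      with False show ?thesis by (simp add: disc_def)
    next
      case True
      then have "r \<le> norm (xi (j - d))" using j by (simp add: disc_def)
      then show ?thesis by (simp add: \<kappa>_def add_increasing2 diff_le_eq)
    qed
    moreover have "r / 2 \<le> r - \<kappa>" using r by simp
    moreover have "0 < r" using r norm_ge_zero[of "dvec d"] unfolding \<kappa>_def by linarith
    note r0 = this
    ultimately have "(r/2)\<^sup>2 \<le> (norm (xi (j - d)))\<^sup>2" by (intro power_mono) auto
    then have "r\<^sup>2 / 4 \<le> wt (j - d)" by (simp add: wt_def power_divide)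
    with r0 have "1 / wt (j - d) \<le> 1 / (r\<^sup>2 / 4)" by (intro divide_left_mono) (auto intro!: wt_pos mult_pos_pos)
    then have "C * (1 / wt (j - d)) \<le> C * (4 / r\<^sup>2)" using C(1) by (intro mult_left_mono) auto
    moreover have "norm (a (j - d)) \<le> C * (1 / wt (j - d))"
      using C(2)[of "j - d"] wt_pos[of "j - d"] by (simp add: powr_minus divide_inverse)
    ultimately show ?thesis by (simp add: mult.commute)
  qed
  have bound: "norm (wdiff d z * psum a r z - psum (bdiff d a) r z) \<le> 8 * C * (4 * cbound + 3) / r"
    if r: "2 * \<kappa> + 1 \<le> r" for r
  proof -
    have r1: "1 \<le> r" using r norm_ge_zero[of "dvec d"] unfolding \<kappa>_def by linarith
    have part: "(\<Sum>j\<in>X. norm (a (j - d))) \<le> (4 * cbound + 3) * r * (4 * C / r\<^sup>2)"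
      if X: "X = {j. j - d \<in> disc r \<and> j \<notin> disc r} \<or> X = {j. j \<in> disc r \<and> j - d \<notin> disc r}" for X
    proof -
      have "(\<Sum>j\<in>X. norm (a (j - d))) \<le> (\<Sum>j\<in>X. 4 * C / r\<^sup>2)"
        using X by (intro sum_mono small[OF r]) auto
      also have "\<dots> = real (card X) * (4 * C / r\<^sup>2)" by simp
      also have "\<dots> \<le> (4 * cbound + 3) * r * (4 * C / r\<^sup>2)"
      proof (rule mult_right_mono)
        have "real (card X) \<le> 2 * (cbound * (1 + r)) + 3"
        using r1 by (intro card_disc_boundary(2)[OF d _ X]) auto
        moreover have "cbound * 1 \<le> cbound * r" using r1 cbound_ge_1 by (intro mult_left_mono) auto
        ultimately show "real (card X) \<le> (4 * cbound + 3) * r" using r1 by (simp add: algebra_simps)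
      qed (use C(1) in simp)
      finally show ?thesis .
    qed
    have "norm (wdiff d z * psum a r z - psum (bdiff d a) r z)
      \<le> (4 * cbound + 3) * r * (4 * C / r\<^sup>2) + (4 * cbound + 3) * r * (4 * C / r\<^sup>2)"
      by (rule order_trans[OF psum_bdiff_bound]) (intro add_mono part; simp)
    also have "\<dots> = 8 * C * (4 * cbound + 3) / r" using r1 by (simp add: power2_eq_square field_simps)
    finally show ?thesis .
  qed
  have lim: "((\<lambda>r. 8 * C * (4 * cbound + 3) / r) \<longlongrightarrow> 0) at_top"
    by (intro tendsto_divide_0[OF tendsto_const] filterlim_at_top_imp_at_infinity filterlim_ident)
  show ?thesis
    by (rule Lim_null_comparison[OF _ lim])
      (use bound in \<open>auto simp: eventually_at_top_linorder\<close>)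
qed

text \<open>At the origin \<open>wdiff\<close> vanishes, so the disc sums of the differences consist
  of boundary terms alone and tend to 0.\<close>

lemma series_bdiff_0:
  assumes "decays 1 a" "decays s (bdiff d a)" "9/8 \<le> s" "d \<in> dirs"
  shows "series (bdiff d a) 0 = 0"
proof -
  have "((\<lambda>r. - (wdiff d 0 * psum a r 0 - psum (bdiff d a) r 0)) \<longlongrightarrow> - 0) at_top"
    by (intro tendsto_minus psum_bdiff_tendsto assms)
  then have "((\<lambda>r. psum (bdiff d a) r 0) \<longlongrightarrow> 0) at_top" by (simp add: wdiff_def)
  with psum_tendsto_series[OF assms(2,3), of 0] show ?thesis
    using tendsto_unique[OF trivial_limit_at_top_linorder] by blast
qed

text \<open>Abel's criterion: one difference makes the coefficients absolutely summable, and off the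
  zeros of \<open>wdiff d\<close> the factor can be divided out again.\<close>

lemma psum_tendsto:
  assumes "decays 1 a" "decays s (bdiff d a)" "9/8 \<le> s" "d \<in> dirs" "wdiff d z \<noteq> 0"
  shows "((\<lambda>r. psum a r z) \<longlongrightarrow> series (bdiff d a) z / wdiff d z) at_top"
proof -
  have "((\<lambda>r. ((wdiff d z * psum a r z - psum (bdiff d a) r z) + psum (bdiff d a) r z) / wdiff d z)
      \<longlongrightarrow> (0 + series (bdiff d a) z) / wdiff d z) at_top"
    by (intro tendsto_intros psum_bdiff_tendsto psum_tendsto_series[OF assms(2,3)] assms)
  then show ?thesis using assms(5) by simp
qed

text \<open>
  \<open>- bcoef\<close> agrees with \<open>1 / (\<omega>\<^sup>2 - |\<xi>|\<^sup>2)\<close> up to \<open>O(|\<xi>|\<^sup>-\<^sup>4)\<close>, which contributes a continuously differentiable function.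
\<close>

definition bcoef :: "int \<times> int \<Rightarrow> complex" where "bcoef i = of_real (1 / wt i)"

text \<open>This is \<open>wt i - wt (i - d)\<close>. Being affine in the index, it has a constant
  difference, which keeps the second differences of \<open>bcoef\<close> small.\<close>

definition gap :: "int \<times> int \<Rightarrow> int \<times> int \<Rightarrow> complex" where
  "gap d i = of_real (2 * (xi i \<bullet> dvec d) - (norm (dvec d))\<^sup>2)"

lemma decays_bcoef: "decays 1 bcoef"
proof (rule decI)
  fix i show "norm (bcoef i) \<le> 1 * wt i powr (-1)"
    unfolding bcoef_def norm_of_real using wt_pos[of i] by (simp add: powr_minus divide_inverse)
qed

lemma decays_gap: "decays (-1/2) (gap d)"
proof -
  have "gap d = (\<lambda>i. 2 * of_real (xi i \<bullet> dvec d) - of_real ((norm (dvec d))\<^sup>2))"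
    by (rule ext) (simp add: gap_def)
  then show ?thesis
    using decays_diff[OF decays_cmult[OF decays_xi] decays_mono[OF decays_const]] by simp
qed

lemma wt_diff: "wt (i - d) = wt i - (2 * (xi i \<bullet> dvec d) - (norm (dvec d))\<^sup>2)"
  unfolding wt_def xi_diff by (simp add: power2_norm_eq_inner inner_diff_left inner_diff_right inner_commute)

lemma bdiff_bcoef: "bdiff d bcoef i = gap d i * (bcoef i * bcoef (i - d))"
proof -
  have "1 / wt (i - d) - 1 / wt i = (wt i - wt (i - d)) * (1 / wt i * (1 / wt (i - d)))"
    using wt_nonzero[of i] wt_nonzero[of "i - d"] by (simp add: field_simps)
  then have "1 / wt (i - d) - 1 / wt i
      = (2 * (xi i \<bullet> dvec d) - (norm (dvec d))\<^sup>2) * (1 / wt i * (1 / wt (i - d)))"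
    using wt_diff[of i d] by simp
  then have "complex_of_real (1 / wt (i - d) - 1 / wt i)
      = of_real ((2 * (xi i \<bullet> dvec d) - (norm (dvec d))\<^sup>2) * (1 / wt i * (1 / wt (i - d))))"
    by (rule arg_cong)
  then show ?thesis by (simp only: bdiff_def bcoef_def gap_def of_real_mult of_real_diff)
qed

lemma decays_bdiff_bcoef: "decays (3/2) (bdiff d bcoef)"
  unfolding bdiff_bcoef[abs_def]
  by (rule decays_mult[OF decays_gap decays_mult[OF decays_bcoef decays_shift[OF decays_bcoef] refl]]) simp

lemma bdiff_mult: "bdiff d (\<lambda>i. f i * g i) i = bdiff d f i * g (i - d) + f i * bdiff d g i"
  by (simp add: bdiff_def algebra_simps)

lemma bdiff_gap: "bdiff d (gap d) i = of_real (- 2 * (norm (dvec d))\<^sup>2)"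
  by (simp add: bdiff_def gap_def xi_diff inner_diff_left power2_norm_eq_inner)

text \<open>Product rule applied to \<open>gap d i * (bcoef i * bcoef (i - d))\<close>: a difference
  falls either on the affine factor, leaving a constant, or on a factor \<open>bcoef\<close>. Either
  way it gains half a power of \<open>wt\<close>.\<close>

lemma decays_bdiff_bdiff_bcoef: "decays 2 (bdiff d (bdiff d bcoef))"
proof -
  have eq: "bdiff d (bdiff d bcoef) = (\<lambda>i. of_real (- 2 * (norm (dvec d))\<^sup>2) * (bcoef (i - d) * bcoef (i - d - d))
     + gap d i * (bdiff d bcoef i * bcoef (i - d - d) + bcoef i * bdiff d bcoef (i - d)))"
  proof
    fix i
    have "bdiff d (bdiff d bcoef) i = bdiff d (\<lambda>i. gap d i * (bcoef i * bcoef (i - d))) i"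
      by (simp add: bdiff_bcoef[abs_def])
    also have "\<dots> = of_real (- 2 * (norm (dvec d))\<^sup>2) * (bcoef (i - d) * bcoef (i - d - d))
     + gap d i * (bdiff d bcoef i * bcoef (i - d - d) + bcoef i * bdiff d bcoef (i - d))"
      unfolding bdiff_mult bdiff_gap by (simp add: bdiff_def algebra_simps)
    finally show "bdiff d (bdiff d bcoef) i = of_real (- 2 * (norm (dvec d))\<^sup>2) * (bcoef (i - d) * bcoef (i - d - d))
     + gap d i * (bdiff d bcoef i * bcoef (i - d - d) + bcoef i * bdiff d bcoef (i - d))" .
  qed
  have 1: "decays 2 (\<lambda>i. of_real (- 2 * (norm (dvec d))\<^sup>2) * (bcoef (i - d) * bcoef (i - d - d)))"
    by (intro decays_cmult decays_mult[where s = 1 and t = 1] decays_shift decays_bcoef)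
      (simp_all add: diff_diff_add decays_shift decays_bcoef)
  have 2: "decays 2 (\<lambda>i. gap d i * (bdiff d bcoef i * bcoef (i - d - d) + bcoef i * bdiff d bcoef (i - d)))"
  proof (rule decays_mult[OF decays_gap decays_add])
    show "decays (5/2) (\<lambda>i. bdiff d bcoef i * bcoef (i - d - d))"
      by (rule decays_mult[OF decays_bdiff_bcoef]) (simp_all add: diff_diff_add decays_shift decays_bcoef)
    show "decays (5/2) (\<lambda>i. bcoef i * bdiff d bcoef (i - d))"
      by (rule decays_mult[OF decays_bcoef decays_shift[OF decays_bdiff_bcoef]]) simp
  qed simp
  show ?thesis by (subst eq) (rule decays_add[OF 1 2])
qed

lemma bdiff_grad_bcoef: "bdiff d (grad h bcoef) i = - (\<i> * of_real (dvec d \<bullet> h)) * bcoef (i - d) + \<i> * of_real (xi i \<bullet> h) * bdiff d bcoef i"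
  by (simp add: bdiff_def grad_def xi_diff inner_diff_left algebra_simps)

text \<open>Leibniz rule: the factor \<open>xi i \<bullet> h\<close> is affine in \<open>i\<close>,
  so its second difference vanishes and only one mixed term survives.\<close>

lemma bdiff_bdiff_grad_bcoef:
  "bdiff d (bdiff d (grad h bcoef)) i = grad h (bdiff d (bdiff d bcoef)) i - 2 * \<i> * of_real (dvec d \<bullet> h) * bdiff d bcoef (i - d)"
proof -
  have x1: "xi (i - d) \<bullet> h = xi i \<bullet> h - dvec d \<bullet> h" for i by (simp add: xi_diff inner_diff_left)
  then have x2: "xi (i - d - d) \<bullet> h = xi i \<bullet> h - 2 * (dvec d \<bullet> h)" by (simp only: x1)
  show ?thesis unfolding bdiff_def grad_def x1 x2 by (simp add: algebra_simps)
qed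

lemma decays_bdiff_grad_bcoef: "decays 1 (bdiff d (grad h bcoef))"
  unfolding bdiff_grad_bcoef[abs_def]
  by (intro decays_add decays_cmult decays_shift decays_bcoef decays_mult[OF decays_cmult[OF decays_xi] decays_bdiff_bcoef]) simp

lemma decays_bdiff_bdiff_grad_bcoef: "decays (3/2) (bdiff d (bdiff d (grad h bcoef)))"
  unfolding bdiff_bdiff_grad_bcoef[abs_def]
  by (intro decays_diff decays_grad[OF decays_bdiff_bdiff_bcoef] decays_cmult decays_shift decays_bdiff_bcoef) simp

section \<open>The Bessel kernel: up to the cell area, the quasi-periodic fundamental solution of 1
  - Laplacian\<close>

definition bessel :: "real^2 \<Rightarrow> complex" where "bessel z = Lim at_top (\<lambda>r. psum bcoef r z)"

text \<open>Stated through \<open>wdiff\<close> because the proofs divide by a nonzero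
  \<open>wdiff d z\<close>; the equivalence with lying outside the period lattice is
  \<open>off_lattice_iff\<close>.\<close>

definition off_lattice :: "real^2 \<Rightarrow> bool" where "off_lattice z \<longleftrightarrow> (\<exists>d\<in>dirs. wdiff d z \<noteq> 0)"

lemma psum_bcoef_tendsto:
  assumes "off_lattice z" shows "((\<lambda>r. psum bcoef r z) \<longlongrightarrow> bessel z) at_top"
proof -
  from assms obtain d where "d \<in> dirs" "wdiff d z \<noteq> 0" by (auto simp: off_lattice_def)
  then have "((\<lambda>r. psum bcoef r z) \<longlongrightarrow> series (bdiff d bcoef) z / wdiff d z) at_top"
    by (intro psum_tendsto[OF decays_bcoef decays_bdiff_bcoef]) auto
  from this tendsto_Lim[OF trivial_limit_at_top_linorder this] show ?thesis by (simp add: bessel_def)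
qed

text \<open>The first form serves for size estimates. The second has coefficients of decay 2, which
  can be differentiated term by term.\<close>

lemma bessel_eq:
  assumes "d \<in> dirs" "wdiff d z \<noteq> 0"
  shows "bessel z = series (bdiff d bcoef) z / wdiff d z" "bessel z = series (bdiff d (bdiff d bcoef)) z / (wdiff d z)\<^sup>2"
proof -
  have "((\<lambda>r. psum bcoef r z) \<longlongrightarrow> series (bdiff d bcoef) z / wdiff d z) at_top"
    using assms by (intro psum_tendsto[OF decays_bcoef decays_bdiff_bcoef]) auto
  from tendsto_Lim[OF trivial_limit_at_top_linorder this] show 1: "bessel z = series (bdiff d bcoef) z / wdiff d z"
    by (simp add: bessel_def)
  show "bessel z = series (bdiff d (bdiff d bcoef)) z / (wdiff d z)\<^sup>2"
    unfolding 1 using assms(2) by (simp add: series_bdiff[OF decays_bdiff_bcoef] power2_eq_square)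
qed

lemma wdiff_has_derivative:
  "(wdiff d has_derivative (\<lambda>h. \<i> * of_real (dvec d \<bullet> h) * cis (dvec d \<bullet> z))) (at z)"
  unfolding wdiff_def by (auto intro!: derivative_eq_intros simp: scaleR_conv_of_real)

lemma isCont_wdiff: "isCont (wdiff d) z"
  using wdiff_has_derivative has_derivative_continuous by blast

lemma open_wdiff_nonzero: "open {z. wdiff d z \<noteq> 0}"
  using isCont_wdiff by (intro open_Collect_neq continuous_intros continuous_at_imp_continuous_on) auto

text \<open>The gradient coefficients themselves are not even square summable, so the derivative
  series is given a meaning by differencing twice and dividing by \<open>(wdiff d z)^2\<close>. The
  quotient rule for the second form of \<open>bessel_eq\<close> leads to exactly this
  expression.\<close>

lemma bessel_has_derivative:
  assumes d: "d \<in> dirs" "wdiff d z \<noteq> 0"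
  shows "(bessel has_derivative (\<lambda>h. series (bdiff d (bdiff d (grad h bcoef))) z / (wdiff d z)\<^sup>2)) (at z)"
proof (rule has_derivative_transform_within_open)
  show "open {z. wdiff d z \<noteq> 0}" by (rule open_wdiff_nonzero)
  show "z \<in> {z. wdiff d z \<noteq> 0}" using d by simp
  show "series (bdiff d (bdiff d bcoef)) w / (wdiff d w)\<^sup>2 = bessel w" if "w \<in> {z. wdiff d z \<noteq> 0}" for w
    using bessel_eq(2)[OF d(1)] that by simp
  have g2: "decays (3/2) (grad h (bdiff d (bdiff d bcoef)))" for h by (rule decays_grad[OF decays_bdiff_bdiff_bcoef]) simp
  \<comment> \<open>The mixed term of the Leibniz rule, after its index shift, matches what the
    quotient rule takes from differentiating the denominator.\<close>
  have eq: "series (bdiff d (bdiff d (grad h bcoef))) z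
     = series (grad h (bdiff d (bdiff d bcoef))) z - 2 * \<i> * of_real (dvec d \<bullet> h) * (cis (dvec d \<bullet> z) * series (bdiff d bcoef) z)" for h
    unfolding bdiff_bdiff_grad_bcoef[abs_def]
    by (subst series_diff[OF g2 decays_cmult[OF decays_shift[OF decays_bdiff_bcoef]]]) (simp_all add: series_cmult series_shift[of "bdiff d bcoef"])
  show "((\<lambda>z. series (bdiff d (bdiff d bcoef)) z / (wdiff d z)\<^sup>2) has_derivative
      (\<lambda>h. series (bdiff d (bdiff d (grad h bcoef))) z / (wdiff d z)\<^sup>2)) (at z)"
  proof (rule has_derivative_eq_rhs)
    show "((\<lambda>z. series (bdiff d (bdiff d bcoef)) z / (wdiff d z)\<^sup>2) has_derivative
      (\<lambda>h. (series (grad h (bdiff d (bdiff d bcoef))) z * (wdiff d z)\<^sup>2 -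
        series (bdiff d (bdiff d bcoef)) z * (2 * wdiff d z * (\<i> * of_real (dvec d \<bullet> h) * cis (dvec d \<bullet> z)))) /
        ((wdiff d z)\<^sup>2 * (wdiff d z)\<^sup>2))) (at z)"
      using d(2)
      by (intro has_derivative_divide' series_has_derivative[OF decays_bdiff_bdiff_bcoef])
        (auto intro!: derivative_eq_intros wdiff_has_derivative simp: mult_ac)
    show "(\<lambda>h. (series (grad h (bdiff d (bdiff d bcoef))) z * (wdiff d z)\<^sup>2 -
        series (bdiff d (bdiff d bcoef)) z * (2 * wdiff d z * (\<i> * of_real (dvec d \<bullet> h) * cis (dvec d \<bullet> z)))) /
        ((wdiff d z)\<^sup>2 * (wdiff d z)\<^sup>2)) = (\<lambda>h. series (bdiff d (bdiff d (grad h bcoef))) z / (wdiff d z)\<^sup>2)"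
      using d(2) unfolding eq by (intro ext) (simp add: series_bdiff[OF decays_bdiff_bcoef] field_simps power2_eq_square)
  qed
qed

end

section \<open>Size of the singularity at the origin\<close>

lemma eventually_at_0_powr_le:
  fixes V :: real
  assumes "0 < s" "\<forall>\<^sub>F r in at_right 0. V \<le> C * r powr s"
  shows "V \<le> 0"
proof (rule tendsto_lowerbound[OF _ assms(2)])
  have "((\<lambda>r. C * r powr s) \<longlongrightarrow> C * 0 powr s) (at_right 0)"
    using assms(1) by (intro tendsto_intros tendsto_powr') (auto intro: eventually_mono[OF eventually_at_right_less])
  then show "((\<lambda>r. C * r powr s) \<longlongrightarrow> 0) (at_right 0)" using assms(1) by simp
qed simp

context dual_lattice
begin

lemma dvec_dirs [simp]: "dvec (1, 0) = k1" "dvec (0, 1) = k2"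
  by (simp_all add: dvec_def)

text \<open>By \<open>dual_expand\<close> a vector \<open>z\<close> cannot be nearly orthogonal to
  both \<open>k1\<close> and \<open>k2\<close>, so one of the two phases is comparable to |z|, and
  for small phases |cis t - 1| is at least |t|/2. Which direction works depends on
  \<open>z\<close>.\<close>

lemma wdiff_lower_bound:
  "\<exists>c>0. \<forall>\<^sub>F z in at 0. \<exists>d\<in>dirs. c * norm z \<le> norm (wdiff d z)"
proof -
  define A where "A = norm a1 + norm a2"
  define K where "K = norm k1 + norm k2"
  have nz: "a1 \<noteq> 0" "k1 \<noteq> 0" using dual by auto
  then have pos: "0 < A" "0 < K" by (auto simp: A_def K_def intro: add_pos_nonneg)
  have low: "\<bar>t\<bar> / 2 \<le> norm (cis t - 1)" if "\<bar>t\<bar> \<le> 1/2" for t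
  proof -
    have "norm (\<i> * complex_of_real t) \<le> norm (cis t - 1 - \<i> * of_real t) + norm (cis t - 1)"
      using norm_triangle_ineq4[of "cis t - 1" "cis t - 1 - \<i> * complex_of_real t"] by simp
    then have "\<bar>t\<bar> \<le> t\<^sup>2 + norm (cis t - 1)" using norm_cis_taylor_le[of t] by (simp add: norm_mult)
    moreover have "\<bar>t\<bar> * \<bar>t\<bar> \<le> (1/2) * \<bar>t\<bar>" using that by (intro mult_right_mono) auto
    ultimately show ?thesis by (simp add: power2_eq_square)
  qed
  have main: "\<exists>d\<in>dirs. (pi / A) * norm z \<le> norm (wdiff d z)" if z: "norm z < 1 / (2 * K)" for z
  proof -
    have "norm ((2 * pi) *\<^sub>R z) \<le> \<bar>k1 \<bullet> z\<bar> * norm a1 + \<bar>k2 \<bullet> z\<bar> * norm a2"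
      unfolding dual_expand by (rule order_trans[OF norm_triangle_ineq]) simp
    also have "\<dots> \<le> max \<bar>k1 \<bullet> z\<bar> \<bar>k2 \<bullet> z\<bar> * A"
      unfolding A_def distrib_left by (intro add_mono mult_right_mono) auto
    finally have "2 * (pi / A) * norm z \<le> max \<bar>k1 \<bullet> z\<bar> \<bar>k2 \<bullet> z\<bar>" using pos by (simp add: field_simps)
    then obtain d where d: "d \<in> dirs" "2 * (pi / A) * norm z \<le> \<bar>dvec d \<bullet> z\<bar>"
      by (force simp: dirs_def max_def split: if_splits)
    have "\<bar>dvec d \<bullet> z\<bar> \<le> norm (dvec d) * norm z" by (rule Cauchy_Schwarz_ineq2)
    also have "\<dots> \<le> K * (1 / (2 * K))"
      using d(1) z pos by (intro mult_mono) (auto simp: dirs_def K_def)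
    also have "\<dots> = 1/2" using pos by simp
    finally have "\<bar>dvec d \<bullet> z\<bar> / 2 \<le> norm (wdiff d z)" unfolding wdiff_def by (rule low)
    with d show ?thesis by (intro bexI[of _ d]) auto
  qed
  have "\<forall>\<^sub>F z in at 0. norm z < 1 / (2 * K)"
    unfolding eventually_at using pos by (intro exI[of _ "1 / (2 * K)"]) auto
  then have "\<forall>\<^sub>F z in at 0. \<exists>d\<in>dirs. (pi / A) * norm z \<le> norm (wdiff d z)"
    by (rule eventually_mono) (rule main)
  then show ?thesis using pos by (intro exI[of _ "pi / A"]) auto
qed

lemma eventually_off_lattice: "\<forall>\<^sub>F z in at 0. off_lattice z"
proof -
  obtain c where c: "0 < c" "\<forall>\<^sub>F z in at 0. \<exists>d\<in>dirs. c * norm z \<le> norm (wdiff d z)"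
    using wdiff_lower_bound by blast
  have "\<forall>\<^sub>F z in at (0::real^2). z \<noteq> 0" by (simp add: eventually_at_filter)
  with c(2) show ?thesis
  proof eventually_elim
    case (elim z)
    then show ?case unfolding off_lattice_def using c(1)
      by (metis mult_pos_pos norm_le_zero_iff norm_zero not_le zero_less_norm_iff)
  qed
qed

text \<open>Since a series of differences vanishes at 0, its Hoelder continuity becomes a bound in
  |z|. The two directions share one constant because the good direction varies with
  \<open>z\<close>.\<close>

lemma series_bdiff_bound:
  assumes "\<And>d. d \<in> dirs \<Longrightarrow> decays 1 (a d)" "\<And>d. d \<in> dirs \<Longrightarrow> decays (3/2) (bdiff d (a d))"
  shows "\<exists>C\<ge>0. \<forall>d\<in>dirs. \<forall>z. norm (series (bdiff d (a d)) z) \<le> C * norm z powr (3/4)"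
proof -
  have "\<exists>C\<ge>0. \<forall>z. norm (series (bdiff d (a d)) z) \<le> C * norm z powr (3/4)" if d: "d \<in> dirs" for d
  proof -
    obtain C where "0 \<le> C" "\<And>z w. norm (series (bdiff d (a d)) z - series (bdiff d (a d)) w) \<le> C * norm (z - w) powr (3/4)"
      using series_Hoelder[OF assms(2)[OF d]] by blast
    moreover have "series (bdiff d (a d)) 0 = 0" using assms d by (intro series_bdiff_0[of _ "3/2"]) auto
    ultimately show ?thesis by (metis diff_zero)
  qed
  then obtain C where C: "\<And>d. d \<in> dirs \<Longrightarrow> 0 \<le> C d"
    "\<And>d z. d \<in> dirs \<Longrightarrow> norm (series (bdiff d (a d)) z) \<le> C d * norm z powr (3/4)" by metis
  have fin: "finite dirs" by (simp add: dirs_def)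
  have "norm (series (bdiff d (a d)) z) \<le> sum C dirs * norm z powr (3/4)" if "d \<in> dirs" for d z
    using C fin that by (intro order_trans[OF C(2)] mult_right_mono member_le_sum) auto
  then show ?thesis using C by (intro exI[of _ "sum C dirs"]) (auto intro: sum_nonneg)
qed

text \<open>A numerator of order 3/4 over a denominator of order 1. The true singularity is
  logarithmic, but this power is already square integrable on a curve.\<close>

lemma bessel_bound: "\<exists>C. \<forall>\<^sub>F z in at 0. norm (bessel z) \<le> C * norm z powr (-1/4)"
proof -
  obtain c where c: "0 < c" "\<forall>\<^sub>F z in at 0. \<exists>d\<in>dirs. c * norm z \<le> norm (wdiff d z)"
    using wdiff_lower_bound by blast
  obtain C where C: "0 \<le> C" "\<And>d z. d \<in> dirs \<Longrightarrow> norm (series (bdiff d bcoef) z) \<le> C * norm z powr (3/4)"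
    using series_bdiff_bound[of "\<lambda>_. bcoef"] decays_bcoef decays_bdiff_bcoef by auto
  have "\<forall>\<^sub>F z in at (0::real^2). z \<noteq> 0" by (simp add: eventually_at_filter)
  with c(2) have "\<forall>\<^sub>F z in at 0. norm (bessel z) \<le> C / c * norm z powr (-1/4)"
  proof eventually_elim
    case (elim z)
    then obtain d where d: "d \<in> dirs" "c * norm z \<le> norm (wdiff d z)" by blast
    have pos: "0 < c * norm z" using c elim by simp
    then have "wdiff d z \<noteq> 0" using d(2) by auto
    then have "norm (bessel z) = norm (series (bdiff d bcoef) z) / norm (wdiff d z)"
      using bessel_eq(1)[OF d(1)] by (simp add: norm_divide)
    also have "\<dots> \<le> (C * norm z powr (3/4)) / (c * norm z)"
      using d pos C by (intro frac_le) auto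
    also have "\<dots> = C / c * (norm z powr (3/4) / norm z powr 1)" using elim by simp
    also have "norm z powr (3/4) / norm z powr 1 = norm z powr (-1/4)"
      unfolding powr_diff[symmetric] by simp
    finally show ?case .
  qed
  then show ?thesis by blast
qed

definition dbessel :: "real^2 \<Rightarrow> real^2 \<Rightarrow> complex" where "dbessel z = frechet_derivative bessel (at z)"

lemma dbessel_eq:
  assumes "d \<in> dirs" "wdiff d z \<noteq> 0"
  shows "dbessel z h = series (bdiff d (bdiff d (grad h bcoef))) z / (wdiff d z)\<^sup>2"
  unfolding dbessel_def using frechet_derivative_at[OF bessel_has_derivative[OF assms]] by metis

lemma bessel_has_derivative_dbessel:
  assumes "off_lattice z" shows "(bessel has_derivative dbessel z) (at z)"
proof -
  from assms obtain d where d: "d \<in> dirs" "wdiff d z \<noteq> 0" by (auto simp: off_lattice_def)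
  from bessel_has_derivative[OF d] dbessel_eq[OF d, abs_def] show ?thesis by simp
qed

lemma linear_dbessel: "off_lattice z \<Longrightarrow> linear (dbessel z)"
  using bessel_has_derivative_dbessel has_derivative_linear by blast

text \<open>A numerator of order 3/4 over a denominator of order 2. The true order is -1; the loss
  of 1/4 is harmless because this bound is always multiplied by a power of |z| or by |n \<bullet>
  z|.\<close>

lemma dbessel_bound: "\<exists>C\<ge>0. \<forall>\<^sub>F z in at 0. norm (dbessel z h) \<le> C * norm z powr (-5/4)"
proof -
  obtain c where c: "0 < c" "\<forall>\<^sub>F z in at 0. \<exists>d\<in>dirs. c * norm z \<le> norm (wdiff d z)"
    using wdiff_lower_bound by blast
  obtain C where C: "0 \<le> C" "\<And>d z. d \<in> dirs \<Longrightarrow> norm (series (bdiff d (bdiff d (grad h bcoef))) z) \<le> C * norm z powr (3/4)"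
    using series_bdiff_bound[of "\<lambda>d. bdiff d (grad h bcoef)"] decays_bdiff_grad_bcoef decays_bdiff_bdiff_grad_bcoef by auto
  have "\<forall>\<^sub>F z in at (0::real^2). z \<noteq> 0" by (simp add: eventually_at_filter)
  with c(2) have "\<forall>\<^sub>F z in at 0. norm (dbessel z h) \<le> C / c\<^sup>2 * norm z powr (-5/4)"
  proof eventually_elim
    case (elim z)
    then obtain d where d: "d \<in> dirs" "c * norm z \<le> norm (wdiff d z)" by blast
    have pos: "0 < c * norm z" using c elim by simp
    then have "wdiff d z \<noteq> 0" using d(2) by auto
    then have "norm (dbessel z h) = norm (series (bdiff d (bdiff d (grad h bcoef))) z) / (norm (wdiff d z))\<^sup>2"
      using dbessel_eq[OF d(1)] by (simp add: norm_divide norm_power)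
    also have "\<dots> \<le> (C * norm z powr (3/4)) / (c * norm z)\<^sup>2"
      using d pos C by (intro frac_le power_mono) auto
    also have "\<dots> = C / c\<^sup>2 * (norm z powr (3/4) / norm z powr 2)"
      using elim by (simp add: power_mult_distrib powr_numeral)
    also have "norm z powr (3/4) / norm z powr 2 = norm z powr (-5/4)"
      unfolding powr_diff[symmetric] by simp
    finally show ?case .
  qed
  then show ?thesis using C c by (intro exI[of _ "C / c\<^sup>2"]) auto
qed

section \<open>The angular derivative at the origin\<close>

text \<open>
  To first order in \<open>z\<close>, the angular derivative is a combination of the products of \<open>wdiff d z\<close> with
  the derivatives along \<open>rot90 a1\<close> and \<open>rot90 a2\<close>; these are the resulting coefficients. Each summand
  is only \<open>O(|\<xi>|\<^sup>-\<^sup>2)\<close>, and the leading terms cancel since \<open>bcoef\<close> is radial.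
\<close>

definition rcoef :: "int \<times> int \<Rightarrow> complex" where
  "rcoef i = bdiff (1, 0) (grad (rot90 a1) bcoef) i + bdiff (0, 1) (grad (rot90 a2) bcoef) i"

text \<open>By \<open>dual_expand\<close>, \<open>2 * pi\<close> times the identity is the sum of
  the maps sending \<open>z\<close> to \<open>(k1 \<bullet> z) *\<^sub>R a1\<close> and
  \<open>(k2 \<bullet> z) *\<^sub>R a2\<close>. Composed with \<open>rot90\<close> its trace is the
  left side, and \<open>rot90\<close> has trace 0.\<close>

lemma trace_rot90: "k1 \<bullet> rot90 a1 + k2 \<bullet> rot90 a2 = 0"
proof -
  have "(2 * pi) *\<^sub>R axis 1 1 = (k1 \<bullet> axis 1 1) *\<^sub>R a1 + (k2 \<bullet> axis 1 1) *\<^sub>R a2"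
    "(2 * pi) *\<^sub>R axis 2 1 = (k1 \<bullet> axis 2 1) *\<^sub>R a1 + (k2 \<bullet> axis 2 1) *\<^sub>R a2"
    by (rule dual_expand)+
  then have "((2 * pi) *\<^sub>R axis 1 1 :: real^2) $ 2 = k1$1 * a1$2 + k2$1 * a2$2"
    "((2 * pi) *\<^sub>R axis 2 1 :: real^2) $ 1 = k1$2 * a1$1 + k2$2 * a2$1"
    by (simp_all add: inner_axis)
  then show ?thesis by (simp add: inner_real2 axis_def)
qed

text \<open>Rotate the expansion of \<open>v\<close> from \<open>dual_expand\<close> and pair it
  with \<open>v\<close>, which is orthogonal to its own rotation.\<close>

lemma inner_rot90_expand: "(k1 \<bullet> v) * (v \<bullet> rot90 a1) + (k2 \<bullet> v) * (v \<bullet> rot90 a2) = 0"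
proof -
  have "v \<bullet> rot90 ((2 * pi) *\<^sub>R v) = v \<bullet> rot90 ((k1 \<bullet> v) *\<^sub>R a1 + (k2 \<bullet> v) *\<^sub>R a2)"
    by (subst dual_expand) rule
  then show ?thesis
    by (simp add: linear_add[OF linear_rot90] linear_cmul[OF linear_rot90] inner_add_right)
qed

text \<open>Two cancellations raise the decay from 1 to 3/2. Where the difference hits the factor
  \<open>xi i \<bullet> h\<close>, the two coefficients are opposite by \<open>trace_rot90\<close>,
  so shifted values of \<open>bcoef\<close> combine to differences. Where it hits
  \<open>bcoef\<close>, the part quadratic in \<open>xi\<close> drops out by
  \<open>inner_rot90_expand\<close>.\<close>

lemma decays_rcoef: "decays (3/2) rcoef"
proof -
  define A where "A = rot90 a1" define B where "B = rot90 a2"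
  define c where "c = - (\<i> * of_real (k1 \<bullet> A))"
  have c: "- (\<i> * of_real (k2 \<bullet> B)) = - c"
  proof -
    have "k2 \<bullet> B = - (k1 \<bullet> A)" using trace_rot90 unfolding A_def B_def by linarith
    then show ?thesis by (simp add: c_def)
  qed
  \<comment> \<open>The quadratic form is twice the expression of \<open>inner_rot90_expand\<close>
    at \<open>xi i\<close>; what is left is linear in \<open>xi i\<close>.\<close>
  have quad: "of_real (xi i \<bullet> A) * gap (1, 0) i + of_real (xi i \<bullet> B) * gap (0, 1) i
     = - of_real ((norm k1)\<^sup>2) * of_real (xi i \<bullet> A) - of_real ((norm k2)\<^sup>2) * complex_of_real (xi i \<bullet> B)" for i
  proof -
    have "(xi i \<bullet> A) * (2 * (xi i \<bullet> k1) - (norm k1)\<^sup>2) + (xi i \<bullet> B) * (2 * (xi i \<bullet> k2) - (norm k2)\<^sup>2)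
      = 2 * ((k1 \<bullet> xi i) * (xi i \<bullet> A) + (k2 \<bullet> xi i) * (xi i \<bullet> B)) - (norm k1)\<^sup>2 * (xi i \<bullet> A) - (norm k2)\<^sup>2 * (xi i \<bullet> B)"
      by (simp add: inner_commute algebra_simps)
    also have "\<dots> = - (norm k1)\<^sup>2 * (xi i \<bullet> A) - (norm k2)\<^sup>2 * (xi i \<bullet> B)"
      unfolding A_def B_def inner_rot90_expand by simp
    finally have "complex_of_real ((xi i \<bullet> A) * (2 * (xi i \<bullet> k1) - (norm k1)\<^sup>2) + (xi i \<bullet> B) * (2 * (xi i \<bullet> k2) - (norm k2)\<^sup>2))
      = of_real (- (norm k1)\<^sup>2 * (xi i \<bullet> A) - (norm k2)\<^sup>2 * (xi i \<bullet> B))"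
      by (rule arg_cong)
    then show ?thesis unfolding gap_def dvec_dirs by simp
  qed
  have shift: "bcoef (i - d) = bcoef i + bdiff d bcoef i" for i d by (simp add: bdiff_def)
  have prod: "bdiff d bcoef i = gap d i * (bcoef i * bcoef i) + gap d i * (bcoef i * bdiff d bcoef i)" for i d
  proof -
    have "bdiff d bcoef i = gap d i * (bcoef i * bcoef (i - d))" by (rule bdiff_bcoef)
    also have "bcoef (i - d) = bcoef i + bdiff d bcoef i" by (rule shift)
    also have "gap d i * (bcoef i * (bcoef i + bdiff d bcoef i)) = gap d i * (bcoef i * bcoef i) + gap d i * (bcoef i * bdiff d bcoef i)"
      by (simp only: distrib_left)
    finally show ?thesis .
  qed
  have "rcoef i = (c * bdiff (1, 0) bcoef i + (- c) * bdiff (0, 1) bcoef i)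
    + (\<i> * (- of_real ((norm k1)\<^sup>2) * of_real (xi i \<bullet> A) - of_real ((norm k2)\<^sup>2) * of_real (xi i \<bullet> B)) * (bcoef i * bcoef i)
    + \<i> * ((of_real (xi i \<bullet> A) * gap (1, 0) i) * (bcoef i * bdiff (1, 0) bcoef i)
          + (of_real (xi i \<bullet> B) * gap (0, 1) i) * (bcoef i * bdiff (0, 1) bcoef i)))" (is "_ = ?r i") for i
  proof -
    have "rcoef i = (c * bcoef (i - (1, 0)) + (- c) * bcoef (i - (0, 1)))
      + \<i> * (of_real (xi i \<bullet> A) * bdiff (1, 0) bcoef i + of_real (xi i \<bullet> B) * bdiff (0, 1) bcoef i)"
      unfolding rcoef_def bdiff_grad_bcoef dvec_dirs A_def[symmetric] B_def[symmetric] c c_def[symmetric]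
      by (simp add: algebra_simps)
    also have "c * bcoef (i - (1, 0)) + (- c) * bcoef (i - (0, 1)) = c * bdiff (1, 0) bcoef i + (- c) * bdiff (0, 1) bcoef i"
      by (simp add: bdiff_def algebra_simps)
    also have "of_real (xi i \<bullet> A) * bdiff (1, 0) bcoef i + of_real (xi i \<bullet> B) * bdiff (0, 1) bcoef i
      = (of_real (xi i \<bullet> A) * gap (1, 0) i + of_real (xi i \<bullet> B) * gap (0, 1) i) * (bcoef i * bcoef i)
      + ((of_real (xi i \<bullet> A) * gap (1, 0) i) * (bcoef i * bdiff (1, 0) bcoef i)
          + (of_real (xi i \<bullet> B) * gap (0, 1) i) * (bcoef i * bdiff (0, 1) bcoef i))"
      by (subst prod[of "(1, 0)"], subst prod[of "(0, 1)"]) (simp add: algebra_simps)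
    finally show ?thesis unfolding quad by (simp add: algebra_simps)
  qed
  then have eq: "rcoef = ?r" by (rule ext)
  have xs: "decays (-1) (\<lambda>i. of_real (xi i \<bullet> h) * gap d i)" for h d
    by (rule decays_mult[OF decays_xi decays_gap]) simp
  have bdf: "decays (5/2) (\<lambda>i. bcoef i * bdiff d bcoef i)" for d
    by (rule decays_mult[OF decays_bcoef decays_bdiff_bcoef]) simp
  show ?thesis
    unfolding eq
    by (intro decays_add decays_cmult decays_bdiff_bcoef decays_mult[OF xs bdf]
        decays_mult[OF decays_cmult[OF decays_diff[OF decays_cmult[OF decays_xi] decays_cmult[OF decays_xi]]] decays_mult[OF decays_bcoef decays_bcoef refl]])
      simp_all
qed

lemma bdiff_commute: "bdiff d (bdiff d' a) = bdiff d' (bdiff d a)"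
  by (rule ext) (simp add: bdiff_def algebra_simps)

lemma bdiff_add: "bdiff d (\<lambda>i. a i + b i) = (\<lambda>i. bdiff d a i + bdiff d b i)"
  by (rule ext) (simp add: bdiff_def)

text \<open>Formally the rule \<open>series_bdiff\<close> for each summand. As the gradient series
  do not converge, both sides are multiplied by \<open>(wdiff d z)^2\<close>, which turns all series
  involved into convergent ones.\<close>

lemma series_rcoef:
  assumes "off_lattice z"
  shows "series rcoef z = wdiff (1, 0) z * dbessel z (rot90 a1) + wdiff (0, 1) z * dbessel z (rot90 a2)"
proof -
  from assms obtain d where d: "d \<in> dirs" "wdiff d z \<noteq> 0" by (auto simp: off_lattice_def)
  have "(wdiff d z)\<^sup>2 * series rcoef z = series (bdiff d (bdiff d rcoef)) z"
    by (simp add: series_bdiff[OF decays_rcoef] series_bdiff[OF decays_bdiff[OF decays_rcoef]] power2_eq_square)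
  also have "bdiff d (bdiff d rcoef)
      = (\<lambda>i. bdiff (1, 0) (bdiff d (bdiff d (grad (rot90 a1) bcoef))) i + bdiff (0, 1) (bdiff d (bdiff d (grad (rot90 a2) bcoef))) i)"
    unfolding rcoef_def[abs_def] bdiff_add by (simp only: bdiff_commute[of d "(1, 0)"] bdiff_commute[of d "(0, 1)"])
  also have "series \<dots> z = wdiff (1, 0) z * series (bdiff d (bdiff d (grad (rot90 a1) bcoef))) z
      + wdiff (0, 1) z * series (bdiff d (bdiff d (grad (rot90 a2) bcoef))) z"
    by (simp add: series_add[OF decays_bdiff[OF decays_bdiff_bdiff_grad_bcoef] decays_bdiff[OF decays_bdiff_bdiff_grad_bcoef]] series_bdiff[OF decays_bdiff_bdiff_grad_bcoef])
  finally show ?thesis using d(2) by (simp add: dbessel_eq[OF d] field_simps)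
qed

text \<open>Expand \<open>rot90 z\<close> in \<open>rot90 a1\<close>, \<open>rot90 a2\<close> with
  coefficients \<open>k1 \<bullet> z\<close>, \<open>k2 \<bullet> z\<close> and replace these, times
  the imaginary unit, by \<open>wdiff\<close> minus its Taylor remainder.\<close>

lemma dbessel_rot90_eq:
  assumes "off_lattice z"
  shows "2 * pi * \<i> * dbessel z (rot90 z) = series rcoef z
    - ((wdiff (1, 0) z - \<i> * of_real (k1 \<bullet> z)) * dbessel z (rot90 a1) + (wdiff (0, 1) z - \<i> * of_real (k2 \<bullet> z)) * dbessel z (rot90 a2))"
proof -
  note lin = linear_dbessel[OF assms]
  have "dbessel z (rot90 ((2 * pi) *\<^sub>R z)) = dbessel z (rot90 ((k1 \<bullet> z) *\<^sub>R a1 + (k2 \<bullet> z) *\<^sub>R a2))"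
    by (subst dual_expand) rule
  then have "of_real (2 * pi) * dbessel z (rot90 z) = of_real (k1 \<bullet> z) * dbessel z (rot90 a1) + of_real (k2 \<bullet> z) * dbessel z (rot90 a2)"
    by (simp only: linear_add[OF linear_rot90] linear_cmul[OF linear_rot90] linear_add[OF lin] linear_cmul[OF lin]
        scaleR_conv_of_real[where 'a = complex])
  then have "\<i> * (of_real (2 * pi) * dbessel z (rot90 z))
     = \<i> * (of_real (k1 \<bullet> z) * dbessel z (rot90 a1) + of_real (k2 \<bullet> z) * dbessel z (rot90 a2))" by simp
  then show ?thesis unfolding series_rcoef[OF assms] by (simp add: algebra_simps)
qed

text \<open>The Taylor remainders of \<open>wdiff\<close> are O(|z|^2) and meet derivatives of order
  -5/4, which gives 3/4, the same order as the Hoelder bound for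
  \<open>series rcoef\<close>.\<close>

lemma dbessel_rot90_limit:
  "\<exists>C. \<forall>\<^sub>F z in at 0. norm (2 * pi * \<i> * dbessel z (rot90 z) - series rcoef 0) \<le> C * norm z powr (3/4)"
proof -
  obtain C0 where C0: "0 \<le> C0" "\<And>z w. norm (series rcoef z - series rcoef w) \<le> C0 * norm (z - w) powr (3/4)"
    using series_Hoelder[OF decays_rcoef] by blast
  obtain C1 where C1: "0 \<le> C1" "\<forall>\<^sub>F z in at 0. norm (dbessel z (rot90 a1)) \<le> C1 * norm z powr (-5/4)"
    using dbessel_bound by blast
  obtain C2 where C2: "0 \<le> C2" "\<forall>\<^sub>F z in at 0. norm (dbessel z (rot90 a2)) \<le> C2 * norm z powr (-5/4)"
    using dbessel_bound by blast
  have "\<forall>\<^sub>F z in at (0::real^2). z \<noteq> 0" by (simp add: eventually_at_filter)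
  with C1(2) C2(2) eventually_off_lattice
  have "\<forall>\<^sub>F z in at 0. norm (2 * pi * \<i> * dbessel z (rot90 z) - series rcoef 0)
      \<le> (C0 + ((norm k1)\<^sup>2 * C1 + (norm k2)\<^sup>2 * C2)) * norm z powr (3/4)"
  proof eventually_elim
    case (elim z)
    have part: "norm ((wdiff d z - \<i> * of_real (dvec d \<bullet> z)) * x) \<le> (norm (dvec d))\<^sup>2 * C * norm z powr (3/4)"
      if x: "norm x \<le> C * norm z powr (-5/4)" and "0 \<le> C" for x C d
    proof -
      have "norm (wdiff d z - \<i> * of_real (dvec d \<bullet> z)) \<le> (dvec d \<bullet> z)\<^sup>2"
        unfolding wdiff_def by (rule norm_cis_taylor_le)
      also have "\<dots> \<le> (norm (dvec d) * norm z)\<^sup>2"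
        using Cauchy_Schwarz_ineq2[of "dvec d" z] power_mono[of "\<bar>dvec d \<bullet> z\<bar>" "norm (dvec d) * norm z" 2] by simp
      finally have "norm ((wdiff d z - \<i> * of_real (dvec d \<bullet> z)) * x)
        \<le> (norm (dvec d) * norm z)\<^sup>2 * (C * norm z powr (-5/4))"
        unfolding norm_mult using x by (intro mult_mono) auto
      also have "\<dots> = (norm (dvec d))\<^sup>2 * C * (norm z powr 2 * norm z powr (-5/4))"
        using elim by (simp add: power_mult_distrib powr_numeral)
      also have "norm z powr 2 * norm z powr (-5/4) = norm z powr (3/4)"
        unfolding powr_add[symmetric] by simp
      finally show ?thesis .
    qed
    have "norm (2 * pi * \<i> * dbessel z (rot90 z) - series rcoef 0)
      = norm ((series rcoef z - series rcoef 0) - ((wdiff (1, 0) z - \<i> * of_real (k1 \<bullet> z)) * dbessel z (rot90 a1)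
          + (wdiff (0, 1) z - \<i> * of_real (k2 \<bullet> z)) * dbessel z (rot90 a2)))"
      unfolding dbessel_rot90_eq[OF elim(3)] by (simp add: algebra_simps)
    also have "\<dots> \<le> norm (series rcoef z - series rcoef 0) + (norm ((wdiff (1, 0) z - \<i> * of_real (k1 \<bullet> z)) * dbessel z (rot90 a1))
          + norm ((wdiff (0, 1) z - \<i> * of_real (k2 \<bullet> z)) * dbessel z (rot90 a2)))"
      by (intro order_trans[OF norm_triangle_ineq4] add_left_mono norm_triangle_ineq)
    also have "\<dots> \<le> C0 * norm z powr (3/4) + ((norm k1)\<^sup>2 * C1 * norm z powr (3/4) + (norm k2)\<^sup>2 * C2 * norm z powr (3/4))"
      using C0(2)[of z 0] part[OF elim(1) C1(1), of "(1, 0)"] part[OF elim(2) C2(1), of "(0, 1)"]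
      by (intro add_mono) auto
    finally show ?case by (simp add: algebra_simps)
  qed
  then show ?thesis by blast
qed

text \<open>By Rolle's theorem on a circle, the limit of the angular derivative at the origin must vanish.\<close>

lemma dbessel_rot90_zero:
  assumes L: "bounded_linear (L :: complex \<Rightarrow> real)" and r: "0 < r" "\<And>z. norm z = r \<Longrightarrow> off_lattice z"
  obtains z where "norm z = r" "L (dbessel z (rot90 z)) = 0"
proof -
  define \<gamma> where "\<gamma> t = (vector [r * cos t, r * sin t] :: real^2)" for t :: real
  define \<gamma>' where "\<gamma>' h t = (vector [h * (- r * sin t), h * (r * cos t)] :: real^2)" for h t :: real
  have \<gamma>n: "norm (\<gamma> t) = r" for t
  proof -
    have "(norm (\<gamma> t))\<^sup>2 = r\<^sup>2 * (sin t)\<^sup>2 + r\<^sup>2 * (cos t)\<^sup>2"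
      unfolding power2_norm_eq_inner inner_real2 \<gamma>_def by (simp add: power2_eq_square)
    also have "\<dots> = r\<^sup>2 * ((sin t)\<^sup>2 + (cos t)\<^sup>2)" by (simp only: distrib_left)
    finally have "(norm (\<gamma> t))\<^sup>2 = r\<^sup>2" by simp
    then show ?thesis using r(1) by simp
  qed
  have c: "((\<lambda>t. r * cos t) has_derivative (\<lambda>h. h * (- r * sin t))) (at t)" for t
  proof -
    have "((\<lambda>t. r * cos t) has_real_derivative (- r * sin t)) (at t)"
      by (auto intro!: derivative_eq_intros)
    then show ?thesis unfolding has_field_derivative_def by (rule has_derivative_eq_rhs) (rule ext, simp)
  qed
  have s: "((\<lambda>t. r * sin t) has_derivative (\<lambda>h. h * (r * cos t))) (at t)" for t
  proof -
    have "((\<lambda>t. r * sin t) has_real_derivative (r * cos t)) (at t)"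
      by (auto intro!: derivative_eq_intros)
    then show ?thesis unfolding has_field_derivative_def by (rule has_derivative_eq_rhs) (rule ext, simp)
  qed
  have der: "(\<gamma> has_derivative (\<lambda>h. \<gamma>' h t)) (at t)" for t
  proof (rule has_derivative_componentwise_within[THEN iffD2], rule ballI)
    fix i :: "real^2" assume "i \<in> Basis"
    then obtain j where j: "i = axis j 1" by (auto simp: Basis_vec_def)
    have "j = 1 \<or> j = 2" by (rule exhaust_2)
    then show "((\<lambda>x. \<gamma> x \<bullet> i) has_derivative (\<lambda>x. \<gamma>' x t \<bullet> i)) (at t within UNIV)"
      unfolding j inner_axis \<gamma>_def \<gamma>'_def using c s by auto
  qed
  have rot: "\<gamma>' 1 t = rot90 (\<gamma> t)" for t by (simp add: \<gamma>_def \<gamma>'_def rot90_def)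
  have Lder: "((\<lambda>t. L (bessel (\<gamma> t))) has_derivative (\<lambda>h. L (dbessel (\<gamma> t) (\<gamma>' h t)))) (at t)" for t
    using bounded_linear.has_derivative[OF L has_derivative_compose[OF der bessel_has_derivative_dbessel[OF r(2)[OF \<gamma>n]]]]
    by simp
  have "\<exists>t. 0 < t \<and> t < 2 * pi \<and> (\<lambda>h. L (dbessel (\<gamma> t) (\<gamma>' h t))) = (\<lambda>v. 0)"
  proof (rule Rolle_deriv[where f = "\<lambda>t. L (bessel (\<gamma> t))"])
    show "L (bessel (\<gamma> 0)) = L (bessel (\<gamma> (2 * pi)))" by (simp add: \<gamma>_def)
    show "continuous_on {0..2 * pi} (\<lambda>t. L (bessel (\<gamma> t)))"
      using Lder by (intro continuous_at_imp_continuous_on ballI) (blast intro: has_derivative_continuous)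
  qed (use Lder in auto)
  then obtain t where "L (dbessel (\<gamma> t) (\<gamma>' 1 t)) = 0" by meson
  then show ?thesis using that[OF \<gamma>n] unfolding rot by blast
qed

text \<open>On every small circle the real part of the angular derivative vanishes at some point,
  where \<open>dbessel_rot90_limit\<close> bounds the real part of the limit by r^(3/4). The
  imaginary part is treated separately, as its zeros may lie elsewhere; hence the real functional
  \<open>L\<close>.\<close>

lemma series_rcoef_0: "series rcoef 0 = 0"
proof -
  obtain C where "\<forall>\<^sub>F z in at 0. norm (2 * pi * \<i> * dbessel z (rot90 z) - series rcoef 0) \<le> C * norm z powr (3/4)"
    using dbessel_rot90_limit by blast
  then have "\<forall>\<^sub>F z in at 0. norm (2 * pi * \<i> * dbessel z (rot90 z) - series rcoef 0) \<le> C * norm z powr (3/4) \<and> off_lattice z"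
    using eventually_off_lattice by (rule eventually_conj)
  then obtain \<delta> where \<delta>: "0 < \<delta>"
    "\<And>z. z \<noteq> 0 \<Longrightarrow> norm z < \<delta> \<Longrightarrow> norm (2 * pi * \<i> * dbessel z (rot90 z) - series rcoef 0) \<le> C * norm z powr (3/4)"
    "\<And>z. z \<noteq> 0 \<Longrightarrow> norm z < \<delta> \<Longrightarrow> off_lattice z"
    unfolding eventually_at by auto
  have key: "\<bar>L (series rcoef 0)\<bar> \<le> 0"
    if L: "bounded_linear L" "\<And>z. \<bar>L z\<bar> \<le> norm z"
      and L': "bounded_linear (\<lambda>z. L (2 * pi * \<i> * z))" for L :: "complex \<Rightarrow> real"
  proof (rule eventually_at_0_powr_le[of "3/4" _ C])
    have "\<bar>L (series rcoef 0)\<bar> \<le> C * r powr (3/4)" if r: "0 < r" "r < \<delta>" for r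
    proof -
      have "off_lattice z" if "norm z = r" for z using \<delta>(3)[of z] r that by auto
      then obtain z where z: "norm z = r" "L (2 * pi * \<i> * dbessel z (rot90 z)) = 0"
        using dbessel_rot90_zero[OF L' r(1)] by blast
      have "\<bar>L (series rcoef 0)\<bar> = \<bar>L (2 * pi * \<i> * dbessel z (rot90 z) - series rcoef 0)\<bar>"
        using z(2) by (simp add: linear_diff[OF bounded_linear.linear[OF L(1)]])
      also have "\<dots> \<le> norm (2 * pi * \<i> * dbessel z (rot90 z) - series rcoef 0)" by (rule L(2))
      also have "\<dots> \<le> C * r powr (3/4)" using \<delta>(2)[of z] z(1) r by auto
      finally show ?thesis .
    qed
    then show "\<forall>\<^sub>F r in at_right 0. \<bar>L (series rcoef 0)\<bar> \<le> C * r powr (3/4)"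
      using \<delta>(1) by (intro eventually_at_rightI[of 0 \<delta>]) auto
  qed simp
  have "\<bar>Re (series rcoef 0)\<bar> \<le> 0"
    by (rule key[OF bounded_linear_Re abs_Re_le_cmod bounded_linear_compose[OF bounded_linear_Re bounded_linear_mult_right]])
  moreover have "\<bar>Im (series rcoef 0)\<bar> \<le> 0"
    by (rule key[OF bounded_linear_Im abs_Im_le_cmod bounded_linear_compose[OF bounded_linear_Im bounded_linear_mult_right]])
  ultimately show ?thesis by (simp add: complex_eq_iff)
qed

lemma dbessel_rot90_bound: "\<exists>C\<ge>0. \<forall>\<^sub>F z in at 0. norm (dbessel z (rot90 z)) \<le> C * norm z powr (3/4)"
proof -
  obtain C where C: "\<forall>\<^sub>F z in at 0. norm (2 * pi * \<i> * dbessel z (rot90 z) - series rcoef 0) \<le> C * norm z powr (3/4)"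
    using dbessel_rot90_limit by blast
  then have "\<forall>\<^sub>F z in at 0. norm (dbessel z (rot90 z)) \<le> (\<bar>C\<bar> / (2 * pi)) * norm z powr (3/4)"
  proof (rule eventually_mono)
    fix z assume "norm (2 * pi * \<i> * dbessel z (rot90 z) - series rcoef 0) \<le> C * norm z powr (3/4)"
    moreover have "C * norm z powr (3/4) \<le> \<bar>C\<bar> * norm z powr (3/4)" by (intro mult_right_mono) auto
    ultimately show "norm (dbessel z (rot90 z)) \<le> (\<bar>C\<bar> / (2 * pi)) * norm z powr (3/4)"
      by (simp add: series_rcoef_0 norm_mult field_simps)
  qed
  then show ?thesis by (intro exI[of _ "\<bar>C\<bar> / (2 * pi)"]) auto
qed

text \<open>Split |z|^2 \<open>n\<close> into its components along \<open>z\<close> and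
  \<open>rot90 z\<close>. The radial part costs |n \<bullet> z| times |z| times the gradient bound,
  divided by |z|^2, so order -9/4. The angular part has the good bound 3/4, giving 1 + 3/4 - 2 =
  -1/4.\<close>

lemma dbessel_normal_bound:
  "\<exists>C\<ge>0. \<forall>\<^sub>F z in at 0. \<forall>n. norm n = 1 \<longrightarrow>
    norm (dbessel z n) \<le> C * (\<bar>n \<bullet> z\<bar> * norm z powr (-9/4) + norm z powr (-1/4))"
proof -
  obtain C1 where C1: "0 \<le> C1" "\<forall>\<^sub>F z in at 0. norm (dbessel z (axis 1 1)) \<le> C1 * norm z powr (-5/4)"
    using dbessel_bound by blast
  obtain C2 where C2: "0 \<le> C2" "\<forall>\<^sub>F z in at 0. norm (dbessel z (axis 2 1)) \<le> C2 * norm z powr (-5/4)"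
    using dbessel_bound by blast
  obtain C3 where C3: "0 \<le> C3" "\<forall>\<^sub>F z in at 0. norm (dbessel z (rot90 z)) \<le> C3 * norm z powr (3/4)"
    using dbessel_rot90_bound by blast
  have "\<forall>\<^sub>F z in at (0::real^2). z \<noteq> 0" by (simp add: eventually_at_filter)
  with C1(2) C2(2) C3(2) eventually_off_lattice
  have "\<forall>\<^sub>F z in at 0. \<forall>n. norm n = 1 \<longrightarrow>
    norm (dbessel z n) \<le> (C1 + C2 + C3) * (\<bar>n \<bullet> z\<bar> * norm z powr (-9/4) + norm z powr (-1/4))"
  proof eventually_elim
    case (elim z)
    note lin = linear_dbessel[OF elim(4)]
    let ?N = "norm z"
    have N: "0 < ?N" using elim by simp
    have "z = z$1 *\<^sub>R axis 1 1 + z$2 *\<^sub>R axis 2 1"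
      by (simp add: vec_eq_iff forall_2 axis_def)
    then have "dbessel z z = z$1 *\<^sub>R dbessel z (axis 1 1) + z$2 *\<^sub>R dbessel z (axis 2 1)"
      by (metis linear_add[OF lin] linear_cmul[OF lin])
    then have "norm (dbessel z z) \<le> \<bar>z$1\<bar> * norm (dbessel z (axis 1 1)) + \<bar>z$2\<bar> * norm (dbessel z (axis 2 1))"
      by (metis norm_scaleR norm_triangle_ineq)
    also have "\<dots> \<le> ?N * (C1 * ?N powr (-5/4)) + ?N * (C2 * ?N powr (-5/4))"
      using elim component_le_norm_cart[of z] by (intro add_mono mult_mono) auto
    also have "\<dots> = (C1 + C2) * (?N powr 1 * ?N powr (-5/4))" using N by (simp add: algebra_simps)
    also have "?N powr 1 * ?N powr (-5/4) = ?N powr (-1/4)" unfolding powr_add[symmetric] by simp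
    finally have Dz: "norm (dbessel z z) \<le> (C1 + C2) * ?N powr (-1/4)" .
    show ?case
    proof (intro allI impI)
      fix n :: "real^2" assume n: "norm n = 1"
      have "?N\<^sup>2 *\<^sub>R n = (n \<bullet> z) *\<^sub>R z + (n \<bullet> rot90 z) *\<^sub>R rot90 z"
        unfolding power2_norm_eq_inner by (simp add: vec_eq_iff forall_2 inner_real2 algebra_simps)
      then have "dbessel z (?N\<^sup>2 *\<^sub>R n) = (n \<bullet> z) *\<^sub>R dbessel z z + (n \<bullet> rot90 z) *\<^sub>R dbessel z (rot90 z)"
        by (metis linear_add[OF lin] linear_cmul[OF lin])
      then have "?N\<^sup>2 * norm (dbessel z n) = norm ((n \<bullet> z) *\<^sub>R dbessel z z + (n \<bullet> rot90 z) *\<^sub>R dbessel z (rot90 z))"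
        by (metis linear_cmul[OF lin] norm_scaleR abs_power2)
      also have "\<dots> \<le> \<bar>n \<bullet> z\<bar> * norm (dbessel z z) + \<bar>n \<bullet> rot90 z\<bar> * norm (dbessel z (rot90 z))"
        by (metis norm_scaleR norm_triangle_ineq)
      also have "\<dots> \<le> \<bar>n \<bullet> z\<bar> * ((C1 + C2) * ?N powr (-1/4)) + ?N * (C3 * ?N powr (3/4))"
        using elim Dz Cauchy_Schwarz_ineq2[of n "rot90 z"] n by (intro add_mono mult_mono) auto
      finally have "norm (dbessel z n) \<le> (\<bar>n \<bullet> z\<bar> * ((C1 + C2) * ?N powr (-1/4)) + ?N * (C3 * ?N powr (3/4))) / ?N\<^sup>2"
        using N by (simp add: field_simps)
      also have "\<dots> = (C1 + C2) * (\<bar>n \<bullet> z\<bar> * (?N powr (-1/4) / ?N powr 2)) + C3 * ((?N powr 1 * ?N powr (3/4)) / ?N powr 2)"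
        using N by (simp add: powr_numeral field_simps)
      also have "?N powr (-1/4) / ?N powr 2 = ?N powr (-9/4)" unfolding powr_diff[symmetric] by simp
      also have "(?N powr 1 * ?N powr (3/4)) / ?N powr 2 = ?N powr (-1/4)"
        unfolding powr_add[symmetric] powr_diff[symmetric] by simp
      also have "(C1 + C2) * (\<bar>n \<bullet> z\<bar> * ?N powr (-9/4)) + C3 * ?N powr (-1/4)
        \<le> (C1 + C2 + C3) * (\<bar>n \<bullet> z\<bar> * ?N powr (-9/4)) + (C1 + C2 + C3) * ?N powr (-1/4)"
        using C1(1) C2(1) C3(1) by (intro add_mono[OF mult_right_mono mult_right_mono]) auto
      finally show "norm (dbessel z n) \<le> (C1 + C2 + C3) * (\<bar>n \<bullet> z\<bar> * ?N powr (-9/4) + ?N powr (-1/4))"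
        by (simp add: algebra_simps)
    qed
  qed
  then show ?thesis using C1 C2 C3 by (intro exI[of _ "C1 + C2 + C3"]) auto
qed

end

section \<open>The Green's functions\<close>

lemma cis_eq_1_iff: "cis t = 1 \<longleftrightarrow> (\<exists>n::int. t = 2 * pi * of_int n)"
proof
  assume "cis t = 1"
  then have "cos t = 1" by (simp add: complex_eq_iff)
  then show "\<exists>n::int. t = 2 * pi * of_int n" unfolding cos_one_2pi_int by (auto simp: mult_ac)
next
  assume "\<exists>n::int. t = 2 * pi * of_int n"
  then show "cis t = 1" by (auto intro: cis_multiple_2pi)
qed

lemma cube_root_orthogonality:
  fixes u :: int
  shows "1 + cis (2 * pi / 3 * u) + cis (- (2 * pi / 3 * u)) = (if 3 dvd u then 3 else 0)"
proof -
  define w where "w = u div 3"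
  define r where "r = u mod 3"
  have u: "u = 3 * w + r" by (simp add: w_def r_def)
  have "2 * pi / 3 * real_of_int u = 2 * pi * of_int w + 2 * pi / 3 * of_int r"
    unfolding u by (simp add: field_simps)
  then have "cis (2 * pi / 3 * u) = cis (2 * pi * of_int w) * cis (2 * pi / 3 * of_int r)"
    by (simp only: cis_mult)
  also have "cis (2 * pi * of_int w) = 1" by (auto intro: cis_multiple_2pi)
  finally have 1: "cis (2 * pi / 3 * u) = cis (2 * pi / 3 * r)" by simp
  have 2: "cis (- (2 * pi / 3 * u)) = cnj (cis (2 * pi / 3 * r))" unfolding 1[symmetric] by (simp add: cis_cnj)
  have "r = 0 \<or> r = 1 \<or> r = 2" unfolding r_def by auto
  moreover have "cos (2 * pi / 3) = - (1/2 :: real)" by (simp add: cos_120)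
  moreover have "cos (4 * pi / 3) = - (1/2 :: real)"
  proof -
    have "4 * pi / 3 = pi + pi / 3" by simp
    then show ?thesis by (simp only: cos_add) (simp add: cos_60)
  qed
  moreover have "3 dvd u \<longleftrightarrow> r = 0" by (auto simp: r_def)
  ultimately show ?thesis unfolding 1 2 by (auto simp: complex_eq_iff)
qed

context dual_lattice
begin

definition hcoef :: "complex \<Rightarrow> int \<times> int \<Rightarrow> complex" where
  "hcoef \<omega> i = 1 / (\<omega>\<^sup>2 - of_real ((norm (xi i))\<^sup>2))"

definition hrem :: "complex \<Rightarrow> int \<times> int \<Rightarrow> complex" where "hrem \<omega> i = hcoef \<omega> i + bcoef i"

text \<open>Over the common denominator the numerator is the constant \<open>1 + \<omega>^2\<close>,
  while both factors of the denominator grow like \<open>wt i\<close>.\<close>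

lemma decays_hrem: "decays 2 (hrem \<omega>)"
proof (rule decays_finite)
  \<comment> \<open>Outside \<open>F\<close> the denominator \<open>\<omega>^2 - |xi i|^2\<close>
    has modulus at least \<open>wt i / 2\<close>. Any index where it vanishes lies in
    \<open>F\<close>; there \<open>hcoef\<close> is 1/0 = 0.\<close>
  define F where "F = {i. wt i < 2 * (1 + (norm \<omega>)\<^sup>2)}"
  have "F \<subseteq> disc (2 * (1 + (norm \<omega>)\<^sup>2))"
  proof
    fix i assume "i \<in> F"
    moreover have "norm (xi i) \<le> wt i"
      using sum_squares_bound[of "norm (xi i)" 1] unfolding wt_def by (simp add: power2_eq_square) (smt (verit) mult_nonneg_nonneg norm_ge_zero)
    ultimately show "i \<in> disc (2 * (1 + (norm \<omega>)\<^sup>2))" by (simp add: F_def disc_def)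
  qed
  then show "finite F" by (rule finite_subset[OF _ finite_disc])
  fix i assume "i \<notin> F"
  then have N: "2 * (1 + (norm \<omega>)\<^sup>2) \<le> wt i" by (simp add: F_def)
  define y where "y = \<omega>\<^sup>2 - of_real ((norm (xi i))\<^sup>2)"
  have "norm (of_real ((norm (xi i))\<^sup>2) :: complex) \<le> norm y + norm (\<omega>\<^sup>2)"
    using norm_triangle_ineq4[of "\<omega>\<^sup>2" y] unfolding y_def by (simp add: norm_minus_commute)
  then have "(norm (xi i))\<^sup>2 \<le> norm y + (norm \<omega>)\<^sup>2" by (simp add: norm_power)
  then have "wt i \<le> norm y + (1 + (norm \<omega>)\<^sup>2)" by (simp add: wt_def)
  moreover have "a / 2 \<le> b" if "a \<le> b + (1 + c)" "2 * (1 + c) \<le> a" for a b c :: real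
    using that by (simp add: field_simps)
  ultimately have y: "wt i / 2 \<le> norm y" using N by blast
  then have y0: "y \<noteq> 0" using wt_pos[of i] by auto
  have "hrem \<omega> i = (y + of_real (wt i)) / (y * of_real (wt i))"
    unfolding hrem_def hcoef_def bcoef_def y_def[symmetric] using y0 wt_nonzero[of i] by (simp add: field_simps)
  also have "y + of_real (wt i) = 1 + \<omega>\<^sup>2" by (simp add: y_def wt_def)
  finally have "norm (hrem \<omega> i) = norm (1 + \<omega>\<^sup>2) / (norm y * wt i)"
    using wt_nonneg by (simp add: norm_divide norm_mult)
  also have "\<dots> \<le> norm (1 + \<omega>\<^sup>2) / (wt i / 2 * wt i)"
    using y wt_pos[of i] y0 by (intro divide_left_mono mult_right_mono mult_pos_pos) auto
  also have "\<dots> = 2 * norm (1 + \<omega>\<^sup>2) * wt i powr (-2)"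
  proof -
    have "wt i powr 2 = wt i * wt i" using wt_pos[of i] by (simp add: power2_eq_square)
    then show ?thesis unfolding powr_minus_divide by simp
  qed
  finally show "norm (hrem \<omega> i) \<le> 2 * norm (1 + \<omega>\<^sup>2) * wt i powr (-2)" .
qed

text \<open>The Green's function without its prefactor: a differentiable series with absolutely
  summable coefficients, and the singular part \<open>bessel\<close>, which does not depend on the
  frequency.\<close>

definition helm :: "complex \<Rightarrow> real^2 \<Rightarrow> complex" where "helm \<omega> z = series (hrem \<omega>) z - bessel z"

lemma psum_hcoef_tendsto:
  assumes "off_lattice z" shows "((\<lambda>r. psum (hcoef \<omega>) r z) \<longlongrightarrow> helm \<omega> z) at_top"
proof -
  have "((\<lambda>r. psum (hrem \<omega>) r z - psum bcoef r z) \<longlongrightarrow> helm \<omega> z) at_top"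
    unfolding helm_def by (intro tendsto_diff psum_tendsto_series[OF decays_hrem] psum_bcoef_tendsto assms) simp
  moreover have "psum (hrem \<omega>) r z - psum bcoef r z = psum (hcoef \<omega>) r z" for r
    unfolding psum_def hrem_def by (simp add: sum_subtractf[symmetric] algebra_simps)
  ultimately show ?thesis by simp
qed

definition dhelm :: "complex \<Rightarrow> real^2 \<Rightarrow> real^2 \<Rightarrow> complex" where
  "dhelm \<omega> z h = series (grad h (hrem \<omega>)) z - dbessel z h"

lemma helm_has_derivative:
  assumes "off_lattice z" shows "(helm \<omega> has_derivative dhelm \<omega> z) (at z)"
proof -
  have "((\<lambda>z. series (hrem \<omega>) z - bessel z) has_derivative (\<lambda>h. series (grad h (hrem \<omega>)) z - dbessel z h)) (at z)"
    by (intro has_derivative_diff series_has_derivative[OF decays_hrem] bessel_has_derivative_dbessel[OF assms])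
  then show ?thesis unfolding helm_def[abs_def] dhelm_def[abs_def] .
qed

lemma isCont_helm: "off_lattice z \<Longrightarrow> isCont (helm \<omega>) z"
  using helm_has_derivative has_derivative_continuous by blast

text \<open>The formula for \<open>dbessel\<close> involves a direction \<open>d\<close> that may
  change with the point; a direction that works at \<open>z\<close> works in a
  neighbourhood.\<close>

lemma isCont_dhelm:
  assumes "off_lattice z" shows "isCont (\<lambda>z. dhelm \<omega> z h) z"
proof -
  from assms obtain d where d: "d \<in> dirs" "wdiff d z \<noteq> 0" by (auto simp: off_lattice_def)
  have "isCont (\<lambda>z. series (grad h (hrem \<omega>)) z - series (bdiff d (bdiff d (grad h bcoef))) z / (wdiff d z)\<^sup>2) z"
    using d(2) by (intro continuous_intros continuous_series[OF decays_grad[OF decays_hrem]] continuous_series[OF decays_bdiff_bdiff_grad_bcoef] isCont_wdiff) auto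
  moreover have "\<forall>\<^sub>F w in nhds z. series (grad h (hrem \<omega>)) w - series (bdiff d (bdiff d (grad h bcoef))) w / (wdiff d w)\<^sup>2 = dhelm \<omega> w h"
    using d dbessel_eq[OF d(1)] open_wdiff_nonzero[of d] unfolding eventually_nhds dhelm_def
    by (intro exI[of _ "{z. wdiff d z \<noteq> 0}"]) auto
  ultimately show ?thesis using isCont_cong by fastforce
qed

lemma norm_powr_ge_1: "\<forall>\<^sub>F z in at (0::real^2). 1 \<le> norm z powr (-1/4)"
proof -
  have "\<forall>\<^sub>F z in at (0::real^2). z \<noteq> 0 \<and> norm z < 1"
    unfolding eventually_at by (intro exI[of _ 1]) auto
  then show ?thesis
  proof (rule eventually_mono)
    fix z :: "real^2" assume "z \<noteq> 0 \<and> norm z < 1"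
    then have "norm z powr 0 \<le> norm z powr (-1/4)" by (intro powr_mono') auto
    then show "1 \<le> norm z powr (-1/4)" using \<open>z \<noteq> 0 \<and> norm z < 1\<close> by simp
  qed
qed

lemma helm_bound: "\<exists>C. \<forall>\<^sub>F z in at 0. norm (helm \<omega> z) \<le> C * norm z powr (-1/4)"
proof -
  obtain C where C: "\<forall>\<^sub>F z in at 0. norm (bessel z) \<le> C * norm z powr (-1/4)" using bessel_bound by blast
  obtain D where D: "0 \<le> D" "\<And>i. norm (hrem \<omega> i) \<le> D * wt i powr (-(9/8))"
  proof -
    have "decays (9/8) (hrem \<omega>)" by (rule decays_mono[OF decays_hrem]) simp
    from decays_bound[OF this] show ?thesis using that by blast
  qed
  define M where "M = D * (\<Sum>\<^sub>\<infinity>i. wt i powr (-9/8))"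
  have M: "norm (series (hrem \<omega>) z) \<le> M" for z unfolding M_def using D by (intro norm_series_le) auto
  then have "0 \<le> M" using norm_ge_zero order_trans by blast
  from C norm_powr_ge_1 have "\<forall>\<^sub>F z in at 0. norm (helm \<omega> z) \<le> (M + C) * norm z powr (-1/4)"
  proof eventually_elim
    case (elim z)
    have "norm (helm \<omega> z) \<le> M + norm (bessel z)"
      unfolding helm_def by (rule order_trans[OF norm_triangle_ineq4]) (simp add: M)
    also have "\<dots> \<le> M * norm z powr (-1/4) + C * norm z powr (-1/4)"
      using elim mult_left_mono[OF elim(2) \<open>0 \<le> M\<close>] by simp
    finally show ?case by (simp add: algebra_simps)
  qed
  then show ?thesis by blast
qed

lemma dhelm_normal_bound:
  "\<exists>C\<ge>0. \<forall>\<^sub>F z in at 0. \<forall>n. norm n = 1 \<longrightarrow>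
    norm (dhelm \<omega> z n) \<le> C * (\<bar>n \<bullet> z\<bar> * norm z powr (-9/4) + norm z powr (-1/4))"
proof -
  obtain C where C: "0 \<le> C" "\<forall>\<^sub>F z in at 0. \<forall>n. norm n = 1 \<longrightarrow>
    norm (dbessel z n) \<le> C * (\<bar>n \<bullet> z\<bar> * norm z powr (-9/4) + norm z powr (-1/4))" using dbessel_normal_bound by blast
  obtain D where D: "0 \<le> D" "\<And>i. norm (hrem \<omega> i) \<le> D * wt i powr (-2)"
    using decays_bound[OF decays_hrem[of \<omega>]] by blast
  define M where "M = D * (\<Sum>\<^sub>\<infinity>i. wt i powr (-9/8))"
  have M: "norm (series (grad n (hrem \<omega>)) z) \<le> M" if n: "norm n = 1" for z n
    unfolding M_def
  proof (rule norm_series_le)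
    fix i
    have "\<bar>xi i \<bullet> n\<bar> \<le> wt i powr (1/2)"
      using Cauchy_Schwarz_ineq2[of "xi i" n] norm_xi_le[of i] n by simp
    also have "\<dots> \<le> wt i powr (7/8)" by (intro powr_mono wt_ge_1) auto
    finally have "norm (grad n (hrem \<omega>) i) \<le> wt i powr (7/8) * (D * wt i powr (-2))"
      unfolding grad_def norm_mult by (intro mult_mono D) auto
    also have "\<dots> = D * (wt i powr (7/8) * wt i powr (-2))" by simp
    also have "wt i powr (7/8) * wt i powr (-2) = wt i powr (-9/8)" unfolding powr_add[symmetric] by simp
    finally show "norm (grad n (hrem \<omega>) i) \<le> D * wt i powr (-9/8)" .
  qed
  have "norm (axis 1 1 :: real^2) = 1" by simp
  from M[OF this] have "0 \<le> M" using norm_ge_zero order_trans by blast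
  from C(2) norm_powr_ge_1 have "\<forall>\<^sub>F z in at 0. \<forall>n. norm n = 1 \<longrightarrow>
    norm (dhelm \<omega> z n) \<le> (M + C) * (\<bar>n \<bullet> z\<bar> * norm z powr (-9/4) + norm z powr (-1/4))"
  proof eventually_elim
    case (elim z)
    show ?case
    proof (intro allI impI)
      fix n :: "real^2" assume n: "norm n = 1"
      have "norm (dhelm \<omega> z n) \<le> M + norm (dbessel z n)"
        unfolding dhelm_def by (rule order_trans[OF norm_triangle_ineq4]) (simp add: M n)
      also have "\<dots> \<le> M * (\<bar>n \<bullet> z\<bar> * norm z powr (-9/4) + norm z powr (-1/4)) + C * (\<bar>n \<bullet> z\<bar> * norm z powr (-9/4) + norm z powr (-1/4))"
      proof (rule add_mono)
        have "1 \<le> \<bar>n \<bullet> z\<bar> * norm z powr (-9/4) + norm z powr (-1/4)"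
          using elim(2) by (simp add: add_increasing)
        then show "M \<le> M * (\<bar>n \<bullet> z\<bar> * norm z powr (-9/4) + norm z powr (-1/4))"
          using mult_left_mono[OF _ \<open>0 \<le> M\<close>] by fastforce
      qed (use elim n in auto)
      finally show "norm (dhelm \<omega> z n) \<le> (M + C) * (\<bar>n \<bullet> z\<bar> * norm z powr (-9/4) + norm z powr (-1/4))"
        by (simp add: distrib_right)
    qed
  qed
  then show ?thesis using \<open>0 \<le> M\<close> C(1) by (intro exI[of _ "M + C"]) auto
qed

text \<open>All \<open>wdiff d z\<close> vanish precisely when \<open>k1 \<bullet> z\<close> and
  \<open>k2 \<bullet> z\<close> are integer multiples of \<open>2 * pi\<close>, and by
  \<open>dual_expand\<close> these integers are the coordinates of \<open>z\<close>.\<close>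

lemma off_lattice_iff: "off_lattice z \<longleftrightarrow> z \<notin> lattice a1 a2"
proof
  assume "off_lattice z"
  then obtain d where d: "d \<in> dirs" "cis (dvec d \<bullet> z) \<noteq> 1" by (auto simp: off_lattice_def wdiff_def)
  show "z \<notin> lattice a1 a2"
  proof
    assume "z \<in> lattice a1 a2"
    then obtain m n :: int where "z = of_int m *\<^sub>R a1 + of_int n *\<^sub>R a2" by (auto simp: lattice_def)
    then have "k1 \<bullet> z = 2 * pi * of_int m" "k2 \<bullet> z = 2 * pi * of_int n"
      by (simp_all add: inner_add_right dual)
    then show False using d by (auto simp: dirs_def cis_eq_1_iff)
  qed
next
  assume z: "z \<notin> lattice a1 a2"
  show "off_lattice z"
  proof (rule ccontr)
    assume "\<not> off_lattice z"
    then obtain m n :: int where mn: "k1 \<bullet> z = 2 * pi * of_int m" "k2 \<bullet> z = 2 * pi * of_int n"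
      by (auto simp: off_lattice_def wdiff_def dirs_def cis_eq_1_iff)
    have "(2 * pi) *\<^sub>R z = (2 * pi) *\<^sub>R (of_int m *\<^sub>R a1 + of_int n *\<^sub>R a2)"
      unfolding dual_expand[of z] mn by (simp add: scaleR_add_right)
    then have "z = of_int m *\<^sub>R a1 + of_int n *\<^sub>R a2" by simp
    with z show False by (auto simp: lattice_def)
  qed
qed

lemma open_off_lattice: "open {z. off_lattice z}"
proof -
  have "{z. off_lattice z} = (\<Union>d\<in>dirs. {z. wdiff d z \<noteq> 0})" by (auto simp: off_lattice_def)
  then show ?thesis using open_wdiff_nonzero by auto
qed

lemma lattice_dvec: "lattice k1 k2 = range dvec"
proof (intro set_eqI iffI)
  fix q assume "q \<in> lattice k1 k2"
  then obtain m n :: int where "q = dvec (m, n)" by (auto simp: lattice_def dvec_def)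
  then show "q \<in> range dvec" by blast
qed (auto simp: lattice_def dvec_def)

lemma inj_dvec: "inj dvec"
proof (rule injI)
  fix i j assume "dvec i = dvec j"
  then show "i = j" using coord_dvec[of i] coord_dvec[of j] by (simp add: prod_eq_iff)
qed

section \<open>The finer lattice and the two Green's functions\<close>

definition t1 :: "real^2" where "t1 = (1/3) *\<^sub>R (2 *\<^sub>R a1 + a2)"

definition t2 :: "real^2" where "t2 = (1/3) *\<^sub>R (a1 + 2 *\<^sub>R a2)"

text \<open>The displacement from inclusion \<open>b\<close> to inclusion \<open>b + 2 * s\<close>.
  For each \<open>b\<close> the three values represent the classes of the lattice of
  \<open>t1\<close>, \<open>t2\<close> modulo its sublattice of index three spanned by
  \<open>a1\<close>, \<open>a2\<close>.\<close>

definition shift :: "nat \<Rightarrow> nat \<Rightarrow> real^2" where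
  "shift b s = (if s = 0 then 0 else if b = 1 then (if s = 1 then t1 else t1 - t2)
     else (if s = 1 then t1 - t2 else - t2))"

definition sublat :: "(int \<times> int) set" where "sublat = {i. 3 dvd (fst i - snd i)}"

text \<open>The exponent of the cube root of unity by which a dual vector with
  \<open>fst i - snd i = 1\<close> acts on \<open>shift b s\<close>; modulo 3 it identifies the
  class of the displacement.\<close>

definition phase :: "nat \<Rightarrow> nat \<Rightarrow> int" where
  "phase b s = (if s = 0 then 0 else if (b = 1) = (s = 1) then -1 else 1)"

lemma cis_dvec_shift:
  assumes "s < 3"
  shows "cis (dvec i \<bullet> shift b s) = cis (2 * pi / 3 * of_int ((fst i - snd i) * phase b s))"
proof -
  define u where "u = fst i - snd i"
  have t: "dvec i \<bullet> t1 = - (2 * pi / 3 * u) + 2 * pi * of_int (fst i)"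
    "dvec i \<bullet> t2 = (2 * pi / 3 * u) + 2 * pi * of_int (snd i)"
    unfolding t1_def t2_def by (simp_all add: inner_add_right coord_dvec u_def field_simps)
  have "dvec i \<bullet> (t1 - t2) = 2 * pi / 3 * u"
    unfolding inner_diff_right t by (simp add: u_def field_simps)
  then have d: "cis (dvec i \<bullet> (t1 - t2)) = cis (2 * pi / 3 * u)"
    by (rule arg_cong)
  have c1: "cis (dvec i \<bullet> t1) = cis (- (2 * pi / 3 * u))"
    unfolding t cis_mult[symmetric] by (subst cis_multiple_2pi) auto
  have "dvec i \<bullet> (- t2) = - (2 * pi / 3 * u) + 2 * pi * of_int (- snd i)"
    unfolding inner_minus_right t by simp
  then have c2: "cis (dvec i \<bullet> (- t2)) = cis (- (2 * pi / 3 * u))"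
    by (simp only: cis_mult[symmetric]) (subst cis_multiple_2pi, auto)
  have "s = 0 \<or> s = 1 \<or> s = 2" using assms by auto
  then show ?thesis
    unfolding u_def[symmetric]
    by (cases "b = 1"; elim disjE; use d c1 c2 in \<open>simp add: shift_def phase_def\<close>)
qed

text \<open>For either value of \<open>b\<close> the three phases are 0, 1, -1 in some order, so the
  sum runs over all three characters of a group of order three.\<close>

lemma sum_cis_shift:
  "(\<Sum>s<3. cis (dvec i \<bullet> shift b s)) = (if i \<in> sublat then 3 else 0)"
proof -
  define u where "u = fst i - snd i"
  have "(\<Sum>s<3. cis (dvec i \<bullet> shift b s)) = (\<Sum>s<3. cis (2 * pi / 3 * of_int (u * phase b s)))"
    unfolding u_def by (intro sum.cong refl cis_dvec_shift) simp
  also have "\<dots> = 1 + cis (2 * pi / 3 * u) + cis (- (2 * pi / 3 * u))"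
    by (cases "b = 1") (simp_all add: eval_nat_numeral phase_def)
  finally show ?thesis unfolding cube_root_orthogonality by (simp add: sublat_def u_def)
qed

lemma lattice_sublat: "lattice (2 *\<^sub>R k1 - k2) (2 *\<^sub>R k2 - k1) = dvec ` sublat"
proof (intro set_eqI iffI)
  fix q assume "q \<in> lattice (2 *\<^sub>R k1 - k2) (2 *\<^sub>R k2 - k1)"
  then obtain m n :: int where "q = of_int m *\<^sub>R (2 *\<^sub>R k1 - k2) + of_int n *\<^sub>R (2 *\<^sub>R k2 - k1)"
    by (auto simp: lattice_def)
  then have "q = dvec (2 * m - n, 2 * n - m)" by (simp add: dvec_def algebra_simps)
  moreover have "(2 * m - n, 2 * n - m) \<in> sublat" by (simp add: sublat_def)
  ultimately show "q \<in> dvec ` sublat" by blast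
next
  fix q assume "q \<in> dvec ` sublat"
  then obtain m n :: int where q: "q = dvec (m, n)" "3 dvd (m - n)" by (auto simp: sublat_def)
  then obtain c where c: "m = n + 3 * c" by (metis dvdE add.commute diff_add_cancel)
  have "q = of_int (n + 2 * c) *\<^sub>R (2 *\<^sub>R k1 - k2) + of_int (n + c) *\<^sub>R (2 *\<^sub>R k2 - k1)"
    unfolding q c by (simp add: dvec_def vec_eq_iff forall_2 algebra_simps)
  then show "q \<in> lattice (2 *\<^sub>R k1 - k2) (2 *\<^sub>R k2 - k1)" unfolding lattice_def by blast
qed

text \<open>The term left out for \<open>\<alpha> = 0\<close>, \<open>\<omega> = 0\<close> would be \<open>1/0 = 0\<close>, so it may be included.\<close>

lemma green_sum:
  assumes "\<And>i. i \<in> I \<Longrightarrow> dvec i = dvec j + f i" "inj_on f I" "L = f ` I"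
  shows "(\<Sum>q \<in> {q \<in> L. norm (dvec j + e + q) \<le> r \<and> (dvec j + e = 0 \<and> \<omega> = 0 \<longrightarrow> q \<noteq> 0)}.
      cis ((dvec j + e + q) \<bullet> z) / (\<omega>\<^sup>2 - of_real ((norm (dvec j + e + q))\<^sup>2)))
    = (\<Sum>i\<in>disc r \<inter> I. hcoef \<omega> i * wave i z)"
proof -
  have x: "dvec j + e + f i = xi i" if "i \<in> I" for i using assms(1)[OF that] by (simp add: xi_def)
  have "(\<Sum>i\<in>disc r \<inter> I. hcoef \<omega> i * wave i z)
    = (\<Sum>i\<in>{i \<in> I. norm (xi i) \<le> r \<and> (dvec j + e = 0 \<and> \<omega> = 0 \<longrightarrow> f i \<noteq> 0)}. hcoef \<omega> i * wave i z)"
  proof (rule sum.mono_neutral_right)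
    show "\<forall>i\<in>disc r \<inter> I - {i \<in> I. norm (xi i) \<le> r \<and> (dvec j + e = 0 \<and> \<omega> = 0 \<longrightarrow> f i \<noteq> 0)}. hcoef \<omega> i * wave i z = 0"
    proof
      fix i assume i: "i \<in> disc r \<inter> I - {i \<in> I. norm (xi i) \<le> r \<and> (dvec j + e = 0 \<and> \<omega> = 0 \<longrightarrow> f i \<noteq> 0)}"
      then have "xi i = 0" "\<omega> = 0" using x[of i] by (auto simp: disc_def)
      then show "hcoef \<omega> i * wave i z = 0" by (simp add: hcoef_def)
    qed
    show "finite (disc r \<inter> I)" using finite_disc by blast
  qed (auto simp: disc_def)
  also have "\<dots> = (\<Sum>q\<in>f ` {i \<in> I. norm (xi i) \<le> r \<and> (dvec j + e = 0 \<and> \<omega> = 0 \<longrightarrow> f i \<noteq> 0)}.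
      cis ((dvec j + e + q) \<bullet> z) / (\<omega>\<^sup>2 - of_real ((norm (dvec j + e + q))\<^sup>2)))"
    using x by (subst sum.reindex) (auto intro!: inj_on_subset[OF assms(2)] sum.cong simp: hcoef_def wave_def)
  also have "f ` {i \<in> I. norm (xi i) \<le> r \<and> (dvec j + e = 0 \<and> \<omega> = 0 \<longrightarrow> f i \<noteq> 0)}
    = {q \<in> L. norm (dvec j + e + q) \<le> r \<and> (dvec j + e = 0 \<and> \<omega> = 0 \<longrightarrow> q \<noteq> 0)}"
    using x unfolding assms(3) by (auto simp: image_iff)
  finally show ?thesis by simp
qed

lemma green_eq:
  assumes "off_lattice z" shows "green c (lattice k1 k2) e \<omega> z = of_real c * helm \<omega> z"
proof -
  have k0: "dvec (0, 0) = 0" by (simp add: dvec_def)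
  have "((\<lambda>r. of_real c * psum (hcoef \<omega>) r z) \<longlongrightarrow> of_real c * helm \<omega> z) at_top"
    by (intro tendsto_intros psum_hcoef_tendsto assms)
  moreover have "(\<Sum>q \<in> {q \<in> lattice k1 k2. norm (e + q) \<le> r \<and> (e = 0 \<and> \<omega> = 0 \<longrightarrow> q \<noteq> 0)}.
      cis ((e + q) \<bullet> z) / (\<omega>\<^sup>2 - of_real ((norm (e + q))\<^sup>2))) = psum (hcoef \<omega>) r z" for r
    using green_sum[where I = UNIV and j = "(0, 0)" and f = dvec and L = "lattice k1 k2" and r = r and \<omega> = \<omega> and z = z] inj_dvec
    by (simp add: k0 lattice_dvec psum_def)
  ultimately show ?thesis
    unfolding green_def using tendsto_Lim[OF trivial_limit_at_top_linorder] by fastforce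
qed

text \<open>The vector \<open>alpha + q\<close> of the reduced series is again some
  \<open>xi i\<close>, so both series are cut off by the same disc, and the sum over
  \<open>s\<close> selects the indices in the class of \<open>j\<close>. The identity thus holds for
  finite sums before the limit is taken. The choice of \<open>b\<close> is free, which allows
  matching it to the boundary piece.\<close>

lemma green_red_eq:
  assumes "\<And>s. s < 3 \<Longrightarrow> off_lattice (z - shift b s)"
  shows "green (3 * c) (lattice (2 *\<^sub>R k1 - k2) (2 *\<^sub>R k2 - k1)) (dvec j + e) \<omega> z
    = (\<Sum>s<3. cis ((dvec j + e) \<bullet> shift b s) * (of_real c * helm \<omega> (z - shift b s)))"
proof -
  define I where "I = {i. i - j \<in> sublat}"
  have "((\<lambda>r. \<Sum>s<3. cis ((dvec j + e) \<bullet> shift b s) * (of_real c * psum (hcoef \<omega>) r (z - shift b s)))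
     \<longlongrightarrow> (\<Sum>s<3. cis ((dvec j + e) \<bullet> shift b s) * (of_real c * helm \<omega> (z - shift b s)))) at_top"
    by (intro tendsto_intros psum_hcoef_tendsto assms) auto
  moreover have "(\<Sum>s<3. cis ((dvec j + e) \<bullet> shift b s) * (of_real c * psum (hcoef \<omega>) r (z - shift b s)))
    = of_real (3 * c) * (\<Sum>q \<in> {q \<in> lattice (2 *\<^sub>R k1 - k2) (2 *\<^sub>R k2 - k1). norm (dvec j + e + q) \<le> r \<and> (dvec j + e = 0 \<and> \<omega> = 0 \<longrightarrow> q \<noteq> 0)}.
      cis ((dvec j + e + q) \<bullet> z) / (\<omega>\<^sup>2 - of_real ((norm (dvec j + e + q))\<^sup>2)))" for r
  proof -
    have L: "lattice (2 *\<^sub>R k1 - k2) (2 *\<^sub>R k2 - k1) = (\<lambda>i. dvec (i - j)) ` I"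
      unfolding lattice_sublat
    proof (intro set_eqI iffI)
      fix q assume "q \<in> dvec ` sublat"
      then obtain i where "i \<in> sublat" "q = dvec i" by blast
      then have "i + j \<in> I" "q = dvec ((i + j) - j)" by (auto simp: I_def)
      then show "q \<in> (\<lambda>i. dvec (i - j)) ` I" by blast
    qed (auto simp: I_def)
    have "(\<Sum>s<3. cis ((dvec j + e) \<bullet> shift b s) * (of_real c * psum (hcoef \<omega>) r (z - shift b s)))
      = (\<Sum>s<3. \<Sum>i\<in>disc r. of_real c * hcoef \<omega> i * wave i z * cis (dvec (j - i) \<bullet> shift b s))"
      unfolding psum_def sum_distrib_left
      by (intro sum.cong refl)
        (simp add: wave_def xi_def dvec_diff inner_diff_right inner_diff_left inner_add_left cis_mult algebra_simps)
    also have "\<dots> = (\<Sum>i\<in>disc r. of_real c * hcoef \<omega> i * wave i z * (\<Sum>s<3. cis (dvec (j - i) \<bullet> shift b s)))"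
      by (subst sum.swap) (simp add: sum_distrib_left)
    also have "\<dots> = (\<Sum>i\<in>disc r. if i \<in> I then 3 * of_real c * hcoef \<omega> i * wave i z else 0)"
    proof (rule sum.cong)
      fix i
      have "j - i \<in> sublat \<longleftrightarrow> i \<in> I" by (simp add: sublat_def I_def) presburger
      then show "of_real c * hcoef \<omega> i * wave i z * (\<Sum>s<3. cis (dvec (j - i) \<bullet> shift b s))
        = (if i \<in> I then 3 * of_real c * hcoef \<omega> i * wave i z else 0)" by (simp add: sum_cis_shift)
    qed simp
    also have "\<dots> = of_real (3 * c) * (\<Sum>i\<in>disc r \<inter> I. hcoef \<omega> i * wave i z)"
      by (simp add: sum.inter_restrict[OF finite_disc] sum_distrib_left mult.assoc if_distrib cong: if_cong)
    also have "(\<Sum>i\<in>disc r \<inter> I. hcoef \<omega> i * wave i z) = (\<Sum>q \<in> {q \<in> lattice (2 *\<^sub>R k1 - k2) (2 *\<^sub>R k2 - k1). norm (dvec j + e + q) \<le> r \<and> (dvec j + e = 0 \<and> \<omega> = 0 \<longrightarrow> q \<noteq> 0)}.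
      cis ((dvec j + e + q) \<bullet> z) / (\<omega>\<^sup>2 - of_real ((norm (dvec j + e + q))\<^sup>2)))"
      by (rule green_sum[OF _ _ L, symmetric])
        (auto simp: dvec_diff inj_on_def dest: injD[OF inj_dvec])
    finally show ?thesis .
  qed
  ultimately show ?thesis
    unfolding green_def using tendsto_Lim[OF trivial_limit_at_top_linorder] by fastforce
qed

lemma green_has_derivative:
  assumes "off_lattice z"
  shows "(green c (lattice k1 k2) e \<omega> has_derivative (\<lambda>h. of_real c * dhelm \<omega> z h)) (at z)"
  by (rule has_derivative_transform_within_open[OF
      has_derivative_mult_right[OF helm_has_derivative[OF assms], of "of_real c"] open_off_lattice])
    (use assms green_eq in auto)

lemma frechet_green:
  assumes "off_lattice z"
  shows "frechet_derivative (green c (lattice k1 k2) e \<omega>) (at z) h = of_real c * dhelm \<omega> z h"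
  using frechet_derivative_at[OF green_has_derivative[OF assms]] by metis

text \<open>The three-term formula holds on an open set around \<open>z\<close>, hence may be
  differentiated.\<close>

lemma frechet_green_red:
  assumes "\<And>s. s < 3 \<Longrightarrow> off_lattice (z - shift b s)"
  shows "frechet_derivative (green (3 * c) (lattice (2 *\<^sub>R k1 - k2) (2 *\<^sub>R k2 - k1)) (dvec j + e) \<omega>) (at z) h
    = (\<Sum>s<3. cis ((dvec j + e) \<bullet> shift b s) * (of_real c * dhelm \<omega> (z - shift b s) h))"
proof -
  define U where "U = {w. \<forall>s<3. off_lattice (w - shift b s)}"
  have "U = (\<Inter>s\<in>{..<3}. (\<lambda>w. w - shift b s) -` {z. off_lattice z})" by (auto simp: U_def)
  moreover have "open ((\<lambda>w. w - shift b s) -` {z. off_lattice z})" for s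
    by (intro open_vimage open_off_lattice continuous_intros)
  ultimately have U: "open U" by auto
  have "((\<lambda>z. \<Sum>s<3. cis ((dvec j + e) \<bullet> shift b s) * (of_real c * helm \<omega> (z - shift b s)))
     has_derivative (\<lambda>h. \<Sum>s<3. cis ((dvec j + e) \<bullet> shift b s) * (of_real c * dhelm \<omega> (z - shift b s) h))) (at z)"
  proof (intro has_derivative_sum has_derivative_mult_right)
    fix s :: nat assume s: "s \<in> {..<3}"
    have "((\<lambda>z. z - shift b s) has_derivative (\<lambda>h. h)) (at z)" by (auto intro!: derivative_eq_intros)
    then show "((\<lambda>z. helm \<omega> (z - shift b s)) has_derivative dhelm \<omega> (z - shift b s)) (at z)"
      by (rule has_derivative_compose) (use s assms in \<open>auto intro: helm_has_derivative\<close>)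
  qed
  then have "(green (3 * c) (lattice (2 *\<^sub>R k1 - k2) (2 *\<^sub>R k2 - k1)) (dvec j + e) \<omega>
     has_derivative (\<lambda>h. \<Sum>s<3. cis ((dvec j + e) \<bullet> shift b s) * (of_real c * dhelm \<omega> (z - shift b s) h))) (at z)"
    by (rule has_derivative_transform_within_open[OF _ U]) (use assms in \<open>auto simp: U_def green_red_eq[symmetric]\<close>)
  then show ?thesis by (subst frechet_derivative_at[symmetric], assumption) (rule refl)
qed

end

section \<open>Length of arcs and singular kernels\<close>

lemma outer_gauge_le:
  assumes "0 < \<delta>" "A \<subseteq> (\<Union>i. C i)"
  shows "outer_measure UNIV (diam_gauge \<delta>) A \<le> (\<Sum>i. diam_gauge \<delta> (C i))"
proof -
  interpret ring_of_sets UNIV "UNIV :: 'a set set" by (rule ring_UNIV)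
  show ?thesis
    by (rule outer_measure_le[OF diam_gauge_positive[OF assms(1)] diam_gauge_increasing]) (use assms in auto)
qed

lemma hausdorff1_leI:
  assumes "\<And>\<delta>. 0 < \<delta> \<Longrightarrow> \<exists>C. A \<subseteq> (\<Union>i::nat. C i) \<and> (\<Sum>i. diam_gauge \<delta> (C i)) \<le> B"
  shows "hausdorff1 A \<le> B"
  unfolding hausdorff1_def
proof (rule SUP_least)
  fix \<delta> :: real assume "\<delta> \<in> {0<..}"
  then have "0 < \<delta>" by simp
  then obtain C where C: "A \<subseteq> (\<Union>i::nat. C i)" "(\<Sum>i. diam_gauge \<delta> (C i)) \<le> B"
    using assms[OF \<open>0 < \<delta>\<close>] that by (elim exE conjE)
  show "outer_measure UNIV (diam_gauge \<delta>) A \<le> B"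
    by (rule order_trans[OF outer_gauge_le[OF \<open>0 < \<delta>\<close> C(1)] C(2)])
qed

lemma diam_gauge_translation: "diam_gauge \<delta> ((+) c ` U) = diam_gauge \<delta> U"
  for c :: "'a::real_normed_vector"
proof -
  have "bounded ((+) c ` U) \<longleftrightarrow> bounded U"
    using bounded_translation[of U c] bounded_translation[of "(+) c ` U" "- c"] by (auto simp: image_image)
  moreover have "diameter ((+) c ` U) = diameter U"
    unfolding diameter_def by (auto simp: image_image case_prod_beta' intro!: arg_cong[where f = Sup])
      (auto simp: image_iff intro!: bexI)
  ultimately show ?thesis by (simp add: diam_gauge_def)
qed

lemma hausdorff1_translation_le:
  fixes c :: "'a::real_normed_vector"
  shows "hausdorff1 ((+) c ` A) \<le> hausdorff1 A"
  unfolding hausdorff1_def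
proof (rule SUP_mono)
  fix \<delta> :: real assume \<delta>: "\<delta> \<in> {0<..}"
  have "outer_measure UNIV (diam_gauge \<delta>) ((+) c ` A) \<le> outer_measure UNIV (diam_gauge \<delta>) A"
    unfolding outer_measure_def[of _ _ A]
  proof (rule INF_greatest, clarify)
    fix C :: "nat \<Rightarrow> 'a set" assume "A \<subseteq> (\<Union>i. C i)"
    then have "(+) c ` A \<subseteq> (\<Union>i. (+) c ` C i)" by blast
    with \<delta> have "outer_measure UNIV (diam_gauge \<delta>) ((+) c ` A) \<le> (\<Sum>i. diam_gauge \<delta> ((+) c ` C i))"
      by (intro outer_gauge_le) auto
    then show "outer_measure UNIV (diam_gauge \<delta>) ((+) c ` A) \<le> (\<Sum>i. diam_gauge \<delta> (C i))"
      by (simp add: diam_gauge_translation)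
  qed
  with \<delta> show "\<exists>m\<in>{0<..}. outer_measure UNIV (diam_gauge \<delta>) ((+) c ` A) \<le> outer_measure UNIV (diam_gauge m) A"
    by blast
qed

lemma hausdorff1_translation:
  fixes c :: "'a::real_normed_vector"
  shows "hausdorff1 ((+) c ` A) = hausdorff1 A"
  using hausdorff1_translation_le[of c A] hausdorff1_translation_le[of "- c" "(+) c ` A"]
  by (simp add: image_image)

lemma distr_arclength_translation:
  fixes c :: "'a::real_normed_vector"
  shows "distr arclength borel ((+) c) = arclength"
proof (rule measure_eqI)
  fix A :: "'a set" assume "A \<in> sets (distr arclength borel ((+) c))"
  then have A: "A \<in> sets borel" by simp
  have m: "(+) c \<in> borel_measurable arclength"
    by (simp add: measurable_cong_sets[OF sets_arclength refl])
  have v: "(+) c -` A = (+) (- c) ` A"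
    by (auto simp: image_iff intro!: bexI[of _ "c + _"])
  have "(+) c -` A \<in> sets borel"
    using A measurable_sets[OF m A] by (simp add: sets_arclength)
  then have "emeasure arclength ((+) c -` A) = hausdorff1 ((+) (- c) ` A)"
    unfolding v by (rule emeasure_arclength)
  also have "\<dots> = emeasure arclength A"
    unfolding hausdorff1_translation using A by (rule emeasure_arclength[symmetric])
  finally show "emeasure (distr arclength borel ((+) c)) A = emeasure arclength A"
    using A by (simp add: emeasure_distr m)
qed (simp add: sets_arclength)

lemma set_integral_translation:
  fixes f :: "'a::real_normed_vector \<Rightarrow> 'b::{banach, second_countable_topology}"
  assumes "set_borel_measurable arclength ((+) c ` A) f"
  shows "(LINT y:((+) c ` A)|arclength. f y) = (LINT y:A|arclength. f (c + y))"
    and "set_integrable arclength ((+) c ` A) f \<Longrightarrow> set_integrable arclength A (\<lambda>y. f (c + y))"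
proof -
  have m: "(+) c \<in> borel_measurable arclength"
    by (simp add: measurable_cong_sets[OF sets_arclength refl])
  let ?F = "\<lambda>y. indicator ((+) c ` A) y *\<^sub>R f y"
  have F: "?F \<in> borel_measurable borel"
    using assms unfolding set_borel_measurable_def by (simp add: measurable_cong_sets[OF sets_arclength refl])
  have F': "?F (c + y) = indicator A y *\<^sub>R f (c + y)" for y
    by (auto simp: indicator_def)
  have "integral\<^sup>L (distr arclength borel ((+) c)) ?F = (LINT y|arclength. ?F (c + y))"
    by (rule integral_distr[OF m F])
  then show "(LINT y:((+) c ` A)|arclength. f y) = (LINT y:A|arclength. f (c + y))"
    unfolding set_lebesgue_integral_def distr_arclength_translation F' .
  assume "set_integrable arclength ((+) c ` A) f"
  then have "integrable (distr arclength borel ((+) c)) ?F"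
    unfolding set_integrable_def distr_arclength_translation .
  then have "integrable arclength (\<lambda>y. ?F (c + y))" by (simp add: integrable_distr_eq[OF m F])
  then show "set_integrable arclength A (\<lambda>y. f (c + y))" unfolding set_integrable_def F' .
qed

lemma set_borel_measurable_translation:
  fixes f :: "'a::real_normed_vector \<Rightarrow> 'b::{banach, second_countable_topology}"
  assumes "set_borel_measurable arclength ((+) c ` A) f"
  shows "set_borel_measurable arclength A (\<lambda>y. f (c + y))"
proof -
  have m: "(+) c \<in> measurable arclength arclength"
    by (simp add: measurable_cong_sets[OF sets_arclength sets_arclength])
  have "(\<lambda>y. indicator ((+) c ` A) (c + y) *\<^sub>R f (c + y)) \<in> borel_measurable arclength"
    using measurable_compose[OF m assms[unfolded set_borel_measurable_def]] .
  moreover have "indicator ((+) c ` A) (c + y) = (indicator A y :: real)" for y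
    by (auto simp: indicator_def)
  ultimately show ?thesis unfolding set_borel_measurable_def by simp
qed

lemma AE_arclength_translation:
  fixes c :: "'a::real_normed_vector"
  assumes "AE y in arclength. P y" shows "AE y in arclength. P (c + y)"
proof -
  have m: "(+) c \<in> borel_measurable arclength"
    by (simp add: measurable_cong_sets[OF sets_arclength refl])
  obtain N where N: "{y. \<not> P y} \<subseteq> N" "N \<in> sets borel" "emeasure arclength N = 0"
    using assms by (auto elim!: AE_E simp: sets_arclength)
  have "emeasure arclength ((+) c -` N) = emeasure (distr arclength borel ((+) c)) N"
    using N(2) by (simp add: emeasure_distr m)
  also have "\<dots> = 0" unfolding distr_arclength_translation by (rule N(3))
  finally have "(+) c -` N \<in> null_sets arclength"
    using measurable_sets[OF m N(2)] by (auto simp: null_sets_def)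
  then show ?thesis by (rule AE_I') (use N(1) in auto)
qed

lemma emeasure_arclength_singleton: "emeasure arclength {x} = 0"
proof -
  have "hausdorff1 {x} \<le> 0"
  proof (rule hausdorff1_leI)
    fix \<delta> :: real assume \<delta>: "0 < \<delta>"
    have "diam_gauge \<delta> (if i = 0 then {x} else {}) = 0" for i :: nat
      using \<delta> by (simp add: diam_gauge_def)
    then show "\<exists>C. {x} \<subseteq> (\<Union>i::nat. C i) \<and> (\<Sum>i. diam_gauge \<delta> (C i)) \<le> 0"
      by (intro exI[of _ "\<lambda>i. if i = 0 then {x} else {}"]) auto
  qed
  then show ?thesis by (simp add: emeasure_arclength)
qed

lemma countable_null_arclength: "countable N \<Longrightarrow> N \<in> null_sets arclength"
  for N :: "'a::metric_space set"
proof -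
  assume N: "countable N"
  have "(\<Union>x\<in>N. {x}) \<in> null_sets arclength"
    using N by (rule null_sets_UN') (auto simp: null_sets_def emeasure_arclength_singleton sets_arclength)
  then show ?thesis by simp
qed

text \<open>Cut the interval into \<open>n\<close> equal parts so short that their images have
  diameter at most \<open>\<delta>\<close>. The sum of the diameter bounds is the same for every
  \<open>n\<close>.\<close>

lemma hausdorff1_Lipschitz_image_le:
  fixes g :: "real \<Rightarrow> 'a::real_normed_vector"
  assumes L: "\<And>s t. s \<in> {a..b} \<Longrightarrow> t \<in> {a..b} \<Longrightarrow> norm (g s - g t) \<le> L * \<bar>s - t\<bar>"
    and ab: "a \<le> b" and L0: "0 \<le> L"
  shows "hausdorff1 (g ` {a..b}) \<le> ennreal (L * (b - a))"
proof (rule hausdorff1_leI)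
  fix \<delta> :: real assume \<delta>: "0 < \<delta>"
  obtain n :: nat where n: "L * (b - a) / \<delta> < real n" using reals_Archimedean2 by blast
  have "0 \<le> L * (b - a) / \<delta>" using ab L0 \<delta> by auto
  then have n0: "0 < n" using n by (cases n) auto
  define h where "h = (b - a) / n"
  have h: "0 \<le> h" "L * h \<le> \<delta>" "n * h = b - a"
    using ab \<delta> n n0 by (auto simp: h_def field_simps)
  define C where "C i = (if i < n then g ` {a + i * h..a + (real i + 1) * h} else {})" for i :: nat
  have sub: "{a + i * h..a + (real i + 1) * h} \<subseteq> {a..b}" if "i < n" for i :: nat
  proof -
    have "(real i + 1) * h \<le> n * h" using that h(1) by (intro mult_right_mono) auto
    then have "a + (real i + 1) * h \<le> b" using h(3) by linarith
    moreover have "a \<le> a + i * h" using h(1) by simp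
    ultimately show ?thesis unfolding atLeastatMost_subset_iff by blast
  qed
  have gauge: "diam_gauge \<delta> (C i) \<le> (if i < n then ennreal (L * h) else 0)" for i
  proof (cases "i < n")
    case True
    have d: "norm (u - v) \<le> L * h" if uv: "u \<in> C i" "v \<in> C i" for u v
    proof -
      obtain s t where st: "s \<in> {a + i * h..a + (real i + 1) * h}" "t \<in> {a + i * h..a + (real i + 1) * h}" "u = g s" "v = g t"
        using uv True by (auto simp: C_def)
      then have "norm (u - v) \<le> L * \<bar>s - t\<bar>" using sub[OF True] L by blast
      also have "\<dots> \<le> L * h" using st L0 by (intro mult_left_mono) (auto simp: algebra_simps)
      finally show ?thesis .
    qed
    have "bounded (C i)"
    proof (rule boundedI)
      fix u assume "u \<in> C i"
      moreover have "g (a + i * h) \<in> C i" using True h(1) by (auto simp: C_def algebra_simps)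
      ultimately have "norm (u - g (a + i * h)) \<le> L * h" by (rule d)
      then show "norm u \<le> L * h + norm (g (a + i * h))" using norm_triangle_sub[of u "g (a + i * h)"] by linarith
    qed
    moreover have "diameter (C i) \<le> L * h" using d L0 h(1) by (intro diameter_le) auto
    ultimately show ?thesis using True h(2) by (auto simp: diam_gauge_def intro: ennreal_leI)
  qed (use \<delta> in \<open>simp add: diam_gauge_def C_def\<close>)
  have "g ` {a..b} \<subseteq> (\<Union>i. C i)"
  proof clarify
    fix t assume t: "t \<in> {a..b}"
    show "g t \<in> (\<Union>i. C i)"
    proof (cases "h = 0")
      case True
      then have "a = b" using h(3) by simp
      then show ?thesis using t n0 True by (auto simp: C_def intro!: UN_I[of 0])
    next
      case False
      then have h0: "0 < h" using h(1) by simp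
      \<comment> \<open>The minimum matters at the right end point, where the floor would be
        \<open>n\<close> and point to an empty piece.\<close>
      define i where "i = min (nat \<lfloor>(t - a) / h\<rfloor>) (n - 1)"
      have i: "i < n" using n0 by (simp add: i_def)
      have "real i \<le> (t - a) / h"
        using t h0 by (simp add: i_def min_def) linarith
      then have lo: "a + i * h \<le> t" using h0 by (simp add: field_simps)
      have hi: "t \<le> a + (real i + 1) * h"
      proof (cases "nat \<lfloor>(t - a) / h\<rfloor> \<le> n - 1")
        case True
        then have "(t - a) / h \<le> real i + 1" unfolding i_def by (simp add: min_def) linarith
        then show ?thesis using h0 by (simp add: field_simps)
      next
        case False
        then have "i = n - 1" by (simp add: i_def)
        then have "(real i + 1) * h = b - a" using n0 h(3) by (simp add: of_nat_diff)
        then show ?thesis using t by simp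
      qed
      show ?thesis using lo hi i by (auto simp: C_def add.commute intro!: UN_I[of i])
    qed
  qed
  moreover have "(\<Sum>i. diam_gauge \<delta> (C i)) \<le> ennreal (L * (b - a))"
  proof -
    have "(\<Sum>i. diam_gauge \<delta> (C i)) \<le> (\<Sum>i. if i < n then ennreal (L * h) else 0)"
      by (intro suminf_le gauge summableI)
    also have "\<dots> = (\<Sum>i<n. if i < n then ennreal (L * h) else 0)"
      by (rule suminf_finite) auto
    also have "\<dots> = of_nat n * ennreal (L * h)" by simp
    also have "\<dots> = ennreal (n * (L * h))" using L0 h(1) by (simp add: ennreal_of_nat_eq_real_of_nat ennreal_mult)
    also have "n * (L * h) = L * (b - a)" using h(3) by (simp add: mult_ac)
    finally show ?thesis .
  qed
  ultimately show "\<exists>C. g ` {a..b} \<subseteq> (\<Union>i::nat. C i) \<and> (\<Sum>i. diam_gauge \<delta> (C i)) \<le> ennreal (L * (b - a))"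
    by blast
qed

section \<open>Arcs with chord-arc and Taylor bounds\<close>

definition tame_arc :: "(real \<Rightarrow> real^2) \<Rightarrow> bool" where
  "tame_arc g \<longleftrightarrow> (\<exists>L c M g'. 0 < c \<and> 0 \<le> L \<and> 0 \<le> M \<and> (\<forall>s\<in>{0..1}. \<forall>t\<in>{0..1}.
     c * \<bar>t - s\<bar> \<le> norm (g t - g s) \<and> norm (g t - g s) \<le> L * \<bar>t - s\<bar> \<and>
     norm (g t - g s - (t - s) *\<^sub>R g' s) \<le> M * \<bar>t - s\<bar>\<^sup>2))"

text \<open>The chord-arc constant needs two regimes. Near the diagonal the first derivative
  dominates its Taylor remainder; away from it injectivity and compactness give a positive minimal
  distance. The other two bounds come from maxima of the first two derivatives.\<close>

lemma smooth_arc_tame_arc: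
  assumes "smooth_arc g" shows "tame_arc g"
proof -
  obtain d where arc: "arc g" and d0: "d 0 = g"
    and d: "\<And>k t. t \<in> {0..1} \<Longrightarrow> (d k has_vector_derivative d (Suc k) t) (at t within {0..1})"
    and nz: "\<And>t. t \<in> {0..1} \<Longrightarrow> d 1 t \<noteq> (0::real^2)"
    using assms unfolding smooth_arc_def by blast
  have cont: "continuous_on {0..1} (d k)" for k
    using d has_vector_derivative_continuous continuous_on_eq_continuous_within by blast
  have bdd: "\<exists>B\<ge>0. \<forall>t\<in>{0..1}. norm (d k t) \<le> B" for k
  proof -
    have "bounded (d k ` {0..1})" using compact_continuous_image[OF cont] compact_imp_bounded by blast
    then show ?thesis by (auto simp: bounded_pos) (metis less_imp_le)
  qed
  have seg: "closed_segment s t \<subseteq> {0..1}" if "s \<in> {0..1}" "t \<in> {0..1}" for s t :: real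
    using that by (auto simp: closed_segment_eq_real_ivl split: if_splits)
  have Lip: "\<exists>B\<ge>0. \<forall>s\<in>{0..1}. \<forall>t\<in>{0..1}. norm (d k t - d k s) \<le> B * \<bar>t - s\<bar>" for k
  proof -
    obtain B where B: "0 \<le> B" "\<And>t. t \<in> {0..1} \<Longrightarrow> norm (d (Suc k) t) \<le> B" using bdd[of "Suc k"] by blast
    have "norm (d k t - d k s) \<le> B * \<bar>t - s\<bar>" if "s \<in> {0..1}" "t \<in> {0..1}" for s t
    proof -
      have "norm (d k t - d k s) \<le> B * norm (t - s)"
      proof (rule differentiable_bound[of "{0..1}"])
        fix u assume u: "u \<in> {0..1::real}"
        show "(d k has_derivative (\<lambda>h. h *\<^sub>R d (Suc k) u)) (at u within {0..1})"
          using d[OF u, of k] by (simp add: has_vector_derivative_def)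
        show "onorm (\<lambda>h. h *\<^sub>R d (Suc k) u) \<le> B"
          using B(2)[OF u] by (intro onorm_le) (simp add: mult.commute[of B] mult_left_mono)
      qed (use that in auto)
      then show ?thesis by simp
    qed
    with B(1) show ?thesis by blast
  qed
  obtain L where L: "0 \<le> L" "\<And>s t. s \<in> {0..1} \<Longrightarrow> t \<in> {0..1} \<Longrightarrow> norm (g t - g s) \<le> L * \<bar>t - s\<bar>"
    using Lip[of 0] unfolding d0 by blast
  obtain M where M: "0 \<le> M" "\<And>s t. s \<in> {0..1} \<Longrightarrow> t \<in> {0..1} \<Longrightarrow> norm (d 1 t - d 1 s) \<le> M * \<bar>t - s\<bar>"
    using Lip[of 1] by blast
  have taylor: "norm (g t - g s - (t - s) *\<^sub>R d 1 s) \<le> M * \<bar>t - s\<bar>\<^sup>2" if "s \<in> {0..1}" "t \<in> {0..1}" for s t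
  proof -
    have "norm (g t - g s - (t - s) *\<^sub>R d 1 s) \<le> norm (t - s) * (M * \<bar>t - s\<bar>)"
    proof (rule vector_differentiable_bound_linearization[where S = "closed_segment s t"])
      fix u assume u: "u \<in> closed_segment s t"
      then have u1: "u \<in> {0..1}" using seg that by blast
      show "(g has_vector_derivative d 1 u) (at u within closed_segment s t)"
        using d[OF u1, of 0] seg[OF that] unfolding d0
        by (auto intro: has_vector_derivative_within_subset)
      have "\<bar>u - s\<bar> \<le> \<bar>t - s\<bar>" using u by (auto simp: closed_segment_eq_real_ivl split: if_splits)
      then show "norm (d 1 u - d 1 s) \<le> M * \<bar>t - s\<bar>"
        using M(2)[OF that(1) u1] M(1) by (meson mult_left_mono order_trans)
    qed auto
    then show ?thesis by (simp add: power2_eq_square mult_ac)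
  qed
  have "continuous_on {0..1} (\<lambda>t. norm (d 1 t))" by (intro continuous_on_norm cont)
  then have "\<exists>t0\<in>{0..1}. \<forall>t\<in>{0..1}. norm (d 1 t0) \<le> norm (d 1 t)"
    by (intro continuous_attains_inf) auto
  then obtain t0 where t0: "t0 \<in> {0..1}" "\<And>t. t \<in> {0..1} \<Longrightarrow> norm (d 1 t0) \<le> norm (d 1 t)"
    by blast
  define m where "m = norm (d 1 t0)"
  have m: "0 < m" "\<And>t. t \<in> {0..1} \<Longrightarrow> m \<le> norm (d 1 t)" using nz[OF t0(1)] t0 by (auto simp: m_def)
  \<comment> \<open>On parameter distances up to \<open>\<eta>\<close> the Taylor remainder uses up
    at most half of the minimal speed \<open>m\<close>; the 1 in the denominator covers
    \<open>M = 0\<close>.\<close>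
  define \<eta> where "\<eta> = m / (2 * (M + 1))"
  have \<eta>: "0 < \<eta>" "M * \<eta> \<le> m / 2"
  proof -
    show "0 < \<eta>" using m M(1) by (simp add: \<eta>_def)
    have "M * \<eta> \<le> (M + 1) * \<eta>" using \<open>0 < \<eta>\<close> by (intro mult_right_mono) auto
    also have "\<dots> = m / 2" using M(1) by (simp add: \<eta>_def field_simps)
    finally show "M * \<eta> \<le> m / 2" .
  qed
  have near: "m / 2 * \<bar>t - s\<bar> \<le> norm (g t - g s)" if st: "s \<in> {0..1}" "t \<in> {0..1}" "\<bar>t - s\<bar> \<le> \<eta>" for s t
  proof -
    have "m * \<bar>t - s\<bar> \<le> norm ((t - s) *\<^sub>R d 1 s)" using mult_right_mono[OF m(2)[OF st(1)], of "\<bar>t - s\<bar>"] by (simp add: mult.commute)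
    also have "\<dots> \<le> norm (g t - g s) + norm (g t - g s - (t - s) *\<^sub>R d 1 s)"
      by (metis norm_minus_commute norm_triangle_sub)
    also have "norm (g t - g s - (t - s) *\<^sub>R d 1 s) \<le> M * \<bar>t - s\<bar>\<^sup>2" by (rule taylor[OF st(1,2)])
    also have "M * \<bar>t - s\<bar>\<^sup>2 = (M * \<bar>t - s\<bar>) * \<bar>t - s\<bar>" by (simp add: power2_eq_square)
    also have "\<dots> \<le> (m / 2) * \<bar>t - s\<bar>"
    proof (rule mult_right_mono)
      have "M * \<bar>t - s\<bar> \<le> M * \<eta>" using st(3) M(1) by (rule mult_left_mono)
      then show "M * \<bar>t - s\<bar> \<le> m / 2" using \<eta>(2) by simp
    qed simp
    finally show ?thesis by simp
  qed
  define K where "K = ({0..1} \<times> {0..1}) \<inter> {p :: real \<times> real. \<eta> \<le> \<bar>snd p - fst p\<bar>}"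
  have "closed {p :: real \<times> real. \<eta> \<le> \<bar>snd p - fst p\<bar>}"
    by (intro closed_Collect_le continuous_intros)
  then have K: "compact K" unfolding K_def by (intro compact_Int_closed compact_Times) auto
  have contK: "continuous_on K (\<lambda>p. norm (g (snd p) - g (fst p)))"
  proof (intro continuous_on_norm continuous_on_diff)
    have cg: "continuous_on {0..1} g" using cont[of 0] unfolding d0 .
    show "continuous_on K (\<lambda>p. g (snd p))" "continuous_on K (\<lambda>p. g (fst p))"
      by (rule continuous_on_compose2[OF cg], rule continuous_on_snd continuous_on_fst,
          rule continuous_on_id, force simp: K_def)+
  qed
  have inj: "g s \<noteq> g t" if "s \<in> {0..1}" "t \<in> {0..1}" "s \<noteq> t" for s t
    using arc that by (auto simp: arc_def inj_on_def)
  have "\<exists>\<mu>>0. \<forall>p\<in>K. \<mu> \<le> norm (g (snd p) - g (fst p))"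
  proof (cases "K = {}")
    case False
    then obtain p where p: "p \<in> K" "\<And>q. q \<in> K \<Longrightarrow> norm (g (snd p) - g (fst p)) \<le> norm (g (snd q) - g (fst q))"
      using continuous_attains_inf[OF K _ contK] by blast
    have "0 < norm (g (snd p) - g (fst p))"
      using p(1) inj[of "snd p" "fst p"] \<eta>(1) by (auto simp: K_def)
    with p(2) show ?thesis by blast
  qed (auto intro: exI[of _ 1])
  then obtain \<mu> where \<mu>: "0 < \<mu>" "\<And>p. p \<in> K \<Longrightarrow> \<mu> \<le> norm (g (snd p) - g (fst p))" by blast
  have lower: "min (m / 2) \<mu> * \<bar>t - s\<bar> \<le> norm (g t - g s)" if st: "s \<in> {0..1}" "t \<in> {0..1}" for s t
  proof (cases "\<bar>t - s\<bar> \<le> \<eta>")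
    case True
    have "min (m / 2) \<mu> * \<bar>t - s\<bar> \<le> m / 2 * \<bar>t - s\<bar>" by (intro mult_right_mono) auto
    then show ?thesis using near[OF st True] by linarith
  next
    case False
    then have "(s, t) \<in> K" using st by (auto simp: K_def)
    then have "\<mu> \<le> norm (g t - g s)" using \<mu>(2) by fastforce
    moreover have "min (m / 2) \<mu> * \<bar>t - s\<bar> \<le> \<mu> * 1" using st \<mu>(1) m(1) by (intro mult_mono) auto
    ultimately show ?thesis by simp
  qed
  have "0 < min (m / 2) \<mu>" using m(1) \<mu>(1) by simp
  then show ?thesis
    unfolding tame_arc_def using L M(1) taylor lower by blast
qed

text \<open>The upper half of Ahlfors regularity in dimension one. The centre \<open>x\<close> is
  not restricted to \<open>S\<close>, and the constant is uniform in \<open>x\<close> and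
  \<open>r\<close>.\<close>

definition upper_regular :: "(real^2) set \<Rightarrow> bool" where
  "upper_regular S \<longleftrightarrow> (\<exists>C\<ge>0. \<forall>x r. 0 < r \<longrightarrow> hausdorff1 (S \<inter> cball x r) \<le> ennreal (C * r))"

text \<open>Two points of the arc in a ball of radius \<open>r\<close> are at most
  \<open>2 * r\<close> apart, so by the chord-arc bound their parameters differ by at most
  \<open>2 * r / c\<close>. The arc inside the ball is the Lipschitz image of an interval of length
  at most \<open>4 * r / c\<close>.\<close>

lemma tame_arc_upper_regular:
  assumes "tame_arc g" shows "upper_regular (path_image g)"
proof -
  obtain L c where c: "0 < c" "0 \<le> L"
    and g: "\<And>s t. s \<in> {0..1} \<Longrightarrow> t \<in> {0..1} \<Longrightarrow> c * \<bar>t - s\<bar> \<le> norm (g t - g s)"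
      "\<And>s t. s \<in> {0..1} \<Longrightarrow> t \<in> {0..1} \<Longrightarrow> norm (g t - g s) \<le> L * \<bar>t - s\<bar>"
    using assms unfolding tame_arc_def by blast
  have "hausdorff1 (path_image g \<inter> cball x r) \<le> ennreal (L * (4 / c) * r)" if r: "0 < r" for x r
  proof (cases "path_image g \<inter> cball x r = {}")
    case True
    have "hausdorff1 ({} :: (real^2) set) = 0"
      using outer_measure_space_hausdorff1 by (auto simp: outer_measure_space_def positive_def)
    then show ?thesis using True by simp
  next
    case False
    then obtain y where "y \<in> path_image g" "y \<in> cball x r" by blast
    then obtain s where s: "s \<in> {0..1}" "norm (x - g s) \<le> r"
      unfolding path_image_def by (force simp: dist_norm)
    define a where "a = max 0 (s - 2 * r / c)"
    define b where "b = min 1 (s + 2 * r / c)"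
    have rc: "0 < 2 * r / c" using r c by simp
    have ab: "a \<le> b" "{a..b} \<subseteq> {0..1}" "b - a \<le> 4 / c * r"
      using s(1) rc by (auto simp: a_def b_def)
    have "path_image g \<inter> cball x r \<subseteq> g ` {a..b}"
    proof clarify
      fix y assume y: "y \<in> path_image g" "y \<in> cball x r"
      then obtain t where t: "t \<in> {0..1}" "y = g t" by (auto simp: path_image_def)
      have "c * \<bar>t - s\<bar> \<le> norm (g t - g s)" by (rule g(1)[OF s(1) t(1)])
      also have "\<dots> \<le> norm (x - g s) + norm (x - g t)" 
        using norm_triangle_ineq4[of "x - g s" "x - g t"] by simp
      also have "\<dots> \<le> 2 * r" using s(2) y t by (simp add: dist_norm)
      finally have "\<bar>t - s\<bar> \<le> 2 * r / c" using c by (simp add: field_simps)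
      then have "t \<in> {a..b}" using t(1) by (auto simp: a_def b_def)
      then show "y \<in> g ` {a..b}" using t(2) by blast
    qed
    then have "hausdorff1 (path_image g \<inter> cball x r) \<le> hausdorff1 (g ` {a..b})" by (rule hausdorff1_mono)
    also have "\<dots> \<le> ennreal (L * (b - a))"
    proof (rule hausdorff1_Lipschitz_image_le[OF _ ab(1) c(2)])
      fix s t assume "s \<in> {a..b}" "t \<in> {a..b}"
      then show "norm (g s - g t) \<le> L * \<bar>s - t\<bar>" using g(2) ab(2) by blast
    qed
    also have "\<dots> \<le> ennreal (L * (4 / c * r))" using ab(3) c by (intro ennreal_leI mult_left_mono) auto
    finally show ?thesis by (simp add: mult_ac)
  qed
  moreover have "0 \<le> L * (4 / c)" using c by simp
  ultimately show ?thesis unfolding upper_regular_def by blast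
qed

lemma hausdorff1_Un_le: "hausdorff1 (A \<union> B) \<le> hausdorff1 A + hausdorff1 (B :: 'a::metric_space set)"
proof -
  interpret ring_of_sets UNIV "UNIV :: 'a set set" by (rule ring_UNIV)
  have os: "positive UNIV (hausdorff1 :: 'a set \<Rightarrow> _)" "countably_subadditive UNIV (hausdorff1 :: 'a set \<Rightarrow> _)"
    using outer_measure_space_hausdorff1 by (auto simp: outer_measure_space_def)
  have sub: "subadditive UNIV (hausdorff1 :: 'a set \<Rightarrow> _)"
    by (rule countably_subadditive_subadditive[OF os])
  have "hausdorff1 (A \<union> (B - A)) \<le> hausdorff1 A + hausdorff1 (B - A)"
    by (rule subadditiveD[OF sub]) auto
  also have "\<dots> \<le> hausdorff1 A + hausdorff1 B" by (intro add_left_mono hausdorff1_mono) auto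
  finally show ?thesis by simp
qed

lemma upper_regular_Un: "upper_regular A \<Longrightarrow> upper_regular B \<Longrightarrow> upper_regular (A \<union> B)"
proof -
  assume "upper_regular A" "upper_regular B"
  then obtain C D where C: "0 \<le> C" "\<And>x r. 0 < r \<Longrightarrow> hausdorff1 (A \<inter> cball x r) \<le> ennreal (C * r)"
    and D: "0 \<le> D" "\<And>x r. 0 < r \<Longrightarrow> hausdorff1 (B \<inter> cball x r) \<le> ennreal (D * r)"
    unfolding upper_regular_def by blast
  have "hausdorff1 ((A \<union> B) \<inter> cball x r) \<le> ennreal ((C + D) * r)" if r: "0 < r" for x r
  proof -
    have "hausdorff1 ((A \<union> B) \<inter> cball x r) \<le> hausdorff1 (A \<inter> cball x r) + hausdorff1 (B \<inter> cball x r)"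
      unfolding Int_Un_distrib2 by (rule hausdorff1_Un_le)
    also have "\<dots> \<le> ennreal (C * r) + ennreal (D * r)" by (intro add_mono C D r)
    also have "\<dots> = ennreal ((C + D) * r)" using C(1) D(1) r by (simp add: distrib_right ennreal_plus)
    finally show ?thesis .
  qed
  with C(1) D(1) show ?thesis unfolding upper_regular_def by (intro exI[of _ "C + D"]) auto
qed

lemma upper_regular_empty: "upper_regular {}"
proof -
  have "hausdorff1 ({} :: (real^2) set) = 0"
    using outer_measure_space_hausdorff1 by (auto simp: outer_measure_space_def positive_def)
  then show ?thesis by (auto simp: upper_regular_def)
qed

lemma upper_regular_UN: "finite I \<Longrightarrow> (\<And>i. i \<in> I \<Longrightarrow> upper_regular (A i)) \<Longrightarrow> upper_regular (\<Union>i\<in>I. A i)"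
  by (induction I rule: finite_induct) (auto intro: upper_regular_Un upper_regular_empty)

section \<open>Singular kernels on regular sets\<close>

lemma dyadic_bracket:
  fixes t :: real
  assumes "0 < t" "t \<le> 1"
  obtains n :: nat where "(1/2) ^ Suc n < t" "t \<le> (1/2) ^ n"
proof -
  define m where "m = (LEAST n::nat. (1/2) ^ n < t)"
  obtain n :: nat where "(1/2) ^ n < t" using real_arch_pow_inv[of t "1/2"] assms by auto
  then have m: "(1/2) ^ m < t" unfolding m_def by (rule LeastI)
  then have "m \<noteq> 0" using assms(2) by (intro notI) simp
  then obtain k where k: "m = Suc k" by (cases m) auto
  then have "\<not> (1/2) ^ k < t" unfolding m_def by (intro not_less_Least) simp
  with m k that show ?thesis by auto
qed

lemma upper_regular_finite:
  assumes "upper_regular S" "S \<in> sets borel" "bounded S"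
  shows "emeasure arclength S < \<infinity>"
proof -
  obtain C where C: "\<And>x r. 0 < r \<Longrightarrow> hausdorff1 (S \<inter> cball x r) \<le> ennreal (C * r)"
    using assms(1) unfolding upper_regular_def by blast
  obtain R where R: "0 < R" "S \<subseteq> cball 0 R"
    using assms(3) unfolding bounded_pos by (auto simp: subset_iff)
  then have "emeasure arclength S \<le> ennreal (C * R)"
    using C[OF R(1), of 0] assms(2) by (simp add: emeasure_arclength Int_absorb2)
  then show ?thesis using le_less_trans by fastforce
qed

text \<open>Dyadic decomposition around \<open>x\<close>: on the shell of radius 2^-n the integrand
  is at most 2^((n+1)/2) and the shell has measure O(2^-n), so the sum is geometric with ratio
  \<open>sqrt 2 / 2\<close>.\<close>

lemma set_integrable_inverse_sqrt_dist:
  assumes "upper_regular S" "S \<in> sets borel" "bounded S"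
  shows "set_integrable arclength S (\<lambda>y. 1 / sqrt (norm (x - y)))"
proof -
  obtain C where C: "0 \<le> C" "\<And>x r. 0 < r \<Longrightarrow> hausdorff1 (S \<inter> cball x r) \<le> ennreal (C * r)"
    using assms(1) unfolding upper_regular_def by blast
  have mb: "f \<in> borel_measurable arclength" if "f \<in> borel_measurable borel" for f :: "real^2 \<Rightarrow> 'b::topological_space"
    using that by (simp add: measurable_cong_sets[OF sets_arclength refl])
  have S [measurable]: "S \<in> sets arclength" using assms(2) by (simp add: sets_arclength)
  have cb [measurable]: "S \<inter> cball x r \<in> sets arclength" for r using assms(2) by (simp add: sets_arclength)
  have meas: "(\<lambda>y. indicator S y *\<^sub>R (1 / sqrt (norm (x - y)))) \<in> borel_measurable arclength"
    using assms(2) by (intro mb) measurable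
  define w where "w n = ennreal (sqrt 2 ^ Suc n)" for n
  have pt: "ennreal (norm (indicator S y *\<^sub>R (1 / sqrt (norm (x - y)))))
    \<le> indicator S y + (\<Sum>n. w n * indicator (S \<inter> cball x ((1/2) ^ n)) y)" for y
  proof (cases "y \<in> S \<and> y \<noteq> x \<and> norm (x - y) \<le> 1")
    case True
    then obtain n where n: "(1/2) ^ Suc n < norm (x - y)" "norm (x - y) \<le> (1/2) ^ n"
      using dyadic_bracket[of "norm (x - y)"] by auto
    have "1 / sqrt (norm (x - y)) \<le> 1 / sqrt ((1/2) ^ Suc n)"
      using n(1) True by (intro divide_left_mono mult_pos_pos) auto
    also have "\<dots> = sqrt 2 ^ Suc n" by (simp add: real_sqrt_power real_sqrt_divide power_one_over del: power_Suc)
    finally have "ennreal (norm (indicator S y *\<^sub>R (1 / sqrt (norm (x - y))))) \<le> w n * indicator (S \<inter> cball x ((1/2) ^ n)) y"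
      using True n(2) by (simp add: w_def dist_norm ennreal_leI)
    also have "F n \<le> (\<Sum>n. F n)" for F :: "nat \<Rightarrow> ennreal"
      using sum_le_suminf[of F "{n}"] by simp
    finally show ?thesis by (simp add: add_increasing)
  next
    case False
    \<comment> \<open>At \<open>y = x\<close> the integrand is 1/0 = 0; the third case lies outside
      all dyadic shells, where the integrand is below 1.\<close>
    then consider "y \<notin> S" | "y = x" | "y \<in> S" "1 < norm (x - y)" by fastforce
    then have "ennreal (norm (indicator S y *\<^sub>R (1 / sqrt (norm (x - y))))) \<le> indicator S y"
    proof cases
      case 3
      then have "1 \<le> sqrt (norm (x - y))" by simp
      then have "1 / sqrt (norm (x - y)) \<le> 1 / 1" by (intro divide_left_mono) auto
      then have "1 / sqrt (norm (x - y)) \<le> 1" by simp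
      then show ?thesis using 3 by (simp add: ennreal_leI[of _ 1, simplified])
    qed simp_all
    then show ?thesis by (simp add: add_increasing2)
  qed
  have "(\<integral>\<^sup>+y. ennreal (norm (indicator S y *\<^sub>R (1 / sqrt (norm (x - y))))) \<partial>arclength)
    \<le> (\<integral>\<^sup>+y. indicator S y + (\<Sum>n. w n * indicator (S \<inter> cball x ((1/2) ^ n)) y) \<partial>arclength)"
    by (intro nn_integral_mono pt)
  also have "\<dots> = emeasure arclength S + (\<Sum>n. w n * emeasure arclength (S \<inter> cball x ((1/2) ^ n)))"
    by (subst nn_integral_add, measurable) (simp add: nn_integral_suminf nn_integral_cmult_indicator)
  also have "\<dots> \<le> emeasure arclength S + (\<Sum>n. ennreal (sqrt 2 * C * (sqrt 2 / 2) ^ n))"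
  proof (intro add_left_mono suminf_le summableI)
    fix n
    have "emeasure arclength (S \<inter> cball x ((1/2) ^ n)) \<le> ennreal (C * (1/2) ^ n)"
      using C(2)[of "(1/2) ^ n" x] assms(2) by (simp add: emeasure_arclength)
    then have "w n * emeasure arclength (S \<inter> cball x ((1/2) ^ n)) \<le> w n * ennreal (C * (1/2) ^ n)"
      by (rule mult_left_mono) simp
    also have "\<dots> = ennreal (sqrt 2 ^ Suc n * (C * (1/2) ^ n))"
      unfolding w_def using C(1) by (subst ennreal_mult) auto
    also have "sqrt 2 ^ Suc n * (C * (1/2) ^ n) = sqrt 2 * C * (sqrt 2 / 2) ^ n"
      by (simp add: power_divide)
    finally show "w n * emeasure arclength (S \<inter> cball x ((1/2) ^ n)) \<le> ennreal (sqrt 2 * C * (sqrt 2 / 2) ^ n)" .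
  qed
  also have "\<dots> < \<infinity>"
  proof -
    have "sqrt 2 < 2" by (rule real_less_lsqrt) auto
    then have "summable (\<lambda>n. sqrt 2 * C * (sqrt 2 / 2) ^ n)"
      by (intro summable_mult summable_geometric) auto
    then have "(\<Sum>n. ennreal (sqrt 2 * C * (sqrt 2 / 2) ^ n)) < \<infinity>"
      using C(1) by (subst suminf_ennreal2) auto
    then show ?thesis using upper_regular_finite[OF assms] by (simp add: less_top)
  qed
  finally show ?thesis
    unfolding set_integrable_def by (intro integrableI_bounded meas)
qed

text \<open>Near \<open>x\<close> the square of the bound is the integrable |x - y|^(-1/2); away
  from \<open>x\<close> continuity on a compact set gives boundedness.\<close>

lemma kernel_in_L2:
  assumes S: "compact S" "upper_regular S" and cont: "continuous_on (S - {x}) K"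
    and bound: "\<forall>\<^sub>F y in at x within S. norm (K y) \<le> C * norm (x - y) powr (-1/4)"
  shows "K \<in> L2 S"
proof -
  have Sb: "S \<in> sets borel" using S(1) by (simp add: compact_imp_closed borel_closed)
  obtain \<delta> where \<delta>: "0 < \<delta>"
    "\<And>y. y \<in> S \<Longrightarrow> y \<noteq> x \<Longrightarrow> dist y x < \<delta> \<Longrightarrow> norm (K y) \<le> C * norm (x - y) powr (-1/4)"
    using bound unfolding eventually_at by blast
  have "compact (S - ball x \<delta>)" using S(1) by (simp add: compact_diff)
  moreover have "continuous_on (S - ball x \<delta>) K" using \<delta>(1) by (intro continuous_on_subset[OF cont]) auto
  ultimately have "bounded (K ` (S - ball x \<delta>))" by (intro compact_imp_bounded compact_continuous_image)
  then obtain B where "\<forall>z\<in>K ` (S - ball x \<delta>). norm z \<le> B" unfolding bounded_iff by blast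
  then have B: "norm (K y) \<le> B" if "y \<in> S - ball x \<delta>" for y using that by blast
  have pt: "(norm (K y))\<^sup>2 \<le> C\<^sup>2 * (1 / sqrt (norm (x - y))) + B\<^sup>2" if y: "y \<in> S" "y \<noteq> x" for y
  proof (cases "dist y x < \<delta>")
    case True
    have "(norm (K y))\<^sup>2 \<le> (C * norm (x - y) powr (-1/4))\<^sup>2"
      using \<delta>(2)[OF y True] by (intro power_mono) auto
    also have "\<dots> = C\<^sup>2 * (norm (x - y) powr (-1/4) * norm (x - y) powr (-1/4))"
      by (simp add: power_mult_distrib power2_eq_square)
    also have "norm (x - y) powr (-1/4) * norm (x - y) powr (-1/4) = norm (x - y) powr (-(1/2))"
      unfolding powr_add[symmetric] by simp
    also have "\<dots> = 1 / sqrt (norm (x - y))" by (simp add: powr_minus_divide powr_half_sqrt)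
    finally show ?thesis by (simp add: add_increasing2)
  next
    case False
    then have "y \<in> S - ball x \<delta>" using y by (simp add: dist_commute)
    then have "(norm (K y))\<^sup>2 \<le> B\<^sup>2" using B by (intro power_mono) auto
    then show ?thesis by (simp add: add_increasing)
  qed
  \<comment> \<open>The value of \<open>K\<close> at \<open>x\<close> itself is uncontrolled, so
    measurability is assembled from the punctured set and the singleton.\<close>
  have "(\<lambda>y. indicator (S - {x}) y *\<^sub>R K y) \<in> borel_measurable borel"
    using Sb by (intro borel_measurable_continuous_on_indicator cont) auto
  moreover have "(\<lambda>y. indicator {x} y *\<^sub>R K x) \<in> borel_measurable borel" by measurable
  ultimately have "(\<lambda>y. indicator (S - {x}) y *\<^sub>R K y + indicator S x *\<^sub>R indicator {x} y *\<^sub>R K x) \<in> borel_measurable borel"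
    by measurable
  moreover have "indicator (S - {x}) y *\<^sub>R K y + indicator S x *\<^sub>R indicator {x} y *\<^sub>R K x = indicator S y *\<^sub>R K y" for y
    by (auto simp: indicator_def)
  ultimately have m: "set_borel_measurable arclength S K"
    unfolding set_borel_measurable_def by (simp add: measurable_cong_sets[OF sets_arclength refl])
  have "set_integrable arclength S (\<lambda>y. C\<^sup>2 * (1 / sqrt (norm (x - y))) + B\<^sup>2)"
  proof (intro set_integral_add(1) set_integrable_mult_right)
    show "set_integrable arclength S (\<lambda>y. 1 / sqrt (norm (x - y)))"
      by (rule set_integrable_inverse_sqrt_dist[OF S(2) Sb compact_imp_bounded[OF S(1)]])
    show "set_integrable arclength S (\<lambda>y. B\<^sup>2)"
      using upper_regular_finite[OF S(2) Sb compact_imp_bounded[OF S(1)]] Sb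
      unfolding set_integrable_def by (intro integrable_real_indicator integrable_scaleR_left) (auto simp: sets_arclength)
  qed
  then have "set_integrable arclength S (\<lambda>y. (norm (K y))\<^sup>2)"
  proof (rule set_integrable_bound)
    have "(\<lambda>y. (norm (indicator S y *\<^sub>R K y))\<^sup>2) \<in> borel_measurable arclength"
      using m unfolding set_borel_measurable_def by measurable
    moreover have "(norm (indicator S y *\<^sub>R K y))\<^sup>2 = indicator S y *\<^sub>R (norm (K y))\<^sup>2" for y
      by (auto simp: indicator_def)
    ultimately show "set_borel_measurable arclength S (\<lambda>y. (norm (K y))\<^sup>2)"
      unfolding set_borel_measurable_def by simp
    have "{x} \<in> null_sets arclength" by (rule countable_null_arclength) simp
    then show "AE y in arclength. y \<in> S \<longrightarrow> norm ((norm (K y))\<^sup>2) \<le> norm (C\<^sup>2 * (1 / sqrt (norm (x - y))) + B\<^sup>2)"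
      by (rule AE_I') (use pt in \<open>force simp: add_nonneg_nonneg\<close>)
  qed
  with m show ?thesis by (simp add: L2_def)
qed

lemma L2_mult_integrable:
  assumes "f \<in> L2 S" "g \<in> L2 S"
  shows "set_integrable arclength S (\<lambda>y. f y * g y)"
proof -
  have "set_integrable arclength S (\<lambda>y. (norm (f y))\<^sup>2 + (norm (g y))\<^sup>2)"
    using assms by (intro set_integral_add(1)) (auto simp: L2_def)
  then show ?thesis
  proof (rule set_integrable_bound)
    have "(\<lambda>y. (indicator S y *\<^sub>R f y) * (indicator S y *\<^sub>R g y)) \<in> borel_measurable arclength"
      using assms unfolding L2_def set_borel_measurable_def by (intro borel_measurable_times) auto
    moreover have "(indicator S y *\<^sub>R f y) * (indicator S y *\<^sub>R g y) = indicator S y *\<^sub>R (f y * g y)" for y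
      by (auto simp: indicator_def)
    ultimately show "set_borel_measurable arclength S (\<lambda>y. f y * g y)"
      unfolding set_borel_measurable_def by (simp only:)
    have "norm (f y * g y) \<le> norm ((norm (f y))\<^sup>2 + (norm (g y))\<^sup>2)" for y
    proof -
      have "2 * (norm (f y) * norm (g y)) \<le> (norm (f y))\<^sup>2 + (norm (g y))\<^sup>2"
        using sum_squares_bound[of "norm (f y)" "norm (g y)"] by (simp add: mult.assoc)
      moreover have "0 \<le> norm (f y) * norm (g y)" by simp
      ultimately have "norm (f y) * norm (g y) \<le> (norm (f y))\<^sup>2 + (norm (g y))\<^sup>2" by linarith
      then show ?thesis by (simp add: norm_mult)
    qed
    then show "AE y in arclength. y \<in> S \<longrightarrow> norm (f y * g y) \<le> norm ((norm (f y))\<^sup>2 + (norm (g y))\<^sup>2)"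
      by simp
  qed
qed

section \<open>Curves and outward normals\<close>

definition tame_curve :: "(real^2) set \<Rightarrow> bool" where
  "tame_curve S \<longleftrightarrow> (\<exists>\<Gamma>. finite \<Gamma> \<and> (\<forall>g\<in>\<Gamma>. tame_arc g) \<and> S = (\<Union>g\<in>\<Gamma>. path_image g))"

lemma tame_curve_upper_regular: "tame_curve S \<Longrightarrow> upper_regular S"
  unfolding tame_curve_def using upper_regular_UN tame_arc_upper_regular by metis

lemma tame_curve_Un: "tame_curve S \<Longrightarrow> tame_curve T \<Longrightarrow> tame_curve (S \<union> T)"
  unfolding tame_curve_def
proof (elim exE conjE)
  fix \<Gamma> \<Delta> assume "finite \<Gamma>" "\<forall>g\<in>\<Gamma>. tame_arc g" "S = (\<Union>g\<in>\<Gamma>. path_image g)"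
    "finite \<Delta>" "\<forall>g\<in>\<Delta>. tame_arc g" "T = (\<Union>g\<in>\<Delta>. path_image g)"
  then show "\<exists>\<Gamma>. finite \<Gamma> \<and> (\<forall>g\<in>\<Gamma>. tame_arc g) \<and> S \<union> T = (\<Union>g\<in>\<Gamma>. path_image g)"
    by (intro exI[of _ "\<Gamma> \<union> \<Delta>"]) auto
qed

lemma tame_curve_UN: "finite I \<Longrightarrow> (\<And>i. i \<in> I \<Longrightarrow> tame_curve (A i)) \<Longrightarrow> tame_curve (\<Union>i\<in>I. A i)"
proof (induction I rule: finite_induct)
  case empty
  show ?case by (auto simp: tame_curve_def intro: exI[of _ "{}"])
qed (auto intro: tame_curve_Un)

lemma tame_arc_isometry:
  assumes "tame_arc g" and lin: "linear F" and iso: "\<And>v. norm (F v) = norm v"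
  shows "tame_arc (\<lambda>t. c + F (g t))"
proof -
  obtain L c0 M g' where c: "0 < c0" "0 \<le> L" "0 \<le> M" and g: "\<forall>s\<in>{0..1}. \<forall>t\<in>{0..1}.
     c0 * \<bar>t - s\<bar> \<le> norm (g t - g s) \<and> norm (g t - g s) \<le> L * \<bar>t - s\<bar> \<and>
     norm (g t - g s - (t - s) *\<^sub>R g' s) \<le> M * \<bar>t - s\<bar>\<^sup>2"
    using assms(1) unfolding tame_arc_def by blast
  have "(c + F (g t)) - (c + F (g s)) = F (g t - g s)" for s t
    by (simp add: linear_diff[OF lin])
  moreover have "F (g t - g s) - (t - s) *\<^sub>R F (g' s) = F (g t - g s - (t - s) *\<^sub>R g' s)" for s t
    by (simp add: linear_diff[OF lin] linear_cmul[OF lin])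
  ultimately show ?thesis
    unfolding tame_arc_def using c g
    by (intro exI[of _ L] exI[of _ c0] exI[of _ M] exI[of _ "\<lambda>s. F (g' s)"]) (simp add: iso)
qed

lemma tame_curve_isometry:
  assumes "tame_curve S" "linear F" "\<And>v. norm (F v) = norm v"
  shows "tame_curve ((\<lambda>x. c + F x) ` S)"
proof -
  obtain \<Gamma> where \<Gamma>: "finite \<Gamma>" "\<And>g. g \<in> \<Gamma> \<Longrightarrow> tame_arc g" "S = (\<Union>g\<in>\<Gamma>. path_image g)"
    using assms(1) unfolding tame_curve_def by blast
  have "(\<lambda>x. c + F x) ` S = (\<Union>g\<in>(\<lambda>g t. c + F (g t)) ` \<Gamma>. path_image g)"
    unfolding \<Gamma>(3) path_image_def by (simp add: image_UN image_image)
  then show ?thesis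
    unfolding tame_curve_def using \<Gamma> tame_arc_isometry[OF _ assms(2,3)]
    by (intro exI[of _ "(\<lambda>g t. c + F (g t)) ` \<Gamma>"]) auto
qed

lemma tame_arc_closed: "tame_arc g \<Longrightarrow> closed (path_image g)"
proof -
  assume "tame_arc g"
  then obtain L where L: "0 \<le> L" "\<And>s t. s \<in> {0..1} \<Longrightarrow> t \<in> {0..1} \<Longrightarrow> norm (g t - g s) \<le> L * \<bar>t - s\<bar>"
    unfolding tame_arc_def by blast
  have "L-lipschitz_on {0..1} g"
    using L by (intro lipschitz_onI) (auto simp: dist_norm dist_real_def)
  then have "continuous_on {0..1} g" by (rule lipschitz_on_continuous_on)
  then show ?thesis unfolding path_image_def by (intro compact_imp_closed compact_continuous_image) auto
qed

text \<open>The inner cone consists of points of \<open>D\<close>, and the open outer cone misses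
  \<open>D\<close>, hence also its closure. Frontier points are squeezed between the two.\<close>

lemma frontier_normal_cone:
  assumes D: "open D" and \<eta>: "0 < \<eta>"
    and \<delta>: "\<And>y. norm (y - x) < \<delta> \<Longrightarrow> ((y - x) \<bullet> n < - \<eta> * norm (y - x) \<longrightarrow> y \<in> D) \<and>
        ((y - x) \<bullet> n > \<eta> * norm (y - x) \<longrightarrow> y \<notin> D)"
    and y: "y \<in> frontier D" "norm (y - x) < \<delta>"
  shows "\<bar>(y - x) \<bullet> n\<bar> \<le> \<eta> * norm (y - x)"
proof -
  have "y \<notin> D" using D y(1) by (simp add: frontier_def interior_open)
  then have "\<not> (y - x) \<bullet> n < - \<eta> * norm (y - x)" using \<delta>[OF y(2)] by blast
  moreover have "\<not> (y - x) \<bullet> n > \<eta> * norm (y - x)"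
  proof
    assume h: "(y - x) \<bullet> n > \<eta> * norm (y - x)"
    define U where "U = {y. norm (y - x) < \<delta>} \<inter> {y. \<eta> * norm (y - x) < (y - x) \<bullet> n}"
    have "open U" unfolding U_def by (intro open_Int open_Collect_less continuous_intros)
    moreover have "y \<in> U" using h y(2) by (simp add: U_def)
    moreover have "U \<inter> D = {}" using \<delta> by (auto simp: U_def)
    ultimately have "y \<notin> closure D" by (metis open_Int_closure_eq_empty disjoint_iff)
    then show False using y(1) by (simp add: frontier_def)
  qed
  ultimately show ?thesis by (simp add: abs_le_iff)
qed

text \<open>Along \<open>v = m - n\<close> one has \<open>v \<bullet> n < 0 < v \<bullet> m\<close>,
  so a short step in this direction would land inside \<open>D\<close> by one normal and outside
  \<open>D\<close> by the other.\<close>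

lemma outward_normal_unique:
  assumes "is_outward_normal D x n" "is_outward_normal D x m"
  shows "n = m"
proof (rule ccontr)
  assume ne: "n \<noteq> m"
  have wt: "n \<bullet> n = 1" "m \<bullet> m = 1" using assms by (auto simp: is_outward_normal_def norm_eq_1)
  define v where "v = m - n"
  have "0 < v \<bullet> v" using ne by (simp add: v_def)
  then have lt: "n \<bullet> m < 1" using wt by (simp add: v_def inner_diff_left inner_diff_right inner_commute)
  have vn: "v \<bullet> n = n \<bullet> m - 1" "v \<bullet> m = 1 - n \<bullet> m"
    using wt by (simp_all add: v_def inner_diff_left inner_diff_right inner_commute)
  have v0: "0 < norm v" using ne by (simp add: v_def)
  define \<eta> where "\<eta> = (1 - n \<bullet> m) / (2 * norm v)"
  have \<eta>: "0 < \<eta>" "\<eta> * norm v < 1 - n \<bullet> m" using lt v0 by (auto simp: \<eta>_def)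
  obtain \<delta>1 where 1: "0 < \<delta>1" "\<And>y. norm (y - x) < \<delta>1 \<Longrightarrow> ((y - x) \<bullet> n < - \<eta> * norm (y - x) \<longrightarrow> y \<in> D)"
    using assms(1) \<eta>(1) unfolding is_outward_normal_def by meson
  obtain \<delta>2 where 2: "0 < \<delta>2" "\<And>y. norm (y - x) < \<delta>2 \<Longrightarrow> ((y - x) \<bullet> m > \<eta> * norm (y - x) \<longrightarrow> y \<notin> D)"
    using assms(2) \<eta>(1) unfolding is_outward_normal_def by meson
  define t where "t = min \<delta>1 \<delta>2 / (2 * norm v)"
  have t: "0 < t" using 1 2 v0 by (simp add: t_def)
  have tn: "t * norm v < min \<delta>1 \<delta>2" proof -
    have "t * norm v = min \<delta>1 \<delta>2 / 2" using v0 by (simp add: t_def)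
    moreover have "0 < min \<delta>1 \<delta>2" using 1 2 by simp
    ultimately show ?thesis by linarith
  qed
  define y where "y = x + t *\<^sub>R v"
  have ny: "norm (y - x) = t * norm v" using t by (simp add: y_def)
  have "v \<bullet> n < - (\<eta> * norm v)" "\<eta> * norm v < v \<bullet> m" using \<eta>(2) vn by linarith+
  then have "t * (v \<bullet> n) < t * - (\<eta> * norm v)" "t * (\<eta> * norm v) < t * (v \<bullet> m)"
    using t by (simp_all only: mult_less_cancel_left_pos)
  then have "(y - x) \<bullet> n < - \<eta> * norm (y - x)" "(y - x) \<bullet> m > \<eta> * norm (y - x)"
    unfolding ny by (simp_all add: y_def mult_ac)
  moreover have "norm (y - x) < \<delta>1" "norm (y - x) < \<delta>2" using tn ny by auto
  ultimately show False using 1(2)[of y] 2(2)[of y] by blast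
qed

lemma outward_normal_eq: "is_outward_normal D x n \<Longrightarrow> is_outward_normal D x (outward_normal D x)"
  unfolding outward_normal_def by (rule theI) (auto dest: outward_normal_unique)

text \<open>If \<open>x\<close> lies on the arc, the arc stays in the frontier and so between the
  cones of \<open>n\<close>. This forces its tangent at \<open>x\<close> to be orthogonal to
  \<open>n\<close>, and the Taylor remainder is quadratic. If \<open>x\<close> is off the arc, its
  distance to the arc is positive and the bound is trivial.\<close>

lemma tame_arc_normal_bound:
  assumes g: "tame_arc g" and D: "open D" "path_image g \<subseteq> frontier D"
    and n: "is_outward_normal D x n"
  shows "\<exists>C\<ge>0. \<forall>y\<in>path_image g. \<bar>n \<bullet> (x - y)\<bar> \<le> C * (norm (x - y))\<^sup>2"
proof (cases "x \<in> path_image g")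
  case False
  have n1: "norm n = 1" using n by (simp add: is_outward_normal_def)
  obtain \<delta> where \<delta>: "0 < \<delta>" "ball x \<delta> \<inter> path_image g = {}"
    using tame_arc_closed[OF g] False
    by (metis Compl_iff disjoint_eq_subset_Compl inf_commute open_Compl open_contains_ball_eq)
  have "\<bar>n \<bullet> (x - y)\<bar> \<le> 1 / \<delta> * (norm (x - y))\<^sup>2" if y: "y \<in> path_image g" for y
  proof -
    have "\<delta> \<le> norm (x - y)" using \<delta>(2) y by (auto simp: dist_norm disjoint_iff not_less)
    then have "\<delta> * norm (x - y) \<le> norm (x - y) * norm (x - y)" by (intro mult_right_mono) auto
    then have "norm (x - y) \<le> 1 / \<delta> * (norm (x - y))\<^sup>2" using \<delta>(1) by (simp add: power2_eq_square field_simps)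
    moreover have "\<bar>n \<bullet> (x - y)\<bar> \<le> norm (x - y)" using Cauchy_Schwarz_ineq2[of n "x - y"] n1 by simp
    ultimately show ?thesis by linarith
  qed
  then show ?thesis using \<delta>(1) by (intro exI[of _ "1 / \<delta>"]) auto
next
  case True
  then obtain s where s: "s \<in> {0..1}" "x = g s" by (auto simp: path_image_def)
  have n1: "norm n = 1" using n by (simp add: is_outward_normal_def)
  obtain L c M g' where c: "0 < c" "0 \<le> L" "0 \<le> M"
    and low: "\<And>t. t \<in> {0..1} \<Longrightarrow> c * \<bar>t - s\<bar> \<le> norm (g t - g s)"
    and up: "\<And>t. t \<in> {0..1} \<Longrightarrow> norm (g t - g s) \<le> L * \<bar>t - s\<bar>"
    and tay: "\<And>t. t \<in> {0..1} \<Longrightarrow> norm (g t - g s - (t - s) *\<^sub>R g' s) \<le> M * \<bar>t - s\<bar>\<^sup>2"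
    using g s(1) unfolding tame_arc_def by blast
  have tay': "\<bar>n \<bullet> (g t - g s) - (t - s) * (n \<bullet> g' s)\<bar> \<le> M * \<bar>t - s\<bar>\<^sup>2" if "t \<in> {0..1}" for t
  proof -
    have "\<bar>n \<bullet> (g t - g s - (t - s) *\<^sub>R g' s)\<bar> \<le> norm n * norm (g t - g s - (t - s) *\<^sub>R g' s)"
      by (rule Cauchy_Schwarz_ineq2)
    then show ?thesis using tay[OF that] n1 by (simp add: inner_diff_right)
  qed
  have "\<bar>n \<bullet> g' s\<bar> \<le> 0"
  proof (rule field_le_epsilon)
    fix e :: real assume e: "0 < e"
    define \<eta> where "\<eta> = e / (2 * (L + 1))"
    have \<eta>: "0 < \<eta>" "\<eta> * L \<le> e / 2"
    proof -
      show "0 < \<eta>" using e c by (simp add: \<eta>_def)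
      have "\<eta> * L \<le> \<eta> * (L + 1)" using \<open>0 < \<eta>\<close> by simp
      also have "\<dots> = e / 2" using c by (simp add: \<eta>_def field_simps)
      finally show "\<eta> * L \<le> e / 2" .
    qed
    obtain \<delta> where \<delta>: "0 < \<delta>" "\<And>y. norm (y - x) < \<delta> \<Longrightarrow> ((y - x) \<bullet> n < - \<eta> * norm (y - x) \<longrightarrow> y \<in> D) \<and>
        ((y - x) \<bullet> n > \<eta> * norm (y - x) \<longrightarrow> y \<notin> D)"
      using n \<eta>(1) unfolding is_outward_normal_def by meson
    \<comment> \<open>The bound 1/2 leaves room for \<open>s + h\<close> or \<open>s - h\<close>
      inside the unit interval; the other two keep the step inside the ball of the cone condition
      and the Taylor error below \<open>e / 2\<close>.\<close>
    define h where "h = min (1/2) (min (\<delta> / (2 * (L + 1))) (e / (2 * (M + 1))))"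
    have h: "0 < h" "h \<le> 1/2" "L * h < \<delta>" "M * h \<le> e / 2"
    proof -
      show "0 < h" using e c \<delta>(1) by (simp add: h_def)
      show "h \<le> 1/2" unfolding h_def by (rule min.cobounded1)
      have "(L + 1) * h \<le> (L + 1) * (\<delta> / (2 * (L + 1)))" using c by (intro mult_left_mono) (auto simp: h_def)
      also have "\<dots> = \<delta> / 2" using c by (simp add: field_simps)
      finally show "L * h < \<delta>" using \<open>0 < h\<close> \<delta>(1) by (simp add: distrib_right)
      have "(M + 1) * h \<le> (M + 1) * (e / (2 * (M + 1)))" using c by (intro mult_left_mono) (auto simp: h_def)
      also have "\<dots> = e / 2" using c by (simp add: field_simps)
      finally show "M * h \<le> e / 2" using \<open>0 < h\<close> by (simp add: distrib_right)
    qed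
    obtain t where t: "t \<in> {0..1}" "\<bar>t - s\<bar> = h"
    proof (cases "s \<le> 1/2")
      case True
      show ?thesis by (rule that[of "s + h"]) (use True s h in auto)
    next
      case False
      show ?thesis by (rule that[of "s - h"]) (use False s h in auto)
    qed
    have gt: "norm (g t - x) \<le> L * h" using up[OF t(1)] t(2) s(2) by simp
    have "g t \<in> frontier D" using D(2) t(1) by (auto simp: path_image_def)
    moreover have "norm (g t - x) < \<delta>" using gt h(3) by simp
    ultimately have "\<bar>(g t - x) \<bullet> n\<bar> \<le> \<eta> * norm (g t - x)"
      using frontier_normal_cone[OF D(1) \<eta>(1), of x \<delta> n "g t"] \<delta>(2) by blast
    also have "\<dots> \<le> \<eta> * (L * h)" using gt \<eta>(1) by simp
    also have "\<dots> = (\<eta> * L) * h" by simp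
    also have "\<dots> \<le> (e / 2) * h" using \<eta>(2) h(1) by (intro mult_right_mono) auto
    finally have 1: "\<bar>n \<bullet> (g t - g s)\<bar> \<le> (e / 2) * h" by (simp add: s(2) inner_commute)
    have "\<bar>n \<bullet> (g t - g s) - (t - s) * (n \<bullet> g' s)\<bar> \<le> (M * h) * h"
      using tay'[OF t(1)] t(2) by (simp add: power2_eq_square)
    also have "\<dots> \<le> (e / 2) * h" using h(1,4) by (intro mult_right_mono) auto
    finally have "\<bar>(t - s) * (n \<bullet> g' s)\<bar> \<le> e * h" using 1 by linarith
    then have "h * \<bar>n \<bullet> g' s\<bar> \<le> h * e" using t(2) by (simp add: abs_mult mult.commute)
    then show "\<bar>n \<bullet> g' s\<bar> \<le> 0 + e" using h(1) by simp
  qed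
  then have tang: "n \<bullet> g' s = 0" by simp
  have "\<bar>n \<bullet> (x - y)\<bar> \<le> M / c\<^sup>2 * (norm (x - y))\<^sup>2" if "y \<in> path_image g" for y
  proof -
    obtain t where t: "t \<in> {0..1}" "y = g t" using \<open>y \<in> path_image g\<close> by (auto simp: path_image_def)
    have "\<bar>n \<bullet> (x - y)\<bar> = \<bar>n \<bullet> (g t - g s)\<bar>" by (simp add: s t inner_diff_right abs_minus_commute)
    also have "\<dots> \<le> M * \<bar>t - s\<bar>\<^sup>2" using tay'[OF t(1)] tang by simp
    also have "\<dots> \<le> M * (norm (g t - g s) / c)\<^sup>2"
      using low[OF t(1)] c by (intro mult_left_mono power_mono) (auto simp: field_simps)
    also have "\<dots> = M / c\<^sup>2 * (norm (x - y))\<^sup>2" by (simp add: s t power_divide norm_minus_commute)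
    finally show ?thesis .
  qed
  then show ?thesis using c by (intro exI[of _ "M / c\<^sup>2"]) auto
qed

lemma tame_curve_normal_bound:
  assumes "tame_curve (frontier D)" "open D" "is_outward_normal D x n"
  shows "\<exists>C\<ge>0. \<forall>y\<in>frontier D. \<bar>n \<bullet> (x - y)\<bar> \<le> C * (norm (x - y))\<^sup>2"
proof -
  obtain \<Gamma> where \<Gamma>: "finite \<Gamma>" "\<And>g. g \<in> \<Gamma> \<Longrightarrow> tame_arc g" "frontier D = (\<Union>g\<in>\<Gamma>. path_image g)"
    using assms(1) unfolding tame_curve_def by blast
  have "\<forall>g\<in>\<Gamma>. \<exists>C. 0 \<le> C \<and> (\<forall>y\<in>path_image g. \<bar>n \<bullet> (x - y)\<bar> \<le> C * (norm (x - y))\<^sup>2)"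
  proof
    fix g assume g: "g \<in> \<Gamma>"
    then have "path_image g \<subseteq> frontier D" using \<Gamma>(3) by blast
    from tame_arc_normal_bound[OF \<Gamma>(2)[OF g] assms(2) this assms(3)]
    show "\<exists>C. 0 \<le> C \<and> (\<forall>y\<in>path_image g. \<bar>n \<bullet> (x - y)\<bar> \<le> C * (norm (x - y))\<^sup>2)" .
  qed
  from bchoice[OF this] obtain C
    where "\<forall>g\<in>\<Gamma>. 0 \<le> C g \<and> (\<forall>y\<in>path_image g. \<bar>n \<bullet> (x - y)\<bar> \<le> C g * (norm (x - y))\<^sup>2)" ..
  then have C: "\<And>g. g \<in> \<Gamma> \<Longrightarrow> 0 \<le> C g"
    "\<And>g y. g \<in> \<Gamma> \<Longrightarrow> y \<in> path_image g \<Longrightarrow> \<bar>n \<bullet> (x - y)\<bar> \<le> C g * (norm (x - y))\<^sup>2"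
    by blast+
  have "\<bar>n \<bullet> (x - y)\<bar> \<le> sum C \<Gamma> * (norm (x - y))\<^sup>2" if y: "y \<in> frontier D" for y
  proof -
    obtain g where g: "g \<in> \<Gamma>" "y \<in> path_image g" using y unfolding \<Gamma>(3) by blast
    have "C g \<le> sum C \<Gamma>" using C(1) \<Gamma>(1) g(1) by (intro member_le_sum) auto
    then have "C g * (norm (x - y))\<^sup>2 \<le> sum C \<Gamma> * (norm (x - y))\<^sup>2" by (intro mult_right_mono) auto
    then show ?thesis using C(2)[OF g] by linarith
  qed
  then show ?thesis using C(1) by (intro exI[of _ "sum C \<Gamma>"]) (auto intro: sum_nonneg)
qed

section \<open>Frontiers of disjoint unions and the hexagonal rotation\<close>

lemma frontier_UN_open:
  assumes "finite I" "\<And>i. i \<in> I \<Longrightarrow> open (A i)"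
    and "\<And>i j. i \<in> I \<Longrightarrow> j \<in> I \<Longrightarrow> i \<noteq> j \<Longrightarrow> closure (A i) \<inter> closure (A j) = {}"
  shows "frontier (\<Union>i\<in>I. A i) = (\<Union>i\<in>I. frontier (A i))"
proof -
  have "frontier (\<Union>i\<in>I. A i) = (\<Union>i\<in>I. closure (A i)) - (\<Union>i\<in>I. A i)"
  proof -
    have "closure (\<Union>i\<in>I. A i) = (\<Union>i\<in>I. closure (A i))"
      using assms(1) by (induction I rule: finite_induct) auto
    then show ?thesis using assms(2) by (simp add: frontier_def interior_open open_UN)
  qed
  also have "\<dots> = (\<Union>i\<in>I. closure (A i) - A i)"
    using assms(3) closure_subset by blast
  also have "\<dots> = (\<Union>i\<in>I. frontier (A i))"
    using assms(2) by (simp add: frontier_def interior_open)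
  finally show ?thesis .
qed

lemma l_components [simp]: "l1$1 = 1/2" "l1$2 = - sqrt 3 / 2" "l2$1 = 1/2" "l2$2 = sqrt 3 / 2"
  by (simp_all add: l1_def l2_def)

lemma rotR_mult: "rotR *v x = vector [x$1 / 2 + sqrt 3 / 2 * x$2, - (sqrt 3 / 2 * x$1) + x$2 / 2]"
  by (simp add: vec_eq_iff forall_2 matrix_vector_mult_def sum_2 rotR_def)

lemma rotR_l: "rotR *v l1 = - l2" "rotR *v l2 = l1 + l2"
  by (simp_all add: rotR_mult vec_eq_iff forall_2)

lemma linear_rotR: "linear ((*v) rotR)"
  by (rule matrix_vector_mul_linear)

lemma norm_real2_sq: "(norm (v :: real^2))\<^sup>2 = (v$1)\<^sup>2 + (v$2)\<^sup>2"
  unfolding power2_norm_eq_inner inner_real2 by (simp add: power2_eq_square)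

section \<open>The honeycomb\<close>

text \<open>All the arithmetic of \<open>sqrt 3\<close>, reduced to \<open>s * s = 3\<close>, with
  \<open>a\<close> and \<open>b\<close> as halved coordinates: the length of a rotated vector, the
  chord of a rotation by 120 degrees, the hexagonal norm form, and the components of the double
  rotation.\<close>

lemma hexagonal_identities:
  fixes s a b :: real
  assumes "s * s = 3"
  shows "(a + s * b)\<^sup>2 + (- (s * a) + b)\<^sup>2 = (2 * a)\<^sup>2 + (2 * b)\<^sup>2"
    and "(- 3 * a + s * b)\<^sup>2 + (- (s * a) - 3 * b)\<^sup>2 = 3 * ((2 * a)\<^sup>2 + (2 * b)\<^sup>2)"
    and "(a + b)\<^sup>2 + (s * (b - a))\<^sup>2 = (2 * a)\<^sup>2 + (2 * b)\<^sup>2 - (2 * a) * (2 * b)"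
    and "(a + s * b) + s * (- (s * a) + b) = 2 * (- a + s * b)"
    and "- (s * (a + s * b)) + (- (s * a) + b) = 2 * (- (s * a) - b)"
proof -
  have "(a + s * b)\<^sup>2 + (- (s * a) + b)\<^sup>2 = (1 + s * s) * (a\<^sup>2 + b\<^sup>2)"
    by (simp add: power2_eq_square algebra_simps)
  then show "(a + s * b)\<^sup>2 + (- (s * a) + b)\<^sup>2 = (2 * a)\<^sup>2 + (2 * b)\<^sup>2"
    unfolding assms by (simp add: power2_eq_square algebra_simps)
  have "(- 3 * a + s * b)\<^sup>2 + (- (s * a) - 3 * b)\<^sup>2 = (9 + s * s) * (a\<^sup>2 + b\<^sup>2)"
    by (simp add: power2_eq_square algebra_simps)
  then show "(- 3 * a + s * b)\<^sup>2 + (- (s * a) - 3 * b)\<^sup>2 = 3 * ((2 * a)\<^sup>2 + (2 * b)\<^sup>2)"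
    unfolding assms by (simp add: power2_eq_square algebra_simps)
  have "(a + b)\<^sup>2 + (s * (b - a))\<^sup>2 = (a + b)\<^sup>2 + (s * s) * (b - a)\<^sup>2"
    by (simp add: power2_eq_square algebra_simps)
  then show "(a + b)\<^sup>2 + (s * (b - a))\<^sup>2 = (2 * a)\<^sup>2 + (2 * b)\<^sup>2 - (2 * a) * (2 * b)"
    unfolding assms by (simp add: power2_eq_square algebra_simps)
  have "(a + s * b) + s * (- (s * a) + b) = a + 2 * (s * b) - (s * s) * a"
    by (simp add: power2_eq_square algebra_simps)
  then show "(a + s * b) + s * (- (s * a) + b) = 2 * (- a + s * b)"
    unfolding assms by (simp add: power2_eq_square algebra_simps)
  have "- (s * (a + s * b)) + (- (s * a) + b) = b - 2 * (s * a) - (s * s) * b"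
    by (simp add: power2_eq_square algebra_simps)
  then show "- (s * (a + s * b)) + (- (s * a) + b) = 2 * (- (s * a) - b)"
    unfolding assms by (simp add: power2_eq_square algebra_simps)
qed

lemma norm_rotR: "norm (rotR *v x) = norm x"
proof -
  have "(norm (rotR *v x))\<^sup>2 = (norm x)\<^sup>2"
    unfolding norm_real2_sq rotR_mult
    using hexagonal_identities(1)[of "sqrt 3" "x$1 / 2" "x$2 / 2"] by (simp add: mult_ac)
  then show ?thesis by simp
qed

lemma rotR_rotR: "rotR *v (rotR *v x)
    = vector [- (x$1 / 2) + sqrt 3 * (x$2 / 2), - (sqrt 3 * (x$1 / 2)) - x$2 / 2]"
  unfolding rotR_mult
  using hexagonal_identities(4,5)[of "sqrt 3" "x$1 / 2" "x$2 / 2"]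
  by (simp add: vec_eq_iff forall_2 field_simps)

text \<open>The chord of a 120 degree rotation. As \<open>D0\<close> contains both ends, this bounds
  the norm of its points by its diameter divided by \<open>sqrt 3\<close>.\<close>

lemma norm_rotR_sq_diff: "norm (rotR *v (rotR *v x) - x) = sqrt 3 * norm x"
proof -
  have "(rotR *v (rotR *v x) - x) $ 1 = - 3 * (x$1 / 2) + sqrt 3 * (x$2 / 2)"
    "(rotR *v (rotR *v x) - x) $ 2 = - (sqrt 3 * (x$1 / 2)) - 3 * (x$2 / 2)"
    unfolding rotR_rotR by simp_all
  then have "(norm (rotR *v (rotR *v x) - x))\<^sup>2 = 3 * ((x$1)\<^sup>2 + (x$2)\<^sup>2)"
    unfolding norm_real2_sq using hexagonal_identities(2)[of "sqrt 3" "x$1 / 2" "x$2 / 2"] by simp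
  also have "\<dots> = (sqrt 3 * norm x)\<^sup>2"
    unfolding power_mult_distrib norm_real2_sq by simp
  finally show ?thesis by (simp add: power2_eq_iff_nonneg)
qed

text \<open>The squared length is \<open>m * m + n * n - m * n\<close>, an integer, and twice it is
  a sum of squares, so it is positive unless \<open>m = n = 0\<close>.\<close>

lemma norm_lattice_ge_1:
  fixes m n :: int
  assumes "m \<noteq> 0 \<or> n \<noteq> 0"
  shows "1 \<le> norm (of_int m *\<^sub>R l1 + of_int n *\<^sub>R l2)"
proof -
  have "(norm (of_int m *\<^sub>R l1 + of_int n *\<^sub>R l2))\<^sup>2 = of_int (m * m + n * n - m * n)"
  proof -
    have "of_int m * (1/2) + of_int n * (1/2) = real_of_int m / 2 + real_of_int n / 2"
      "of_int m * (- sqrt 3 / 2) + of_int n * (sqrt 3 / 2) = sqrt 3 * (real_of_int n / 2 - real_of_int m / 2)"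
      by (simp_all add: algebra_simps)
    then show ?thesis
      unfolding norm_real2_sq
      using hexagonal_identities(3)[of "sqrt 3" "real_of_int m / 2" "real_of_int n / 2"]
      by (simp add: power2_eq_square)
  qed
  moreover have "1 \<le> m * m + n * n - m * n"
  proof -
    have "2 * (m * m + n * n - m * n) = m * m + n * n + (m - n) * (m - n)" by (simp add: algebra_simps)
    moreover have "0 < m * m \<or> 0 < n * n" using assms by (auto simp: zero_less_mult_iff)
    moreover have "0 \<le> m * m" "0 \<le> n * n" "0 \<le> (m - n) * (m - n)" by auto
    ultimately have "0 < 2 * (m * m + n * n - m * n)" by linarith
    then show ?thesis by simp
  qed
  moreover have "of_int 1 \<le> (of_int (m * m + n * n - m * n) :: real)"
    using calculation(2) by (simp only: of_int_le_iff)
  ultimately have "1\<^sup>2 \<le> (norm (of_int m *\<^sub>R l1 + of_int n *\<^sub>R l2))\<^sup>2" by simp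
  then show ?thesis by (rule power2_le_imp_le) simp
qed

lemma inclusion_1: "inclusion D0 1 = (+) (- ((1/3) *\<^sub>R l1)) ` D0"
  by (simp add: inclusion_def)

lemma inclusion_Suc: "1 \<le> j \<Longrightarrow> inclusion D0 (Suc j) = (*v) rotR ` inclusion D0 j"
  by (cases j) (simp_all add: inclusion_def image_comp)

lemma rotR_image_translation: "(*v) rotR ` ((+) v ` A) = (+) (rotR *v v) ` ((*v) rotR ` A)"
  by (simp add: image_image linear_add[OF linear_rotR])

lemma frontier_subset_closure: "frontier S \<subseteq> closure S"
  by (auto simp: frontier_def)

lemma frontier_image_isometry:
  fixes F :: "real^2 \<Rightarrow> real^2"
  assumes "open D" "linear F" "inj F" "surj F"
  shows "open (F ` D)" "closure (F ` D) = F ` closure D" "frontier (F ` D) = F ` frontier D"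
proof -
  show 1: "open (F ` D)" using open_surjective_linear_image[OF assms(1,2,4)] .
  show 2: "closure (F ` D) = F ` closure D" using closure_injective_linear_image[OF assms(2,3)] by simp
  show "frontier (F ` D) = F ` frontier D"
    unfolding frontier_def 2 using assms(1,3) 1 by (simp add: interior_open image_set_diff)
qed

lemma inj_rotR: "inj ((*v) rotR)" and surj_rotR: "surj ((*v) rotR)"
proof -
  show i: "inj ((*v) rotR)"
    unfolding linear_injective_0[OF linear_rotR] using norm_rotR by (metis norm_eq_zero)
  show "surj ((*v) rotR)" by (rule linear_injective_imp_surjective[OF linear_rotR i]) (rule refl)
qed

section \<open>The six inclusions and their boundaries\<close>

locale crystal = dual_lattice l1 l2 k1 k2 e for k1 k2 e +
  fixes D0 :: "(real^2) set"
  assumes D0: "open D0" "0 \<in> D0" "piecewise_smooth_boundary D0" "bounded D0" "diameter D0 < 1/4"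
    and D0_rot: "(\<lambda>x. (rotR ** rotR) *v x) ` D0 = D0"
begin

lemma t_eq: "t1 = tl1" "t2 = tl2"
  by (simp_all add: t1_def t2_def tl1_def tl2_def)

text \<open>Two shapes suffice: \<open>D0\<close> is invariant under the double rotation, so the odd
  inclusions are translates of \<open>D0\<close> and the even ones translates of its single
  rotation.\<close>

definition base :: "nat \<Rightarrow> (real^2) set" where "base b = (if b = 1 then D0 else (*v) rotR ` D0)"

definition center :: "nat \<Rightarrow> real^2" where "center b = (if b = 1 then - ((1/3) *\<^sub>R l1) else (1/3) *\<^sub>R l2)"

lemma rotR_base_2: "(*v) rotR ` ((*v) rotR ` D0) = D0"
  using D0_rot by (simp add: image_image matrix_vector_mul_assoc)

lemma inclusion_centers:
  "inclusion D0 1 = (+) ((1/3) *\<^sub>R (- l1)) ` base 1"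
  "inclusion D0 2 = (+) ((1/3) *\<^sub>R l2) ` base 2"
  "inclusion D0 3 = (+) ((1/3) *\<^sub>R (l1 + l2)) ` base 1"
  "inclusion D0 4 = (+) ((1/3) *\<^sub>R l1) ` base 2"
  "inclusion D0 5 = (+) ((1/3) *\<^sub>R (- l2)) ` base 1"
  "inclusion D0 6 = (+) ((1/3) *\<^sub>R (- (l1 + l2))) ` base 2"
proof -
  have b: "(*v) rotR ` base 1 = base 2" "(*v) rotR ` base 2 = base 1"
    by (simp_all add: base_def rotR_base_2)
  have r: "rotR *v (- x) = - (rotR *v x)" "rotR *v (x + y) = rotR *v x + rotR *v y"
    "rotR *v (c *\<^sub>R x) = c *\<^sub>R (rotR *v x)" for x y c
    by (simp_all add: linear_neg[OF linear_rotR] linear_add[OF linear_rotR] linear_cmul[OF linear_rotR])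
  show 1: "inclusion D0 1 = (+) ((1/3) *\<^sub>R (- l1)) ` base 1" by (simp add: inclusion_1[simplified] base_def)
  show 2: "inclusion D0 2 = (+) ((1/3) *\<^sub>R l2) ` base 2"
    using inclusion_Suc[of 1 D0] unfolding 1 rotR_image_translation b r rotR_l by (simp add: numeral_2_eq_2)
  show 3: "inclusion D0 3 = (+) ((1/3) *\<^sub>R (l1 + l2)) ` base 1"
    using inclusion_Suc[of 2 D0] unfolding 2 rotR_image_translation b r rotR_l by (simp add: eval_nat_numeral)
  show 4: "inclusion D0 4 = (+) ((1/3) *\<^sub>R l1) ` base 2"
    using inclusion_Suc[of 3 D0] unfolding 3 rotR_image_translation b r rotR_l by (simp add: eval_nat_numeral)
  show 5: "inclusion D0 5 = (+) ((1/3) *\<^sub>R (- l2)) ` base 1"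
    using inclusion_Suc[of 4 D0] unfolding 4 rotR_image_translation b r rotR_l by (simp add: eval_nat_numeral)
  show 6: "inclusion D0 6 = (+) ((1/3) *\<^sub>R (- (l1 + l2))) ` base 2"
    using inclusion_Suc[of 5 D0] unfolding 5 rotR_image_translation b r rotR_l by (simp add: eval_nat_numeral)
qed

text \<open>Three times the centre of inclusion \<open>b + 2 * s\<close>, in coordinates with
  respect to \<open>l1\<close>, \<open>l2\<close>. The six values are distinct integer vectors, so
  separation of centres reduces to the shortest lattice vector.\<close>

definition center_idx :: "nat \<Rightarrow> nat \<Rightarrow> int \<times> int" where
  "center_idx b s = (if b = 1 then (if s = 0 then (-1, 0) else if s = 1 then (1, 1) else (0, -1))
     else (if s = 0 then (0, 1) else if s = 1 then (1, 0) else (-1, -1)))"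

lemma center_shift:
  assumes "b \<in> {1, 2}" "s < 3"
  shows "shift b s + center b = (1/3) *\<^sub>R (of_int (fst (center_idx b s)) *\<^sub>R l1 + of_int (snd (center_idx b s)) *\<^sub>R l2)"
proof -
  have "s = 0 \<or> s = 1 \<or> s = 2" using assms(2) by auto
  with assms(1) show ?thesis
    by (auto simp: shift_def center_def center_idx_def t1_def t2_def vec_eq_iff forall_2 field_simps)
qed

lemma inclusion_eq:
  assumes "b \<in> {1, 2}" "s < 3"
  shows "inclusion D0 (b + 2 * s) = (+) (shift b s + center b) ` base b"
proof -
  have eq: ?thesis
    if "b + 2 * s = j" "of_int (fst (center_idx b s)) *\<^sub>R l1 + of_int (snd (center_idx b s)) *\<^sub>R l2 = v"
      "inclusion D0 j = (+) ((1/3) *\<^sub>R v) ` base b" for j v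
    unfolding center_shift[OF assms] that ..
  have "s = 0 \<or> s = 1 \<or> s = 2" using assms(2) by auto
  with assms(1) consider "b = 1" "s = 0" | "b = 2" "s = 0" | "b = 1" "s = 1" | "b = 2" "s = 1" | "b = 1" "s = 2" | "b = 2" "s = 2" by blast
  then show ?thesis
  proof cases
    case 1
    show ?thesis by (rule eq[of 1 "- l1"]) (use 1 inclusion_centers(1) in \<open>simp_all add: center_idx_def\<close>)
  next
    case 2
    show ?thesis by (rule eq[of 2 "l2"]) (use 2 inclusion_centers(2) in \<open>simp_all add: center_idx_def\<close>)
  next
    case 3
    show ?thesis by (rule eq[of 3 "l1 + l2"]) (use 3 inclusion_centers(3) in \<open>simp_all add: center_idx_def\<close>)
  next
    case 4
    show ?thesis by (rule eq[of 4 "l1"]) (use 4 inclusion_centers(4) in \<open>simp_all add: center_idx_def\<close>)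
  next
    case 5
    show ?thesis by (rule eq[of 5 "- l2"]) (use 5 inclusion_centers(5) in \<open>simp_all add: center_idx_def\<close>)
  next
    case 6
    show ?thesis by (rule eq[of 6 "- (l1 + l2)"]) (use 6 inclusion_centers(6) in \<open>simp_all add: center_idx_def\<close>)
  qed
qed

lemma base_props:
  assumes "b \<in> {1, 2}"
  shows "open (base b)" "tame_curve (frontier (base b))" "closure (base b) \<subseteq> cball 0 (4/25)"
proof -
  have small: "norm x \<le> 4/25" if x: "x \<in> D0" for x
  proof -
    have "rotR *v (rotR *v x) \<in> D0" using x rotR_base_2 by blast
    then have "dist (rotR *v (rotR *v x)) x \<le> diameter D0" by (rule diameter_bounded_bound[OF D0(4) _ x])
    then have "sqrt 3 * norm x < 1/4" using D0(5) by (simp add: dist_norm norm_rotR_sq_diff)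
    \<comment> \<open>25/16 is a rational lower bound for \<open>sqrt 3\<close> that turns the
      diameter 1/4 into the radius 4/25. Two such radii add up to 8/25, which is still below the
      distance 1/3 of neighbouring centres.\<close>
    moreover have "25/16 * norm x \<le> sqrt 3 * norm x"
      by (intro mult_right_mono real_le_rsqrt) (auto simp: power2_eq_square)
    ultimately show ?thesis by simp
  qed
  have tame: "tame_curve (frontier D0)"
    using D0(3) smooth_arc_tame_arc unfolding piecewise_smooth_boundary_def tame_curve_def by metis
  note F = frontier_image_isometry[OF D0(1) linear_rotR inj_rotR surj_rotR]
  show "open (base b)" using D0(1) F(1) by (simp add: base_def)
  have "tame_curve ((*v) rotR ` frontier D0)"
    using tame_curve_isometry[OF tame linear_rotR norm_rotR, of 0] by simp
  with tame show "tame_curve (frontier (base b))" by (simp add: base_def F(3))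
  have "base b \<subseteq> cball 0 (4/25)" using small by (auto simp: base_def norm_rotR)
  then show "closure (base b) \<subseteq> cball 0 (4/25)" by (rule closure_minimal) simp
qed

definition bd :: "nat \<Rightarrow> (real^2) set" where "bd b = frontier (inclusion D0 b)"

definition bds :: "nat \<Rightarrow> nat \<Rightarrow> (real^2) set" where "bds b s = frontier (inclusion D0 (b + 2 * s))"

lemma shift_0 [simp]: "shift b 0 = 0"
  by (simp add: shift_def)

lemma bd_eq: "b \<in> {1, 2} \<Longrightarrow> bd b = (+) (center b) ` frontier (base b)"
  using inclusion_eq[of b 0] by (simp add: bd_def frontier_translation)

lemma bds_eq: "b \<in> {1, 2} \<Longrightarrow> s < 3 \<Longrightarrow> bds b s = (+) (shift b s) ` bd b"
proof -
  assume bs: "b \<in> {1, 2}" "s < 3"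
  have "(+) (shift b s + center b) = (\<lambda>x. shift b s + (center b + x))" by (rule ext) (simp only: add.assoc)
  then show ?thesis
    unfolding bds_def bd_eq[OF bs(1)] inclusion_eq[OF bs] frontier_translation image_image by simp
qed

lemma bds_0: "bds b 0 = bd b"
  by (simp add: bds_def bd_def)

lemma closure_inclusion:
  assumes "b \<in> {1, 2}" "s < 3"
  shows "closure (inclusion D0 (b + 2 * s)) \<subseteq> cball (shift b s + center b) (4/25)"
proof -
  have "closure (inclusion D0 (b + 2 * s)) = (+) (shift b s + center b) ` closure (base b)"
    unfolding inclusion_eq[OF assms] by (rule closure_translation)
  also have "\<dots> \<subseteq> (+) (shift b s + center b) ` cball 0 (4/25)"
    by (intro image_mono base_props assms)
  finally show ?thesis by (auto simp: dist_norm)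
qed

lemma open_inclusion: "b \<in> {1, 2} \<Longrightarrow> s < 3 \<Longrightarrow> open (inclusion D0 (b + 2 * s))"
  unfolding inclusion_eq by (intro open_translation base_props) auto

lemma center_idx_inj:
  assumes "b \<in> {1, 2}" "s < 3" "b' \<in> {1, 2}" "s' < 3" "center_idx b s = center_idx b' s'"
  shows "b = b'" "s = s'"
proof -
  have "s = 0 \<or> s = 1 \<or> s = 2" "s' = 0 \<or> s' = 1 \<or> s' = 2" using assms(2,4) by auto
  with assms(1,3,5) show "b = b'" "s = s'" by (auto simp: center_idx_def)
qed

text \<open>Distinct centres differ by a third of a nonzero lattice vector, hence by at least 1/3,
  more than the two radii 4/25 together.\<close>

lemma closure_inclusion_disjoint:
  assumes "b \<in> {1, 2}" "s < 3" "b' \<in> {1, 2}" "s' < 3" "(b, s) \<noteq> (b', s')"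
  shows "closure (inclusion D0 (b + 2 * s)) \<inter> closure (inclusion D0 (b' + 2 * s')) = {}"
proof (rule ccontr)
  assume "\<not> ?thesis"
  then obtain x where "x \<in> cball (shift b s + center b) (4/25)" "x \<in> cball (shift b' s' + center b') (4/25)"
    using closure_inclusion assms by blast
  then have "dist (shift b s + center b) (shift b' s' + center b') \<le> 4/25 + 4/25"
    using dist_triangle_le[of "shift b s + center b" x "shift b' s' + center b'" "4/25 + 4/25"]
    by (simp add: dist_commute)
  then have le: "norm ((shift b s + center b) - (shift b' s' + center b')) \<le> 8/25" by (simp add: dist_norm)
  define m n where "m = fst (center_idx b s) - fst (center_idx b' s')" and "n = snd (center_idx b s) - snd (center_idx b' s')"
  have "center_idx b s \<noteq> center_idx b' s'" using center_idx_inj assms by blast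
  then have mn: "m \<noteq> 0 \<or> n \<noteq> 0" by (auto simp: m_def n_def prod_eq_iff)
  have "(shift b s + center b) - (shift b' s' + center b') = (1/3) *\<^sub>R (of_int m *\<^sub>R l1 + of_int n *\<^sub>R l2)"
    unfolding center_shift[OF assms(1,2)] center_shift[OF assms(3,4)]
    by (simp add: m_def n_def vec_eq_iff forall_2 field_simps)
  then have "norm ((shift b s + center b) - (shift b' s' + center b')) = (1/3) * norm (of_int m *\<^sub>R l1 + of_int n *\<^sub>R l2)"
    by simp
  with norm_lattice_ge_1[OF mn] le show False by simp
qed

lemma bds_disjoint:
  assumes "b \<in> {1, 2}" "s < 3" "b' \<in> {1, 2}" "s' < 3" "(b, s) \<noteq> (b', s')"
  shows "bds b s \<inter> bds b' s' = {}"
  using closure_inclusion_disjoint[OF assms] frontier_subset_closure unfolding bds_def by blast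

definition Idx :: "(nat \<times> nat) set" where "Idx = {1, 2} \<times> {..<3}"

lemma Idx_iff: "(b, s) \<in> Idx \<longleftrightarrow> b \<in> {1, 2} \<and> s < 3"
  by (auto simp: Idx_def)

lemma finite_Idx: "finite Idx"
  by (simp add: Idx_def)

lemma honeycomb_Idx: "honeycomb D0 = (\<Union>(b, s)\<in>Idx. inclusion D0 (b + 2 * s))"
proof -
  have "{1..6::nat} = (\<lambda>(b, s). b + 2 * s) ` Idx"
    by (auto simp: Idx_def image_def eval_nat_numeral atLeastAtMostSuc_conv lessThan_Suc)
  then show ?thesis unfolding honeycomb_def by auto
qed

lemma open_honeycomb: "open (honeycomb D0)"
  unfolding honeycomb_Idx by (intro open_UN) (auto simp: Idx_iff open_inclusion)

lemma frontier_honeycomb: "frontier (honeycomb D0) = (\<Union>(b, s)\<in>Idx. bds b s)"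
proof -
  have "frontier (\<Union>p\<in>Idx. inclusion D0 (fst p + 2 * snd p)) = (\<Union>p\<in>Idx. frontier (inclusion D0 (fst p + 2 * snd p)))"
  proof (rule frontier_UN_open[OF finite_Idx])
    fix p assume "p \<in> Idx"
    then show "open (inclusion D0 (fst p + 2 * snd p))" by (cases p) (auto simp: Idx_iff open_inclusion)
  next
    fix p q assume pq: "p \<in> Idx" "q \<in> Idx" "p \<noteq> q"
    obtain b s b' s' where e: "p = (b, s)" "q = (b', s')" by (cases p, cases q)
    have "b \<in> {1, 2}" "s < 3" "b' \<in> {1, 2}" "s' < 3" "(b, s) \<noteq> (b', s')"
      using pq unfolding e Idx_iff by blast+
    then show "closure (inclusion D0 (fst p + 2 * snd p)) \<inter> closure (inclusion D0 (fst q + 2 * snd q)) = {}"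
      unfolding e fst_conv snd_conv by (rule closure_inclusion_disjoint)
  qed
  then show ?thesis unfolding honeycomb_Idx bds_def by (simp add: case_prod_beta')
qed

lemma frontier_honeycomb_iff: "x \<in> frontier (honeycomb D0) \<longleftrightarrow> (\<exists>b\<in>{1, 2}. \<exists>s<3. x \<in> bds b s)"
  unfolding frontier_honeycomb Idx_def by auto

lemma frontier_honeycomb_red: "frontier (honeycomb_red D0) = bd 1 \<union> bd 2"
proof -
  have "frontier (\<Union>b\<in>{1, 2}. inclusion D0 b) = (\<Union>b\<in>{1, 2}. frontier (inclusion D0 b))"
  proof (rule frontier_UN_open)
    fix b b' :: nat assume "b \<in> {1, 2}" "b' \<in> {1, 2}" "b \<noteq> b'"
    then show "closure (inclusion D0 b) \<inter> closure (inclusion D0 b') = {}"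
      using closure_inclusion_disjoint[of b 0 b' 0] by auto
  next
    fix b :: nat assume "b \<in> {1, 2}"
    then show "open (inclusion D0 b)" using open_inclusion[of b 0] by auto
  qed simp
  then show ?thesis by (simp add: honeycomb_red_def bd_def)
qed

abbreviation "bdry \<equiv> frontier (honeycomb D0)"

lemma tame_curve_bds: "b \<in> {1, 2} \<Longrightarrow> s < 3 \<Longrightarrow> tame_curve (bds b s)"
  unfolding bds_eq bd_eq image_image
  using tame_curve_isometry[OF base_props(2) linear_id, of b "shift b s + center b"] by (simp add: add.assoc)

lemma tame_curve_bdry: "tame_curve bdry"
  unfolding frontier_honeycomb by (intro tame_curve_UN finite_Idx) (auto simp: Idx_iff tame_curve_bds)

lemma bounded_honeycomb: "bounded (closure (honeycomb D0))"
proof -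
  have "bounded (inclusion D0 (b + 2 * s))" if "(b, s) \<in> Idx" for b s
    using closure_inclusion[of b s] closure_subset[of "inclusion D0 (b + 2 * s)"] that
    by (meson Idx_iff bounded_cball bounded_subset)
  then have "bounded (honeycomb D0)" unfolding honeycomb_Idx using finite_Idx by auto
  then show ?thesis by (rule bounded_closure)
qed

lemma compact_bdry: "compact bdry"
  by (simp add: compact_eq_bounded_closed bounded_subset[OF bounded_honeycomb frontier_subset_closure])

lemma upper_regular_bdry: "upper_regular bdry"
  by (rule tame_curve_upper_regular[OF tame_curve_bdry])

text \<open>The centres have norm 1/3, and 1/3 + 4/25 < 1/2. Two boundary points are therefore less
  than 1 apart, too close to differ by a nonzero period; the kernel on the boundary is singular on
  the diagonal alone.\<close>

lemma norm_bdry: "x \<in> bdry \<Longrightarrow> norm x < 1/2"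
proof -
  assume "x \<in> bdry"
  then obtain b s where bs: "b \<in> {1, 2}" "s < 3" "x \<in> bds b s" unfolding frontier_honeycomb_iff by blast
  then have "x \<in> cball (shift b s + center b) (4/25)"
    using closure_inclusion[OF bs(1,2)] frontier_subset_closure unfolding bds_def by blast
  moreover have "norm (shift b s + center b) \<le> 1/3"
  proof -
    have "norm (of_int (fst (center_idx b s)) *\<^sub>R l1 + of_int (snd (center_idx b s)) *\<^sub>R l2) = 1"
    proof -
      have "(norm (of_int (fst (center_idx b s)) *\<^sub>R l1 + of_int (snd (center_idx b s)) *\<^sub>R l2))\<^sup>2 = 1"
        unfolding norm_real2_sq center_idx_def by (simp add: power2_eq_square field_simps)
      then show ?thesis by (simp add: power2_eq_1_iff) (smt (verit) norm_ge_zero)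
    qed
    then show ?thesis unfolding center_shift[OF bs(1,2)] by simp
  qed
  ultimately show ?thesis
    using norm_triangle_ineq2[of x "shift b s + center b"] by (simp add: dist_norm norm_minus_commute)
qed

lemma off_lattice_bdry: "x \<in> bdry \<Longrightarrow> y \<in> bdry \<Longrightarrow> x \<noteq> y \<Longrightarrow> off_lattice (x - y)"
proof (rule ccontr)
  assume xy: "x \<in> bdry" "y \<in> bdry" "x \<noteq> y" and "\<not> off_lattice (x - y)"
  then obtain m n :: int where mn: "x - y = of_int m *\<^sub>R l1 + of_int n *\<^sub>R l2"
    by (auto simp: off_lattice_iff lattice_def)
  have "m \<noteq> 0 \<or> n \<noteq> 0" using mn xy(3) by auto
  then have "1 \<le> norm (x - y)" unfolding mn by (rule norm_lattice_ge_1)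
  moreover have "norm (x - y) \<le> norm x + norm y" by (rule norm_triangle_ineq4)
  ultimately show False using norm_bdry[OF xy(1)] norm_bdry[OF xy(2)] by linarith
qed

end

section \<open>Layer potentials\<close>

lemma L2_subset: "f \<in> L2 S \<Longrightarrow> T \<subseteq> S \<Longrightarrow> T \<in> sets borel \<Longrightarrow> f \<in> L2 T"
  unfolding L2_def
  using set_borel_measurable_subset[of arclength S f T] set_integrable_subset[of arclength S _ T]
  by (auto simp: sets_arclength)

lemma L2_translation:
  assumes "f \<in> L2 ((+) c ` A)" shows "(\<lambda>y. f (c + y)) \<in> L2 A"
proof -
  have m: "set_borel_measurable arclength ((+) c ` A) f"
    and i: "set_integrable arclength ((+) c ` A) (\<lambda>y. (norm (f y))\<^sup>2)"
    using assms by (auto simp: L2_def)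
  have "set_borel_measurable arclength ((+) c ` A) (\<lambda>y. (norm (f y))\<^sup>2)"
    using i unfolding set_integrable_def set_borel_measurable_def by (rule borel_measurable_integrable)
  from set_integral_translation(2)[OF this i] set_borel_measurable_translation[OF m]
  show ?thesis by (simp add: L2_def)
qed

lemma L2_extend:
  assumes "f \<in> L2 T" "T \<subseteq> S"
  shows "(\<lambda>y. indicator T y * f y) \<in> L2 S"
proof -
  have "indicator S y *\<^sub>R (indicator T y * f y) = indicator T y *\<^sub>R f y" for y
    using assms(2) by (auto simp: indicator_def)
  moreover have "indicator S y *\<^sub>R (norm (indicator T y * f y))\<^sup>2 = indicator T y *\<^sub>R (norm (f y))\<^sup>2" for y
    using assms(2) by (auto simp: indicator_def)
  ultimately show ?thesis
    using assms(1) by (simp add: L2_def set_borel_measurable_def set_integrable_def)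
qed

lemma L2_cmult: "f \<in> L2 S \<Longrightarrow> (\<lambda>y. c * f y) \<in> L2 S"
proof -
  assume f: "f \<in> L2 S"
  have "(\<lambda>y. c * (indicator S y *\<^sub>R f y)) \<in> borel_measurable arclength"
    using f unfolding L2_def set_borel_measurable_def by (intro borel_measurable_times) auto
  then have "set_borel_measurable arclength S (\<lambda>y. c * f y)"
    unfolding set_borel_measurable_def by (simp only: mult_scaleR_right)
  moreover have "set_integrable arclength S (\<lambda>y. (norm c)\<^sup>2 * (norm (f y))\<^sup>2)"
    using f by (intro set_integrable_mult_right) (simp add: L2_def)
  ultimately show ?thesis by (simp add: L2_def norm_mult power_mult_distrib)
qed

lemma L2_add: "f \<in> L2 S \<Longrightarrow> g \<in> L2 S \<Longrightarrow> (\<lambda>y. f y + g y) \<in> L2 S"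
proof -
  assume fg: "f \<in> L2 S" "g \<in> L2 S"
  have "(\<lambda>y. indicator S y *\<^sub>R f y + indicator S y *\<^sub>R g y) \<in> borel_measurable arclength"
    using fg unfolding L2_def set_borel_measurable_def by (intro borel_measurable_add) auto
  then have m: "(\<lambda>y. indicator S y *\<^sub>R (f y + g y)) \<in> borel_measurable arclength"
    by (simp only: scaleR_add_right)
  have "set_integrable arclength S (\<lambda>y. 2 * (norm (f y))\<^sup>2 + 2 * (norm (g y))\<^sup>2)"
    using fg by (intro set_integral_add(1) set_integrable_mult_right) (auto simp: L2_def)
  then have "set_integrable arclength S (\<lambda>y. (norm (f y + g y))\<^sup>2)"
  proof (rule set_integrable_bound)
    have "(\<lambda>y. (norm (indicator S y *\<^sub>R (f y + g y)))\<^sup>2) \<in> borel_measurable arclength"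
      using m by measurable
    moreover have "(norm (indicator S y *\<^sub>R (f y + g y)))\<^sup>2 = indicator S y *\<^sub>R (norm (f y + g y))\<^sup>2" for y
      by (auto simp: indicator_def)
    ultimately show "set_borel_measurable arclength S (\<lambda>y. (norm (f y + g y))\<^sup>2)"
      unfolding set_borel_measurable_def by (simp only:)
    have "(norm (f y + g y))\<^sup>2 \<le> 2 * (norm (f y))\<^sup>2 + 2 * (norm (g y))\<^sup>2" for y
    proof -
      have "(norm (f y + g y))\<^sup>2 \<le> (norm (f y) + norm (g y))\<^sup>2" by (intro power_mono norm_triangle_ineq) auto
      also have "\<dots> \<le> 2 * (norm (f y))\<^sup>2 + 2 * (norm (g y))\<^sup>2"
        using sum_squares_bound[of "norm (f y)" "norm (g y)"] by (simp add: power2_sum)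
      finally show ?thesis .
    qed
    then show "AE y in arclength. y \<in> S \<longrightarrow> norm ((norm (f y + g y))\<^sup>2) \<le> norm (2 * (norm (f y))\<^sup>2 + 2 * (norm (g y))\<^sup>2)"
      by (simp add: add_nonneg_nonneg)
  qed
  with m show ?thesis by (simp add: L2_def set_borel_measurable_def)
qed

lemma L2_zero: "(\<lambda>y. 0) \<in> L2 S"
  by (simp add: L2_def set_borel_measurable_def set_integrable_def)

lemma L2_sum: "(\<And>i. i \<in> I \<Longrightarrow> f i \<in> L2 S) \<Longrightarrow> (\<lambda>y. \<Sum>i\<in>I. f i y) \<in> L2 S"
  by (induction I rule: infinite_finite_induct) (auto intro: L2_zero L2_add)

lemma set_integral_cong_AE_L2:
  fixes f g :: "real^2 \<Rightarrow> complex"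
  assumes "set_borel_measurable arclength S f" "set_borel_measurable arclength S g"
    and "AE y in arclength. y \<in> S \<longrightarrow> f y = g y"
  shows "set_integrable arclength S f \<longleftrightarrow> set_integrable arclength S g"
    and "(LINT y:S|arclength. f y) = (LINT y:S|arclength. g y)"
proof -
  have *: "AE y in arclength. indicator S y *\<^sub>R f y = indicator S y *\<^sub>R g y"
    using assms(3) by eventually_elim (auto simp: indicator_def)
  show "set_integrable arclength S f \<longleftrightarrow> set_integrable arclength S g"
    using integrable_cong_AE[OF assms(1,2)[unfolded set_borel_measurable_def] *] by (simp add: set_integrable_def)
  show "(LINT y:S|arclength. f y) = (LINT y:S|arclength. g y)"
    using integral_cong_AE[OF assms(1,2)[unfolded set_borel_measurable_def] *] by (simp add: set_lebesgue_integral_def)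
qed

text \<open>
  \<^const>\<open>arclength\<close> lives on the Borel sets, so equality almost everywhere does not transfer
  measurability, but equality off a countable set does.
\<close>

lemma set_integral_countable_difference:
  fixes f g :: "real^2 \<Rightarrow> complex"
  assumes "countable N" "\<And>y. y \<in> S \<Longrightarrow> y \<notin> N \<Longrightarrow> f y = g y"
  shows "set_integrable arclength S f \<longleftrightarrow> set_integrable arclength S g"
    and "(LINT y:S|arclength. f y) = (LINT y:S|arclength. g y)"
proof -
  have eq: "indicator S y *\<^sub>R f y = indicator S y *\<^sub>R g y" if "y \<notin> N" for y
    using assms(2)[of y] that by (auto simp: indicator_def)
  show "set_integrable arclength S f \<longleftrightarrow> set_integrable arclength S g"
    unfolding set_integrable_def
    by (rule integrable_discrete_difference[where X = N])
      (use assms(1) eq in \<open>auto simp: emeasure_arclength_singleton sets_arclength\<close>)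
  show "(LINT y:S|arclength. f y) = (LINT y:S|arclength. g y)"
    unfolding set_lebesgue_integral_def
    by (rule integral_discrete_difference[where X = N])
      (use assms(1) eq in \<open>auto simp: emeasure_arclength_singleton sets_arclength\<close>)
qed

lemma set_borel_measurable_mult_L2:
  assumes "f \<in> L2 S" "g \<in> L2 S"
  shows "set_borel_measurable arclength S (\<lambda>y. f y * g y)"
proof -
  have "(\<lambda>y. (indicator S y *\<^sub>R f y) * (indicator S y *\<^sub>R g y)) \<in> borel_measurable arclength"
    using assms unfolding L2_def set_borel_measurable_def by (intro borel_measurable_times) auto
  moreover have "(indicator S y *\<^sub>R f y) * (indicator S y *\<^sub>R g y) = indicator S y *\<^sub>R (f y * g y)" for y
    by (auto simp: indicator_def)
  ultimately show ?thesis unfolding set_borel_measurable_def by (simp only:)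
qed

text \<open>Dominated convergence after the substitution of 1/t for \<open>\<delta>\<close>. If
  \<open>x - y\<close> is not in the closed set \<open>P\<close>, it has positive distance from
  \<open>P\<close>, so \<open>y\<close> is eventually kept; the remaining points form a countable
  null set.\<close>

lemma principal_value_tendsto:
  fixes f :: "real^2 \<Rightarrow> complex"
  assumes f: "set_integrable arclength S f" and S: "S \<in> sets borel"
    and P: "closed P" "countable P"
  shows "((\<lambda>\<delta>. LINT y:{y \<in> S. \<forall>p\<in>P. \<delta> \<le> norm (x - y - p)}|arclength. f y) \<longlongrightarrow> (LINT y:S|arclength. f y)) (at_right 0)"
  unfolding filterlim_at_right_to_top
proof -
  let ?A = "\<lambda>\<delta>. {y \<in> S. \<forall>p\<in>P. \<delta> \<le> norm (x - y - p)}"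
  have A: "?A \<delta> \<in> sets borel" for \<delta>
  proof -
    have "?A \<delta> = S \<inter> (\<Inter>p\<in>P. {y. \<delta> \<le> norm (x - y - p)})" by auto
    moreover have "closed (\<Inter>p\<in>P. {y. \<delta> \<le> norm (x - y - p)})"
      by (intro closed_INT ballI closed_Collect_le continuous_intros)
    ultimately show ?thesis using S by (simp add: borel_closed)
  qed
  have "((\<lambda>t. LINT y|arclength. indicator (?A (inverse t)) y *\<^sub>R f y) \<longlongrightarrow> (LINT y|arclength. indicator S y *\<^sub>R f y)) at_top"
  proof (rule integral_dominated_convergence_at_top)
    show "(\<lambda>y. indicator S y *\<^sub>R f y) \<in> borel_measurable arclength"
      using f unfolding set_integrable_def by (rule borel_measurable_integrable)
    show "(\<lambda>y. indicator (?A (inverse t)) y *\<^sub>R f y) \<in> borel_measurable arclength" for t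
    proof -
      have "set_integrable arclength (?A (inverse t)) f"
        by (rule set_integrable_subset[OF f]) (use A in \<open>auto simp: sets_arclength\<close>)
      then show ?thesis unfolding set_integrable_def by (rule borel_measurable_integrable)
    qed
    show "integrable arclength (\<lambda>y. norm (indicator S y *\<^sub>R f y))"
      using f unfolding set_integrable_def by (rule integrable_norm)
    show "\<forall>\<^sub>F t in at_top. AE y in arclength. norm (indicator (?A (inverse t)) y *\<^sub>R f y) \<le> norm (indicator S y *\<^sub>R f y)"
      by (intro always_eventually allI AE_I2) (auto simp: indicator_def)
    have "countable ((\<lambda>p. x - p) ` P)" using P(2) by simp
    then have null: "(\<lambda>p. x - p) ` P \<in> null_sets arclength" by (rule countable_null_arclength)
    show "AE y in arclength. ((\<lambda>t. indicator (?A (inverse t)) y *\<^sub>R f y) \<longlongrightarrow> indicator S y *\<^sub>R f y) at_top"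
    proof (rule AE_I'[OF null], clarify)
      fix y assume y: "\<not> ((\<lambda>t. indicator (?A (inverse t)) y *\<^sub>R f y) \<longlongrightarrow> indicator S y *\<^sub>R f y) at_top"
      show "y \<in> (\<lambda>p. x - p) ` P"
      proof (rule ccontr)
        assume n: "y \<notin> (\<lambda>p. x - p) ` P"
        have "x - y \<notin> P"
        proof
          assume "x - y \<in> P"
          then have "x - (x - y) \<in> (\<lambda>p. x - p) ` P" by (rule imageI)
          then show False using n by simp
        qed
        then obtain \<eta> where \<eta>: "0 < \<eta>" "ball (x - y) \<eta> \<inter> P = {}"
          using P(1) by (metis Compl_iff disjoint_eq_subset_Compl inf_commute open_Compl open_contains_ball_eq)
        have "y \<in> ?A (inverse t) \<longleftrightarrow> y \<in> S" if "inverse \<eta> \<le> t" for t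
        proof -
          have "inverse t \<le> inverse (inverse \<eta>)" by (rule le_imp_inverse_le[OF that]) (simp add: \<eta>(1))
          then have "inverse t \<le> \<eta>" by simp
          moreover have "\<eta> \<le> norm (x - y - p)" if "p \<in> P" for p
            using \<eta>(2) that by (auto simp: disjoint_iff dist_norm not_less)
          ultimately show ?thesis by force
        qed
        then have "\<forall>\<^sub>F t in at_top. indicator (?A (inverse t)) y *\<^sub>R f y = indicator S y *\<^sub>R f y"
          unfolding eventually_at_top_linorder by (intro exI[of _ "inverse \<eta>"]) (simp add: indicator_def)
        from y tendsto_eventually[OF this] show False by (rule notE)
      qed
    qed
  qed
  then show "((\<lambda>t. LINT y:?A (inverse t)|arclength. f y) \<longlongrightarrow> (LINT y:S|arclength. f y)) at_top"
    unfolding set_lebesgue_integral_def .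
qed

lemma eventually_at_0_shift:
  fixes x :: "'a::real_normed_vector"
  assumes "\<forall>\<^sub>F z in at 0. P z" shows "\<forall>\<^sub>F y in at x within S. P (x - y)"
proof -
  obtain d where d: "0 < d" "\<And>z. z \<noteq> 0 \<Longrightarrow> norm z < d \<Longrightarrow> P z"
    using assms unfolding eventually_at by auto
  show ?thesis
    unfolding eventually_at using d by (intro exI[of _ d]) (auto simp: dist_norm norm_minus_commute)
qed

context dual_lattice
begin

lemma countable_lattice: "countable (lattice a b)"
proof -
  have "lattice a b = (\<lambda>(m, n). of_int m *\<^sub>R a + of_int n *\<^sub>R b) ` (UNIV :: (int \<times> int) set)"
    by (auto simp: lattice_def)
  then show ?thesis by simp
qed

lemma closed_lattice: "closed (lattice a1 a2)"
proof -
  have "- lattice a1 a2 = {z. off_lattice z}" by (auto simp: off_lattice_iff)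
  then show ?thesis using open_off_lattice by (simp add: closed_def)
qed


text \<open>The finer lattice and the coarser dual lattice are again a dual pair.\<close>

lemma closed_lattice_sublat: "closed (lattice t1 t2)"
proof -
  have "dual_lattice t1 t2 (2 *\<^sub>R k1 - k2) (2 *\<^sub>R k2 - k1)"
    by unfold_locales (simp_all add: t1_def t2_def inner_diff_left inner_add_right dual field_simps)
  then show ?thesis by (rule dual_lattice.closed_lattice)
qed

end

context crystal
begin

section \<open>Characters on the three translates and folding of integrals\<close>

definition classes :: "(int \<times> int) set" where "classes = {(1, 0), (0, 1), (0, 0)}"

definition alpha :: "int \<times> int \<Rightarrow> real^2" where "alpha j = dvec j + e"

lemma finite_classes: "finite classes"
  by (simp add: classes_def)

text \<open>One of the two orthogonality relations of the three by three character table: the common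
  vector \<open>e\<close> cancels, and distinct classes differ by an index outside
  \<open>sublat\<close>.\<close>

lemma orthogonality_shift:
  assumes "i \<in> classes" "j \<in> classes"
  shows "(\<Sum>s<3. cis (alpha i \<bullet> shift b s) * cis (- (alpha j \<bullet> shift b s))) = (if i = j then 3 else 0)"
proof -
  have "(\<Sum>s<3. cis (alpha i \<bullet> shift b s) * cis (- (alpha j \<bullet> shift b s))) = (\<Sum>s<3. cis (dvec (i - j) \<bullet> shift b s))"
    by (intro sum.cong refl) (simp add: cis_mult alpha_def dvec_diff inner_add_left inner_diff_left)
  also have "\<dots> = (if i - j \<in> sublat then 3 else 0)" by (rule sum_cis_shift)
  also have "i - j \<in> sublat \<longleftrightarrow> i = j" using assms unfolding classes_def by (elim insertE emptyE) (simp_all add: sublat_def)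
  finally show ?thesis .
qed

text \<open>The dual relation. Here \<open>e\<close> leaves a unimodular factor, which is 1 when
  \<open>s = s'\<close>; otherwise the two phases differ modulo 3 and the sum vanishes.\<close>

lemma orthogonality_classes:
  assumes "s < 3" "s' < 3"
  shows "(\<Sum>j\<in>classes. cis (alpha j \<bullet> shift b s) * cis (- (alpha j \<bullet> shift b s'))) = (if s = s' then 3 else 0)"
proof -
  define w where "w = phase b s - phase b s'"
  have "cis (alpha j \<bullet> shift b s) * cis (- (alpha j \<bullet> shift b s'))
      = cis (e \<bullet> (shift b s - shift b s')) * cis (2 * pi / 3 * of_int ((fst j - snd j) * w))" for j
  proof -
    have "cis (alpha j \<bullet> shift b s) * cis (- (alpha j \<bullet> shift b s'))
      = cis (e \<bullet> (shift b s - shift b s')) * (cis (dvec j \<bullet> shift b s) * cnj (cis (dvec j \<bullet> shift b s')))"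
      unfolding cis_cnj by (simp add: cis_mult alpha_def inner_add_left inner_diff_right algebra_simps)
    also have "cis (dvec j \<bullet> shift b s) * cnj (cis (dvec j \<bullet> shift b s')) = cis (2 * pi / 3 * of_int ((fst j - snd j) * w))"
      unfolding cis_dvec_shift[OF assms(1)] cis_dvec_shift[OF assms(2)] cis_cnj cis_mult w_def
      by (rule arg_cong[where f = cis]) (simp add: algebra_simps)
    finally show ?thesis .
  qed
  then have "(\<Sum>j\<in>classes. cis (alpha j \<bullet> shift b s) * cis (- (alpha j \<bullet> shift b s')))
    = cis (e \<bullet> (shift b s - shift b s')) * (\<Sum>j\<in>classes. cis (2 * pi / 3 * of_int ((fst j - snd j) * w)))"
    by (simp add: sum_distrib_left)
  also have "(\<Sum>j\<in>classes. cis (2 * pi / 3 * of_int ((fst j - snd j) * w))) = (if 3 dvd w then 3 else 0)"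
    unfolding cube_root_orthogonality[symmetric] by (simp add: classes_def add_ac)
  also have "3 dvd w \<longleftrightarrow> s = s'"
  proof -
    have "s = 0 \<or> s = 1 \<or> s = 2" "s' = 0 \<or> s' = 1 \<or> s' = 2" using assms by auto
    then show ?thesis unfolding w_def phase_def by (cases "b = 1"; elim disjE) simp_all
  qed
  finally show ?thesis by auto
qed

lemma sets_bds: "bds b s \<in> sets borel" and sets_bd: "bd b \<in> sets borel" and sets_bdry: "bdry \<in> sets borel"
  by (simp_all add: bds_def bd_def borel_closed)

lemma bds_subset: "b \<in> {1, 2} \<Longrightarrow> s < 3 \<Longrightarrow> bds b s \<subseteq> bdry"
  using frontier_honeycomb_iff by blast

lemma bd_subset: "b \<in> {1, 2} \<Longrightarrow> bd b \<subseteq> bdry"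
  using bds_subset[of b 0] by (simp add: bds_0)

lemma shift_mem_bds: "b \<in> {1, 2} \<Longrightarrow> s < 3 \<Longrightarrow> y \<in> bd b \<Longrightarrow> shift b s + y \<in> bds b s"
  by (simp add: bds_eq)

lemma L2_shift: "f \<in> L2 bdry \<Longrightarrow> b \<in> {1, 2} \<Longrightarrow> s < 3 \<Longrightarrow> (\<lambda>y. f (shift b s + y)) \<in> L2 (bd b)"
  using L2_subset[OF _ bds_subset sets_bds] by (intro L2_translation) (simp add: bds_eq[symmetric])

text \<open>Membership in the quasi-periodic subspace as a relation between the values of one
  function, without the auxiliary functions on the first two boundary pieces.\<close>

definition quasi_per :: "real^2 \<Rightarrow> (real^2 \<Rightarrow> complex) \<Rightarrow> bool" where
  "quasi_per \<alpha> \<phi> \<longleftrightarrow> (\<forall>b\<in>{1, 2}. \<forall>s<3. AE y in arclength. y \<in> bd b \<longrightarrow> \<phi> (shift b s + y) = cis (\<alpha> \<bullet> shift b s) * \<phi> y)"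

lemma set_integral_bdry:
  fixes f :: "real^2 \<Rightarrow> complex"
  assumes f: "set_integrable arclength bdry f"
  shows "(LINT y:bdry|arclength. f y) = (\<Sum>b\<in>{1, 2}. \<Sum>s<3. LINT y:bd b|arclength. f (shift b s + y))"
proof -
  have sub: "set_integrable arclength (bds b s) f" if "b \<in> {1, 2}" "s < 3" for b s
    by (rule set_integrable_subset[OF f _ bds_subset[OF that]]) (simp add: sets_arclength sets_bds)
  have "(LINT y:bdry|arclength. f y) = (LINT y:(\<Union>p\<in>Idx. bds (fst p) (snd p))|arclength. f y)"
    by (simp add: frontier_honeycomb case_prod_beta')
  also have "\<dots> = (\<Sum>p\<in>Idx. LINT y:bds (fst p) (snd p)|arclength. f y)"
  proof (rule set_integral_finite_Union[OF finite_Idx])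
    show "disjoint_family_on (\<lambda>p. bds (fst p) (snd p)) Idx"
      unfolding disjoint_family_on_def
    proof (intro ballI impI)
      fix p q assume pq: "p \<in> Idx" "q \<in> Idx" "p \<noteq> q"
      obtain b s b' s' where e: "p = (b, s)" "q = (b', s')" by (cases p, cases q)
      have "b \<in> {1, 2}" "s < 3" "b' \<in> {1, 2}" "s' < 3" "(b, s) \<noteq> (b', s')"
        using pq unfolding e Idx_iff by blast+
      then show "bds (fst p) (snd p) \<inter> bds (fst q) (snd q) = {}"
        unfolding e fst_conv snd_conv by (rule bds_disjoint)
    qed
    fix p assume "p \<in> Idx"
    then show "set_integrable arclength (bds (fst p) (snd p)) f" "bds (fst p) (snd p) \<in> sets arclength"
      using sub by (cases p, auto simp: Idx_iff sets_arclength sets_bds)+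
  qed
  also have "\<dots> = (\<Sum>p\<in>Idx. LINT y:bd (fst p)|arclength. f (shift (fst p) (snd p) + y))"
  proof (rule sum.cong[OF refl])
    fix p assume "p \<in> Idx"
    then obtain b s where p: "p = (b, s)" "b \<in> {1, 2}" "s < 3" by (cases p) (simp add: Idx_iff)
    have "set_borel_measurable arclength ((+) (shift b s) ` bd b) f"
      using sub[OF p(2,3)] unfolding bds_eq[OF p(2,3)] set_integrable_def set_borel_measurable_def
      by (rule borel_measurable_integrable)
    from set_integral_translation(1)[OF this]
    show "(LINT y:bds (fst p) (snd p)|arclength. f y) = (LINT y:bd (fst p)|arclength. f (shift (fst p) (snd p) + y))"
      unfolding p(1) fst_conv snd_conv bds_eq[OF p(2,3)] .
  qed
  also have "\<dots> = (\<Sum>b\<in>{1, 2}. \<Sum>s<3. LINT y:bd b|arclength. f (shift b s + y))"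
    unfolding Idx_def sum.cartesian_product by (simp add: case_prod_beta')
  finally show ?thesis .
qed

text \<open>Every boundary piece is moved onto the first or second one. Quasi-periodicity replaces
  the translated density by the density times a phase, and the phases together with the translated
  kernels add up to \<open>Kt\<close>. The exceptional set \<open>N\<close> is where
  \<open>Kt\<close> may be singular.\<close>

lemma reduce_integral:
  assumes K: "K \<in> L2 bdry" and \<phi>: "\<phi> \<in> L2 bdry" "quasi_per \<alpha> \<phi>" and N: "countable N"
    and Kt: "\<And>b y. b \<in> {1, 2} \<Longrightarrow> y \<in> bd b \<Longrightarrow> y \<notin> N \<Longrightarrow> Kt y = (\<Sum>s<3. cis (\<alpha> \<bullet> shift b s) * K (shift b s + y))"
  shows "set_integrable arclength (bd 1 \<union> bd 2) (\<lambda>y. Kt y * \<phi> y)"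
    and "(LINT y:bdry|arclength. K y * \<phi> y) = (LINT y:(bd 1 \<union> bd 2)|arclength. Kt y * \<phi> y)"
proof -
  define h where "h b s y = K (shift b s + y) * (cis (\<alpha> \<bullet> shift b s) * \<phi> y)" for b s y
  have L: "(\<lambda>y. K (shift b s + y)) \<in> L2 (bd b)" "\<phi> \<in> L2 (bd b)" "(\<lambda>y. \<phi> (shift b s + y)) \<in> L2 (bd b)"
    if "b \<in> {1, 2}" "s < 3" for b s
    using L2_shift[OF K that] L2_shift[OF \<phi>(1) that] L2_subset[OF \<phi>(1) bd_subset[OF that(1)] sets_bd] by auto
  have h: "set_integrable arclength (bd b) (h b s)"
    "(LINT y:bd b|arclength. K (shift b s + y) * \<phi> (shift b s + y)) = (LINT y:bd b|arclength. h b s y)"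
    if bs: "b \<in> {1, 2}" "s < 3" for b s
  proof -
    show "set_integrable arclength (bd b) (h b s)"
      unfolding h_def[abs_def] by (intro L2_mult_integrable L2_cmult L[OF bs])
    have "AE y in arclength. y \<in> bd b \<longrightarrow> \<phi> (shift b s + y) = cis (\<alpha> \<bullet> shift b s) * \<phi> y"
      using \<phi>(2) bs unfolding quasi_per_def by blast
    then have "AE y in arclength. y \<in> bd b \<longrightarrow> K (shift b s + y) * \<phi> (shift b s + y) = h b s y"
      by eventually_elim (simp add: h_def)
    then show "(LINT y:bd b|arclength. K (shift b s + y) * \<phi> (shift b s + y)) = (LINT y:bd b|arclength. h b s y)"
      unfolding h_def[abs_def]
      by (intro set_integral_cong_AE_L2(2) set_borel_measurable_mult_L2 L2_cmult L[OF bs])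
  qed
  have sum: "set_integrable arclength (bd b) (\<lambda>y. \<Sum>s<3. h b s y)"
    "(LINT y:bd b|arclength. \<Sum>s<3. h b s y) = (\<Sum>s<3. LINT y:bd b|arclength. h b s y)"
    if b: "b \<in> {1, 2}" for b
  proof -
    note hb = h(1)[OF b, unfolded set_integrable_def]
    show "set_integrable arclength (bd b) (\<lambda>y. \<Sum>s<3. h b s y)"
      unfolding set_integrable_def scaleR_sum_right by (intro Bochner_Integration.integrable_sum hb) simp
    show "(LINT y:bd b|arclength. \<Sum>s<3. h b s y) = (\<Sum>s<3. LINT y:bd b|arclength. h b s y)"
      unfolding set_lebesgue_integral_def scaleR_sum_right by (intro Bochner_Integration.integral_sum hb) simp
  qed
  have eq: "(\<Sum>s<3. h b s y) = Kt y * \<phi> y" if "b \<in> {1, 2}" "y \<in> bd b" "y \<notin> N" for b y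
    unfolding Kt[OF that] h_def sum_distrib_right by (intro sum.cong refl) (simp add: mult_ac)
  have Kti: "set_integrable arclength (bd b) (\<lambda>y. Kt y * \<phi> y)"
    "(LINT y:bd b|arclength. Kt y * \<phi> y) = (\<Sum>s<3. LINT y:bd b|arclength. h b s y)"
    if b: "b \<in> {1, 2}" for b
    using set_integral_countable_difference[OF N eq[OF b], of "bd b"] sum[OF b] by auto
  have disj: "bd 1 \<inter> bd 2 = {}" using bds_disjoint[of 1 0 2 0] by (simp add: bds_0)
  show "set_integrable arclength (bd 1 \<union> bd 2) (\<lambda>y. Kt y * \<phi> y)"
    using Kti(1) by (intro set_integrable_Un) (auto simp: sets_arclength sets_bd)
  have "(LINT y:bdry|arclength. K y * \<phi> y) = (\<Sum>b\<in>{1, 2}. \<Sum>s<3. LINT y:bd b|arclength. K (shift b s + y) * \<phi> (shift b s + y))"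
    by (rule set_integral_bdry[OF L2_mult_integrable[OF K \<phi>(1)]])
  also have "\<dots> = (\<Sum>b\<in>{1, 2}. \<Sum>s<3. LINT y:bd b|arclength. h b s y)"
    by (intro sum.cong refl h(2)) auto
  also have "\<dots> = (\<Sum>b\<in>{1, 2}. LINT y:bd b|arclength. Kt y * \<phi> y)"
    by (intro sum.cong refl Kti(2)[symmetric]) auto
  also have "\<dots> = (LINT y:(bd 1 \<union> bd 2)|arclength. Kt y * \<phi> y)"
    using set_integral_Un[OF disj Kti(1) Kti(1)] by (simp add: sets_arclength sets_bd)
  finally show "(LINT y:bdry|arclength. K y * \<phi> y) = (LINT y:(bd 1 \<union> bd 2)|arclength. Kt y * \<phi> y)" .
qed

text \<open>The common pattern of both potentials. Integrability of each folded product is recorded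
  because the reduced principal value needs it.\<close>

lemma layer_identity:
  assumes K: "K \<in> L2 bdry" and \<phi>: "\<phi> \<in> L2 bdry" and \<Phi>: "\<And>j. j \<in> classes \<Longrightarrow> \<Phi> j \<in> L2 bdry" "\<And>j. j \<in> classes \<Longrightarrow> quasi_per (alpha j) (\<Phi> j)"
    and sum: "eq_ae_on bdry \<phi> (\<lambda>y. \<Sum>j\<in>classes. \<Phi> j y)" and N: "countable N"
    and Kt: "\<And>j b y. j \<in> classes \<Longrightarrow> b \<in> {1, 2} \<Longrightarrow> y \<in> bd b \<Longrightarrow> y \<notin> N \<Longrightarrow>
      Kt j y = (\<Sum>s<3. cis (alpha j \<bullet> shift b s) * K (shift b s + y))"
  shows "\<And>j. j \<in> classes \<Longrightarrow> set_integrable arclength (bd 1 \<union> bd 2) (\<lambda>y. Kt j y * \<Phi> j y)"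
    and "(LINT y:bdry|arclength. K y * \<phi> y) = (\<Sum>j\<in>classes. LINT y:(bd 1 \<union> bd 2)|arclength. Kt j y * \<Phi> j y)"
proof -
  show "set_integrable arclength (bd 1 \<union> bd 2) (\<lambda>y. Kt j y * \<Phi> j y)" if "j \<in> classes" for j
    by (rule reduce_integral(1)[OF K \<Phi>(1)[OF that] \<Phi>(2)[OF that] N Kt[OF that]])
  have red: "(LINT y:bdry|arclength. K y * \<Phi> j y) = (LINT y:(bd 1 \<union> bd 2)|arclength. Kt j y * \<Phi> j y)"
    if "j \<in> classes" for j
    by (rule reduce_integral(2)[OF K \<Phi>(1)[OF that] \<Phi>(2)[OF that] N Kt[OF that]])
  have "AE y in arclength. y \<in> bdry \<longrightarrow> K y * \<phi> y = K y * (\<Sum>j\<in>classes. \<Phi> j y)"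
    using sum unfolding eq_ae_on_def by eventually_elim auto
  then have "(LINT y:bdry|arclength. K y * \<phi> y) = (LINT y:bdry|arclength. K y * (\<Sum>j\<in>classes. \<Phi> j y))"
    by (intro set_integral_cong_AE_L2(2) set_borel_measurable_mult_L2 K \<phi> L2_sum \<Phi>)
  also have "\<dots> = (\<Sum>j\<in>classes. LINT y:bdry|arclength. K y * \<Phi> j y)"
    using L2_mult_integrable[OF K \<Phi>(1)]
    unfolding set_integrable_def set_lebesgue_integral_def scaleR_sum_right sum_distrib_left
    by (intro Bochner_Integration.integral_sum)
  also have "\<dots> = (\<Sum>j\<in>classes. LINT y:(bd 1 \<union> bd 2)|arclength. Kt j y * \<Phi> j y)"
    by (intro sum.cong refl red)
  finally show "(LINT y:bdry|arclength. K y * \<phi> y) = (\<Sum>j\<in>classes. LINT y:(bd 1 \<union> bd 2)|arclength. Kt j y * \<Phi> j y)" .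
qed

section \<open>The kernels on the boundary and the two layer identities\<close>

lemma green_kernel_L2:
  assumes x: "x \<in> bdry"
  shows "(\<lambda>y. green c (lattice k1 k2) e \<omega> (x - y)) \<in> L2 bdry"
proof -
  have eq: "green c (lattice k1 k2) e \<omega> (x - y) = of_real c * helm \<omega> (x - y)" if "y \<in> bdry - {x}" for y
    using off_lattice_bdry[OF x, of y] that by (intro green_eq) auto
  obtain C where C: "\<forall>\<^sub>F z in at 0. norm (helm \<omega> z) \<le> C * norm z powr (-1/4)" using helm_bound by blast
  show ?thesis
  proof (rule kernel_in_L2[OF compact_bdry upper_regular_bdry])
    have "continuous_on (bdry - {x}) (\<lambda>y. of_real c * helm \<omega> (x - y))"
    proof (intro continuous_at_imp_continuous_on ballI)
      fix y assume "y \<in> bdry - {x}"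
      then have "off_lattice (x - y)" using off_lattice_bdry[OF x, of y] by auto
      moreover have "isCont (\<lambda>y. x - y) y" by (intro continuous_intros)
      ultimately have "isCont (\<lambda>y. helm \<omega> (x - y)) y" by (rule isCont_o2[OF _ isCont_helm, rotated])
      then show "isCont (\<lambda>y. of_real c * helm \<omega> (x - y)) y" by (rule continuous_mult[OF continuous_const])
    qed
    then show "continuous_on (bdry - {x}) (\<lambda>y. green c (lattice k1 k2) e \<omega> (x - y))"
      by (subst continuous_on_cong[OF refl eq])
    have "\<forall>\<^sub>F y in at x within bdry. y \<in> bdry \<and> y \<noteq> x" by (simp add: eventually_at_filter)
    with eventually_at_0_shift[OF C]
    show "\<forall>\<^sub>F y in at x within bdry. norm (green c (lattice k1 k2) e \<omega> (x - y)) \<le> (\<bar>c\<bar> * C) * norm (x - y) powr (-1/4)"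
    proof eventually_elim
      case (elim y)
      then show ?case using eq[of y] mult_left_mono[OF elim(1), of "\<bar>c\<bar>"] by (simp add: norm_mult mult.assoc)
    qed
  qed
qed

text \<open>At a point with a normal, |n \<bullet> (x - y)| is at most a constant times the squared
  distance, which raises the order -9/4 of the radial term to -1/4.\<close>

lemma green_normal_kernel_L2:
  assumes x: "x \<in> bdry" and n: "is_outward_normal (honeycomb D0) x n"
  shows "(\<lambda>y. frechet_derivative (green c (lattice k1 k2) e \<omega>) (at (x - y)) n) \<in> L2 bdry"
proof -
  have eq: "frechet_derivative (green c (lattice k1 k2) e \<omega>) (at (x - y)) n = of_real c * dhelm \<omega> (x - y) n"
    if "y \<in> bdry - {x}" for y
    using off_lattice_bdry[OF x, of y] that by (intro frechet_green) auto
  have n1: "norm n = 1" using n by (simp add: is_outward_normal_def)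
  obtain C where C: "0 \<le> C" "\<forall>\<^sub>F z in at 0. \<forall>n. norm n = 1 \<longrightarrow>
    norm (dhelm \<omega> z n) \<le> C * (\<bar>n \<bullet> z\<bar> * norm z powr (-9/4) + norm z powr (-1/4))" using dhelm_normal_bound by blast
  obtain M where M: "0 \<le> M" "\<And>y. y \<in> bdry \<Longrightarrow> \<bar>n \<bullet> (x - y)\<bar> \<le> M * (norm (x - y))\<^sup>2"
    using tame_curve_normal_bound[OF tame_curve_bdry open_honeycomb n] by blast
  show ?thesis
  proof (rule kernel_in_L2[OF compact_bdry upper_regular_bdry])
    have "continuous_on (bdry - {x}) (\<lambda>y. of_real c * dhelm \<omega> (x - y) n)"
    proof (intro continuous_at_imp_continuous_on ballI)
      fix y assume "y \<in> bdry - {x}"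
      then have "off_lattice (x - y)" using off_lattice_bdry[OF x, of y] by auto
      moreover have "isCont (\<lambda>y. x - y) y" by (intro continuous_intros)
      ultimately have "isCont (\<lambda>y. dhelm \<omega> (x - y) n) y" by (rule isCont_o2[OF _ isCont_dhelm, rotated])
      then show "isCont (\<lambda>y. of_real c * dhelm \<omega> (x - y) n) y" by (rule continuous_mult[OF continuous_const])
    qed
    then show "continuous_on (bdry - {x}) (\<lambda>y. frechet_derivative (green c (lattice k1 k2) e \<omega>) (at (x - y)) n)"
      by (subst continuous_on_cong[OF refl eq])
    have "\<forall>\<^sub>F y in at x within bdry. y \<in> bdry \<and> y \<noteq> x" by (simp add: eventually_at_filter)
    with eventually_at_0_shift[OF C(2)]
    show "\<forall>\<^sub>F y in at x within bdry. norm (frechet_derivative (green c (lattice k1 k2) e \<omega>) (at (x - y)) n)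
        \<le> (\<bar>c\<bar> * (C * (M + 1))) * norm (x - y) powr (-1/4)"
    proof eventually_elim
      case (elim y)
      let ?r = "norm (x - y)"
      have r: "0 < ?r" using elim by auto
      have "\<bar>n \<bullet> (x - y)\<bar> * ?r powr (-9/4) \<le> M * ?r\<^sup>2 * ?r powr (-9/4)"
        using M(2) elim by (intro mult_right_mono) auto
      also have "\<dots> = M * (?r powr 2 * ?r powr (-9/4))" using r by simp
      also have "?r powr 2 * ?r powr (-9/4) = ?r powr (-1/4)" unfolding powr_add[symmetric] by simp
      finally have "\<bar>n \<bullet> (x - y)\<bar> * ?r powr (-9/4) + ?r powr (-1/4) \<le> (M + 1) * ?r powr (-1/4)"
        by (simp add: algebra_simps)
      then have "C * (\<bar>n \<bullet> (x - y)\<bar> * ?r powr (-9/4) + ?r powr (-1/4)) \<le> C * ((M + 1) * ?r powr (-1/4))"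
        using C(1) by (rule mult_left_mono)
      then have "norm (dhelm \<omega> (x - y) n) \<le> C * ((M + 1) * ?r powr (-1/4))"
        using elim(1) n1 by fastforce
      then have "\<bar>c\<bar> * norm (dhelm \<omega> (x - y) n) \<le> \<bar>c\<bar> * (C * ((M + 1) * ?r powr (-1/4)))"
        by (rule mult_left_mono) simp
      then show ?case using eq[of y] elim by (simp add: norm_mult mult.assoc)
    qed
  qed
qed

text \<open>Contains every \<open>y\<close> for which one of the three translates of
  \<open>x - y\<close> is a period. Off this countable set the formulas for the reduced kernels
  apply for both values of \<open>b\<close>.\<close>

definition singular :: "real^2 \<Rightarrow> (real^2) set" where
  "singular x = (\<Union>b\<in>{1, 2}. \<Union>s<3. (\<lambda>p. x - shift b s - p) ` lattice l1 l2)"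

lemma countable_singular: "countable (singular x)"
  unfolding singular_def by (intro countable_UN countable_image countable_lattice) auto

lemma off_lattice_off_singular: "y \<notin> singular x \<Longrightarrow> b \<in> {1, 2} \<Longrightarrow> s < 3 \<Longrightarrow> off_lattice (x - y - shift b s)"
proof (rule ccontr)
  assume h: "y \<notin> singular x" "b \<in> {1, 2}" "s < 3" "\<not> off_lattice (x - y - shift b s)"
  then have "x - y - shift b s \<in> lattice l1 l2" by (simp add: off_lattice_iff)
  then have "x - shift b s - (x - y - shift b s) \<in> (\<lambda>p. x - shift b s - p) ` lattice l1 l2" by (rule imageI)
  then have "y \<in> (\<lambda>p. x - shift b s - p) ` lattice l1 l2" by simp
  then have "y \<in> singular x" unfolding singular_def using h(2,3) by blast
  with h(1) show False ..
qed

lemma single_layer_identity: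
  assumes \<phi>: "\<phi> \<in> L2 bdry" and \<Phi>: "\<And>j. j \<in> classes \<Longrightarrow> \<Phi> j \<in> L2 bdry" "\<And>j. j \<in> classes \<Longrightarrow> quasi_per (alpha j) (\<Phi> j)"
    and sum: "eq_ae_on bdry \<phi> (\<lambda>y. \<Sum>j\<in>classes. \<Phi> j y)" and x: "x \<in> bdry"
  shows "S_D k1 k2 D0 e \<omega> \<phi> x = (\<Sum>j\<in>classes. S_red k1 k2 D0 (alpha j) \<omega> (\<Phi> j) x)"
  unfolding S_D_def S_red_def single_layer_def frontier_honeycomb_red green_qp_def green_red_def
proof (rule layer_identity(2)[OF green_kernel_L2[OF x] \<phi> \<Phi> sum countable_singular[of x]])
  fix j y and b :: nat assume "b \<in> {1, 2}" "y \<notin> singular x"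
  then have reg: "off_lattice (x - y - shift b s)" if "s < 3" for s using off_lattice_off_singular that by blast
  have "green (3 * (1 / measure lborel hexY)) (lattice (2 *\<^sub>R k1 - k2) (2 *\<^sub>R k2 - k1)) (alpha j) \<omega> (x - y)
    = (\<Sum>s<3. cis (alpha j \<bullet> shift b s) * (of_real (1 / measure lborel hexY) * helm \<omega> (x - y - shift b s)))"
    unfolding alpha_def by (rule green_red_eq[OF reg])
  also have "\<dots> = (\<Sum>s<3. cis (alpha j \<bullet> shift b s) * green (1 / measure lborel hexY) (lattice k1 k2) e \<omega> (x - (shift b s + y)))"
    using green_eq[OF reg] by (intro sum.cong refl) (simp add: diff_diff_add add.commute)
  finally show "green (3 / measure lborel hexY) (lattice (2 *\<^sub>R k1 - k2) (2 *\<^sub>R k2 - k1)) (alpha j) \<omega> (x - y)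
    = (\<Sum>s<3. cis (alpha j \<bullet> shift b s) * green (1 / measure lborel hexY) (lattice k1 k2) e \<omega> (x - (shift b s + y)))"
    by simp
qed

text \<open>Both principal values are replaced by ordinary integrals, to which
  \<open>layer_identity\<close> applies. The existence of some normal is passed to the vector
  \<open>\<nu>\<close> chosen by the definite description, through uniqueness.\<close>

lemma normal_layer_identity:
  assumes \<phi>: "\<phi> \<in> L2 bdry" and \<Phi>: "\<And>j. j \<in> classes \<Longrightarrow> \<Phi> j \<in> L2 bdry" "\<And>j. j \<in> classes \<Longrightarrow> quasi_per (alpha j) (\<Phi> j)"
    and sum: "eq_ae_on bdry \<phi> (\<lambda>y. \<Sum>j\<in>classes. \<Phi> j y)" and x: "x \<in> bdry"
    and n: "is_outward_normal (honeycomb D0) x n"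
  shows "K_adj k1 k2 D0 (- e) \<omega> \<phi> x = (\<Sum>j\<in>classes. K_adj_red k1 k2 D0 (- alpha j) \<omega> (\<Phi> j) x)"
proof -
  define c where "c = 1 / measure lborel hexY"
  define \<nu> where "\<nu> = outward_normal (honeycomb D0) x"
  have \<nu>: "is_outward_normal (honeycomb D0) x \<nu>" unfolding \<nu>_def by (rule outward_normal_eq[OF n])
  define K where "K y = frechet_derivative (green c (lattice k1 k2) e \<omega>) (at (x - y)) \<nu>" for y
  define Kt where "Kt j y = frechet_derivative (green (3 * c) (lattice (2 *\<^sub>R k1 - k2) (2 *\<^sub>R k2 - k1)) (alpha j) \<omega>) (at (x - y)) \<nu>" for j y
  have K: "K \<in> L2 bdry" unfolding K_def[abs_def] by (rule green_normal_kernel_L2[OF x \<nu>])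
  have Kt: "Kt j y = (\<Sum>s<3. cis (alpha j \<bullet> shift b s) * K (shift b s + y))"
    if "b \<in> {1, 2}" "y \<notin> singular x" for j and b :: nat and y
  proof -
    have reg: "off_lattice (x - y - shift b s)" if "s < 3" for s
      using off_lattice_off_singular \<open>b \<in> {1, 2}\<close> \<open>y \<notin> singular x\<close> that by blast
    have "Kt j y = (\<Sum>s<3. cis (alpha j \<bullet> shift b s) * (of_real c * dhelm \<omega> (x - y - shift b s) \<nu>))"
      unfolding Kt_def alpha_def by (rule frechet_green_red[OF reg])
    also have "\<dots> = (\<Sum>s<3. cis (alpha j \<bullet> shift b s) * K (shift b s + y))"
      unfolding K_def using frechet_green[OF reg] by (intro sum.cong refl) (simp add: diff_diff_add add.commute)
    finally show ?thesis .
  qed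
  note layer = layer_identity[OF K \<phi> \<Phi> sum countable_singular[of x] Kt]
  have "K_adj k1 k2 D0 (- e) \<omega> \<phi> x = (LINT y:bdry|arclength. K y * \<phi> y)"
    unfolding K_adj_def normal_layer_pv_def green_qp_def c_def[symmetric] \<nu>_def[symmetric] minus_minus K_def[symmetric]
    by (intro tendsto_Lim trivial_limit_at_right_real principal_value_tendsto L2_mult_integrable K \<phi> sets_bdry
        closed_lattice countable_lattice)
  also have "\<dots> = (\<Sum>j\<in>classes. LINT y:(bd 1 \<union> bd 2)|arclength. Kt j y * \<Phi> j y)"
    by (rule layer(2))
  also have "\<dots> = (\<Sum>j\<in>classes. K_adj_red k1 k2 D0 (- alpha j) \<omega> (\<Phi> j) x)"
  proof (rule sum.cong[OF refl])
    fix j assume j: "j \<in> classes"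
    have c3: "3 / measure lborel hexY = 3 * c" by (simp add: c_def)
    \<comment> \<open>The reduced principal value removes discs around the translates of
      \<open>x\<close> by the finer lattice, so closedness and countability are needed for that
      lattice.\<close>
    have "closed (lattice tl1 tl2)" using closed_lattice_sublat unfolding t_eq .
    then have "((\<lambda>\<delta>. LINT y:{y \<in> bd 1 \<union> bd 2. \<forall>p\<in>lattice tl1 tl2. \<delta> \<le> norm (x - y - p)}|arclength. Kt j y * \<Phi> j y)
      \<longlongrightarrow> (LINT y:(bd 1 \<union> bd 2)|arclength. Kt j y * \<Phi> j y)) (at_right 0)"
      using layer(1)[OF _ _ _ _ j] by (intro principal_value_tendsto countable_lattice) (auto intro: sets.Un sets_bd)
    from tendsto_Lim[OF trivial_limit_at_right_real this]
    show "(LINT y:(bd 1 \<union> bd 2)|arclength. Kt j y * \<Phi> j y) = K_adj_red k1 k2 D0 (- alpha j) \<omega> (\<Phi> j) x"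
      unfolding K_adj_red_def normal_layer_pv_def green_red_def c3 \<nu>_def[symmetric] minus_minus Kt_def
        frontier_honeycomb_red by (rule sym)
  qed
  finally show ?thesis .
qed


section \<open>The quasi-periodic decomposition\<close>

definition extension :: "real^2 \<Rightarrow> (nat \<Rightarrow> real^2 \<Rightarrow> complex) \<Rightarrow> real^2 \<Rightarrow> complex" where
  "extension \<alpha> f y = (\<Sum>p\<in>Idx. cis (\<alpha> \<bullet> shift (fst p) (snd p)) *
     (indicator (bds (fst p) (snd p)) y * f (fst p) (y - shift (fst p) (snd p))))"

lemma extension_eq:
  "extension \<alpha> (\<lambda>b. if b = 1 then f1 else f2) y =
           indicator (frontier (inclusion D0 1)) y * f1 y
         + cis (\<alpha> \<bullet> tl1) * indicator (frontier (inclusion D0 3)) y * f1 (y - tl1)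
         + cis (\<alpha> \<bullet> (tl1 - tl2)) * indicator (frontier (inclusion D0 5)) y * f1 (y - tl1 + tl2)
         + indicator (frontier (inclusion D0 2)) y * f2 y
         + cis (\<alpha> \<bullet> (tl1 - tl2)) * indicator (frontier (inclusion D0 4)) y * f2 (y - tl1 + tl2)
         + cis (- (\<alpha> \<bullet> tl2)) * indicator (frontier (inclusion D0 6)) y * f2 (y + tl2)"
proof -
  have I: "Idx = {(1, 0), (1, 1), (1, 2), (2, 0), (2, 1), (2, 2)}"
    by (auto simp: Idx_def lessThan_Suc eval_nat_numeral)
  have G: "bds 1 0 = frontier (inclusion D0 1)" "bds 1 1 = frontier (inclusion D0 3)"
    "bds 1 2 = frontier (inclusion D0 5)" "bds 2 0 = frontier (inclusion D0 2)"
    "bds 2 1 = frontier (inclusion D0 4)" "bds 2 2 = frontier (inclusion D0 6)"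
    by (simp_all add: bds_def eval_nat_numeral)
  have sh: "shift 1 0 = 0" "shift 1 1 = tl1" "shift 1 2 = tl1 - tl2"
    "shift 2 0 = 0" "shift 2 1 = tl1 - tl2" "shift 2 2 = - tl2"
    by (simp_all add: shift_def t_eq)
  have "extension \<alpha> f y =
      cis (\<alpha> \<bullet> shift 1 0) * (indicator (bds 1 0) y * f 1 (y - shift 1 0))
    + (cis (\<alpha> \<bullet> shift 1 1) * (indicator (bds 1 1) y * f 1 (y - shift 1 1))
    + (cis (\<alpha> \<bullet> shift 1 2) * (indicator (bds 1 2) y * f 1 (y - shift 1 2))
    + (cis (\<alpha> \<bullet> shift 2 0) * (indicator (bds 2 0) y * f 2 (y - shift 2 0))
    + (cis (\<alpha> \<bullet> shift 2 1) * (indicator (bds 2 1) y * f 2 (y - shift 2 1))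
    + cis (\<alpha> \<bullet> shift 2 2) * (indicator (bds 2 2) y * f 2 (y - shift 2 2))))))" for f
    unfolding extension_def I by (subst sum.insert; simp)+
  moreover have "y - (tl1 - tl2) = y - tl1 + tl2" "y - (- tl2) = y + tl2" by simp_all
  ultimately show ?thesis unfolding sh G by (simp add: add_ac mult_ac)
qed

text \<open>The six boundary pieces are disjoint, so exactly one summand survives.\<close>

lemma extension_at:
  assumes "b \<in> {1, 2}" "s < 3" "y \<in> bd b"
  shows "extension \<alpha> f (shift b s + y) = cis (\<alpha> \<bullet> shift b s) * f b y"
proof -
  let ?z = "shift b s + y"
  have z: "?z \<in> bds b s" by (rule shift_mem_bds[OF assms])
  have "extension \<alpha> f ?z = (\<Sum>p\<in>Idx. if p = (b, s) then cis (\<alpha> \<bullet> shift b s) * f b y else 0)"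
    unfolding extension_def
  proof (rule sum.cong[OF refl])
    fix p assume p: "p \<in> Idx"
    show "cis (\<alpha> \<bullet> shift (fst p) (snd p)) * (indicator (bds (fst p) (snd p)) ?z * f (fst p) (?z - shift (fst p) (snd p)))
      = (if p = (b, s) then cis (\<alpha> \<bullet> shift b s) * f b y else 0)"
    proof (cases "p = (b, s)")
      case False
      obtain b' s' where e: "p = (b', s')" by (cases p)
      have "b' \<in> {1, 2}" "s' < 3" using p unfolding e Idx_iff by blast+
      then have "bds b s \<inter> bds b' s' = {}" using False assms e by (intro bds_disjoint) auto
      then have "?z \<notin> bds b' s'" using z by blast
      then show ?thesis using False by (auto simp: e)
    qed (use z in simp)
  qed
  also have "\<dots> = cis (\<alpha> \<bullet> shift b s) * f b y"
    using assms(1,2) finite_Idx Idx_iff[of b s] by simp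
  finally show ?thesis .
qed

lemma extension_in_L2_qp:
  assumes f: "\<And>b. b \<in> {1, 2} \<Longrightarrow> f b \<in> L2 (bd b)"
  shows "extension \<alpha> f \<in> L2_qp D0 \<alpha>"
proof -
  have eq: "extension \<alpha> f = extension \<alpha> (\<lambda>b. if b = 1 then f 1 else f 2)"
    unfolding extension_def[abs_def] by (intro ext sum.cong refl) (auto simp: Idx_def)
  have "extension \<alpha> f \<in> L2 bdry"
    unfolding extension_def[abs_def]
  proof (intro L2_sum L2_cmult L2_extend)
    fix p assume "p \<in> Idx"
    then obtain b s where p: "p = (b, s)" "b \<in> {1, 2}" "s < 3" by (cases p) (simp add: Idx_iff)
    show "bds (fst p) (snd p) \<subseteq> bdry" using bds_subset p by simp
    have "bd b = (+) (- shift b s) ` bds b s"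
      unfolding bds_eq[OF p(2,3)] image_image by simp
    then have "(\<lambda>y. f b (- shift b s + y)) \<in> L2 (bds b s)"
      using f[OF p(2)] by (intro L2_translation) simp
    then show "(\<lambda>y. f (fst p) (y - shift (fst p) (snd p))) \<in> L2 (bds (fst p) (snd p))"
      unfolding p(1) fst_conv snd_conv by (simp only: uminus_add_conv_diff)
  qed
  moreover have "f 1 \<in> L2 (frontier (inclusion D0 1))" "f 2 \<in> L2 (frontier (inclusion D0 2))"
    using f[of 1] f[of 2] by (simp_all add: bd_def)
  moreover have "eq_ae_on bdry (extension \<alpha> f) (extension \<alpha> (\<lambda>b. if b = 1 then f 1 else f 2))"
    unfolding eq_ae_on_def eq[symmetric] by simp
  ultimately show ?thesis
    unfolding L2_qp_def extension_eq by blast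
qed

text \<open>The representation is only known almost everywhere, and comparing \<open>y\<close> with
  \<open>shift b s + y\<close> uses it at both points; translation invariance of null sets makes
  both available for almost all \<open>y\<close>.\<close>

lemma L2_qpD:
  assumes "\<phi> \<in> L2_qp D0 \<alpha>" shows "\<phi> \<in> L2 bdry" "quasi_per \<alpha> \<phi>"
proof -
  show "\<phi> \<in> L2 bdry" using assms by (simp add: L2_qp_def)
  obtain f1 f2 where ae: "eq_ae_on bdry \<phi> (extension \<alpha> (\<lambda>b. if b = 1 then f1 else f2))"
    using assms unfolding L2_qp_def extension_eq[abs_def] by blast
  define f where "f = (\<lambda>b. if b = (1::nat) then f1 else f2)"
  have ae': "AE y in arclength. y \<in> bdry \<longrightarrow> \<phi> y = extension \<alpha> f y"
    using ae unfolding eq_ae_on_def f_def .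
  show "quasi_per \<alpha> \<phi>"
    unfolding quasi_per_def
  proof (intro ballI allI impI)
    fix b s :: nat assume bs: "b \<in> {1, 2}" "s < 3"
    from ae' AE_arclength_translation[OF ae', of "shift b s"]
    show "AE y in arclength. y \<in> bd b \<longrightarrow> \<phi> (shift b s + y) = cis (\<alpha> \<bullet> shift b s) * \<phi> y"
    proof eventually_elim
      case (elim y)
      show ?case
      proof
        assume y: "y \<in> bd b"
        then have "y \<in> bdry" "shift b s + y \<in> bdry"
          using bd_subset bds_subset shift_mem_bds bs by blast+
        then have "\<phi> y = extension \<alpha> f y" "\<phi> (shift b s + y) = extension \<alpha> f (shift b s + y)"
          using elim by blast+
        moreover have "extension \<alpha> f y = f b y"
          using extension_at[of b 0 y \<alpha> f] bs y by simp
        ultimately show "\<phi> (shift b s + y) = cis (\<alpha> \<bullet> shift b s) * \<phi> y"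
          using extension_at[OF bs y] by simp
      qed
    qed
  qed
qed

text \<open>The discrete Fourier coefficient of the three translated values of \<open>\<phi>\<close>
  for the character of class \<open>j\<close>.\<close>

definition component :: "(real^2 \<Rightarrow> complex) \<Rightarrow> int \<times> int \<Rightarrow> nat \<Rightarrow> real^2 \<Rightarrow> complex" where
  "component \<phi> j b y = (1/3) * (\<Sum>s<3. cis (- (alpha j \<bullet> shift b s)) * \<phi> (shift b s + y))"

text \<open>Fourier inversion on three points: exchanging the sums,
  \<open>orthogonality_classes\<close> isolates the translate on which \<open>y\<close>
  lies.\<close>

lemma component_sum:
  assumes "y \<in> bdry"
  shows "(\<Sum>j\<in>classes. extension (alpha j) (component \<phi> j) y) = \<phi> y"
proof -
  obtain b s where bs: "b \<in> {1, 2}" "s < 3" and "y \<in> bds b s"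
    using assms unfolding frontier_honeycomb_iff by blast
  then obtain x where x: "x \<in> bd b" "y = shift b s + x" by (auto simp: bds_eq)
  have "(\<Sum>j\<in>classes. extension (alpha j) (component \<phi> j) y) = (\<Sum>j\<in>classes. cis (alpha j \<bullet> shift b s) * component \<phi> j b x)"
    unfolding x(2) extension_at[OF bs x(1)] ..
  also have "\<dots> = (\<Sum>j\<in>classes. \<Sum>s'<3. (1/3) * (cis (alpha j \<bullet> shift b s) * cis (- (alpha j \<bullet> shift b s'))) * \<phi> (shift b s' + x))"
    unfolding component_def sum_distrib_left by (intro sum.cong refl) (simp add: mult_ac)
  also have "\<dots> = (\<Sum>s'<3. (1/3) * (\<Sum>j\<in>classes. cis (alpha j \<bullet> shift b s) * cis (- (alpha j \<bullet> shift b s'))) * \<phi> (shift b s' + x))"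
    by (subst sum.swap) (simp only: sum_distrib_left sum_distrib_right)
  also have "\<dots> = (\<Sum>s'<3. if s' = s then \<phi> (shift b s + x) else 0)"
    by (rule sum.cong[OF refl]) (use orthogonality_classes[OF bs(2)] in auto)
  also have "\<dots> = \<phi> y" using bs(2) x(2) by simp
  finally show ?thesis .
qed

lemma component_in_L2:
  assumes "\<phi> \<in> L2 bdry" "b \<in> {1, 2}"
  shows "component \<phi> j b \<in> L2 (bd b)"
  unfolding component_def[abs_def]
  by (intro L2_cmult L2_sum L2_shift assms) simp

text \<open>Inserting any decomposition into the Fourier coefficient,
  \<open>orthogonality_shift\<close> keeps just the part of class \<open>j\<close>, so that part is
  determined by \<open>\<phi>\<close>.\<close>

lemma component_unique:
  assumes \<Phi>: "\<And>j. j \<in> classes \<Longrightarrow> quasi_per (alpha j) (\<Phi> j)" and sum: "eq_ae_on bdry \<phi> (\<lambda>y. \<Sum>j\<in>classes. \<Phi> j y)"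
    and j: "j \<in> classes" and b: "b \<in> {1, 2}"
  shows "AE y in arclength. y \<in> bd b \<longrightarrow> \<Phi> j y = component \<phi> j b y"
proof -
  have 1: "AE y in arclength. \<forall>s\<in>{..<3}. \<forall>i\<in>classes. y \<in> bd b \<longrightarrow> \<Phi> i (shift b s + y) = cis (alpha i \<bullet> shift b s) * \<Phi> i y"
    using \<Phi> b finite_classes unfolding quasi_per_def by (intro AE_finite_allI) auto
  have 2: "AE y in arclength. \<forall>s\<in>{..<3}. shift b s + y \<in> bdry \<longrightarrow> \<phi> (shift b s + y) = (\<Sum>i\<in>classes. \<Phi> i (shift b s + y))"
    using AE_arclength_translation[OF sum[unfolded eq_ae_on_def]] by (intro AE_finite_allI) auto
  from 1 2 show ?thesis
  proof eventually_elim
    case (elim y)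
    show ?case
    proof
      assume y: "y \<in> bd b"
      have \<phi>: "\<phi> (shift b s + y) = (\<Sum>i\<in>classes. cis (alpha i \<bullet> shift b s) * \<Phi> i y)" if "s < 3" for s
      proof -
        have "shift b s + y \<in> bdry" using bds_subset[OF b that] shift_mem_bds[OF b that y] by blast
        then have "\<phi> (shift b s + y) = (\<Sum>i\<in>classes. \<Phi> i (shift b s + y))" using elim(2) that by blast
        also have "\<dots> = (\<Sum>i\<in>classes. cis (alpha i \<bullet> shift b s) * \<Phi> i y)"
          using elim(1) that y by (intro sum.cong refl) blast
        finally show ?thesis .
      qed
      have "component \<phi> j b y = (1/3) * (\<Sum>s<3. cis (- (alpha j \<bullet> shift b s)) * (\<Sum>i\<in>classes. cis (alpha i \<bullet> shift b s) * \<Phi> i y))"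
        unfolding component_def using \<phi> by simp
      also have "\<dots> = (\<Sum>s<3. \<Sum>i\<in>classes. (1/3) * \<Phi> i y * (cis (alpha i \<bullet> shift b s) * cis (- (alpha j \<bullet> shift b s))))"
        unfolding sum_distrib_left by (intro sum.cong refl) (simp add: mult_ac)
      also have "\<dots> = (\<Sum>i\<in>classes. (1/3) * \<Phi> i y * (\<Sum>s<3. cis (alpha i \<bullet> shift b s) * cis (- (alpha j \<bullet> shift b s))))"
        by (subst sum.swap) (simp only: sum_distrib_left)
      also have "\<dots> = (\<Sum>i\<in>classes. if i = j then \<Phi> j y else 0)"
        by (rule sum.cong[OF refl]) (use orthogonality_shift[OF _ j] in auto)
      also have "\<dots> = \<Phi> j y" using j finite_classes by simp
      finally show "\<Phi> j y = component \<phi> j b y" by simp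
    qed
  qed
qed

text \<open>Two decompositions agree with the same \<open>component\<close> on the first two pieces.
  Quasi-periodicity carries the equality to their translates, and a translation of null sets brings
  it to the piece itself.\<close>

lemma decomposition_unique:
  assumes \<Phi>: "\<And>j. j \<in> classes \<Longrightarrow> quasi_per (alpha j) (\<Phi> j)" and sum: "eq_ae_on bdry \<phi> (\<lambda>y. \<Sum>j\<in>classes. \<Phi> j y)"
    and \<Psi>: "\<And>j. j \<in> classes \<Longrightarrow> quasi_per (alpha j) (\<Psi> j)" and sum': "eq_ae_on bdry \<phi> (\<lambda>y. \<Sum>j\<in>classes. \<Psi> j y)"
    and j: "j \<in> classes"
  shows "eq_ae_on bdry (\<Phi> j) (\<Psi> j)"
proof -
  have main: "AE z in arclength. z \<in> bds b s \<longrightarrow> \<Phi> j z = \<Psi> j z" if bs: "b \<in> {1, 2}" "s < 3" for b s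
  proof -
    have "AE y in arclength. y \<in> bd b \<longrightarrow> \<Phi> j (shift b s + y) = cis (alpha j \<bullet> shift b s) * \<Phi> j y"
      "AE y in arclength. y \<in> bd b \<longrightarrow> \<Psi> j (shift b s + y) = cis (alpha j \<bullet> shift b s) * \<Psi> j y"
      using \<Phi>[OF j] \<Psi>[OF j] bs unfolding quasi_per_def by blast+
    moreover have "AE y in arclength. y \<in> bd b \<longrightarrow> \<Phi> j y = component \<phi> j b y"
      by (rule component_unique[OF \<Phi> sum j bs(1)])
    moreover have "AE y in arclength. y \<in> bd b \<longrightarrow> \<Psi> j y = component \<phi> j b y"
      by (rule component_unique[OF \<Psi> sum' j bs(1)])
    ultimately have "AE y in arclength. y \<in> bd b \<longrightarrow> \<Phi> j (shift b s + y) = \<Psi> j (shift b s + y)"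
      by eventually_elim auto
    from AE_arclength_translation[OF this, of "- shift b s"]
    show ?thesis
      by eventually_elim (auto simp: bds_eq[OF bs])
  qed
  have "AE z in arclength. \<forall>b\<in>{1, 2}. \<forall>s\<in>{..<3}. z \<in> bds b s \<longrightarrow> \<Phi> j z = \<Psi> j z"
    using main by (intro AE_finite_allI) auto
  then show ?thesis
    unfolding eq_ae_on_def by eventually_elim (use frontier_honeycomb_iff in blast)
qed

text \<open>Indexes three functions by the classes in the order \<open>k1\<close>,
  \<open>k2\<close>, 0, so that the three-term sums of the theorem become sums over
  \<open>classes\<close>.\<close>

definition triple :: "'a \<Rightarrow> 'a \<Rightarrow> 'a \<Rightarrow> int \<times> int \<Rightarrow> 'a" where
  "triple u v w j = (if j = (1, 0) then u else if j = (0, 1) then v else w)"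

lemma sum_classes: "(\<Sum>j\<in>classes. F j) = F (1, 0) + F (0, 1) + F (0, 0)" for F :: "int \<times> int \<Rightarrow> complex"
  by (simp add: classes_def add_ac)

lemma alpha_simps: "alpha (1, 0) = k1 + e" "alpha (0, 1) = k2 + e" "alpha (0, 0) = 0 + e"
  by (simp_all add: alpha_def dvec_def)

lemma triple_simps: "triple u v w (1, 0) = u" "triple u v w (0, 1) = v" "triple u v w (0, 0) = w"
  by (simp_all add: triple_def)

lemma qp_decompositionD:
  assumes "qp_decomposition k1 k2 D0 e \<phi> \<phi>1 \<phi>2 \<phi>3"
  shows "\<And>j. j \<in> classes \<Longrightarrow> triple \<phi>1 \<phi>2 \<phi>3 j \<in> L2 bdry" "\<And>j. j \<in> classes \<Longrightarrow> quasi_per (alpha j) (triple \<phi>1 \<phi>2 \<phi>3 j)"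
    and "eq_ae_on bdry \<phi> (\<lambda>y. \<Sum>j\<in>classes. triple \<phi>1 \<phi>2 \<phi>3 j y)"
proof -
  have "triple \<phi>1 \<phi>2 \<phi>3 j \<in> L2_qp D0 (alpha j)" if "j \<in> classes" for j
    using that assms unfolding classes_def qp_decomposition_def
    by (elim insertE emptyE) (simp_all add: alpha_simps triple_simps)
  then show "\<And>j. j \<in> classes \<Longrightarrow> triple \<phi>1 \<phi>2 \<phi>3 j \<in> L2 bdry" "\<And>j. j \<in> classes \<Longrightarrow> quasi_per (alpha j) (triple \<phi>1 \<phi>2 \<phi>3 j)"
    using L2_qpD by blast+
  show "eq_ae_on bdry \<phi> (\<lambda>y. \<Sum>j\<in>classes. triple \<phi>1 \<phi>2 \<phi>3 j y)"
    using assms unfolding qp_decomposition_def sum_classes triple_simps by blast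
qed

lemma qp_decomposition_exists:
  assumes "\<phi> \<in> L2 bdry"
  shows "\<exists>\<phi>1 \<phi>2 \<phi>3. qp_decomposition k1 k2 D0 e \<phi> \<phi>1 \<phi>2 \<phi>3"
proof -
  define \<Phi> where "\<Phi> j = extension (alpha j) (component \<phi> j)" for j
  have "\<Phi> j \<in> L2_qp D0 (alpha j)" for j
    unfolding \<Phi>_def by (intro extension_in_L2_qp component_in_L2 assms)
  from this[of "(1, 0)"] this[of "(0, 1)"] this[of "(0, 0)"]
  have "qp_decomposition k1 k2 D0 e \<phi> (\<Phi> (1, 0)) (\<Phi> (0, 1)) (\<Phi> (0, 0))"
    unfolding qp_decomposition_def eq_ae_on_def alpha_simps
    using component_sum[of _ \<phi>] unfolding \<Phi>_def[symmetric] sum_classes by auto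
  then show ?thesis by blast
qed

end

theorem theorem5p2:
  fixes D0 :: "(real^2) set" and k1 k2 :: "real^2"
  assumes "k1 \<bullet> l1 = 2 * pi" and "k1 \<bullet> l2 = 0" and "k2 \<bullet> l1 = 0" and "k2 \<bullet> l2 = 2 * pi"
    and "open D0" and "connected D0" and "0 \<in> D0" and "piecewise_smooth_boundary D0"
    and "(\<lambda>x. (rotR ** rotR) *v x) ` D0 = D0" and "(\<lambda>x. reflTx *v x) ` D0 = D0"
    and "bounded D0" and "diameter D0 < 1/4"
    and "closure (honeycomb D0) \<subseteq> interior hexY" and "card (components (honeycomb D0)) = 6"
  shows "\<exists>r>0. \<forall>(\<omega>::complex) (\<epsilon>::real^2).
    norm \<omega> < r \<and> norm \<epsilon> < r \<and> (norm \<epsilon> < norm \<omega> \<or> \<omega> = 0 \<and> \<epsilon> = 0) \<longrightarrow>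
    (\<forall>\<phi> \<in> L2 (frontier (honeycomb D0)).
      (\<exists>\<phi>1 \<phi>2 \<phi>3. qp_decomposition k1 k2 D0 \<epsilon> \<phi> \<phi>1 \<phi>2 \<phi>3) \<and>
      (\<forall>\<phi>1 \<phi>2 \<phi>3 \<psi>1 \<psi>2 \<psi>3.
        qp_decomposition k1 k2 D0 \<epsilon> \<phi> \<phi>1 \<phi>2 \<phi>3 \<and> qp_decomposition k1 k2 D0 \<epsilon> \<phi> \<psi>1 \<psi>2 \<psi>3 \<longrightarrow>
        eq_ae_on (frontier (honeycomb D0)) \<phi>1 \<psi>1 \<and>
        eq_ae_on (frontier (honeycomb D0)) \<phi>2 \<psi>2 \<and>
        eq_ae_on (frontier (honeycomb D0)) \<phi>3 \<psi>3) \<and>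
      (\<forall>\<phi>1 \<phi>2 \<phi>3. qp_decomposition k1 k2 D0 \<epsilon> \<phi> \<phi>1 \<phi>2 \<phi>3 \<longrightarrow>
        (\<forall>x \<in> frontier (honeycomb D0).
          S_D k1 k2 D0 \<epsilon> \<omega> \<phi> x =
            S_red k1 k2 D0 (k1 + \<epsilon>) \<omega> \<phi>1 x
          + S_red k1 k2 D0 (k2 + \<epsilon>) \<omega> \<phi>2 x
          + S_red k1 k2 D0 (0 + \<epsilon>) \<omega> \<phi>3 x) \<and>
        (\<forall>x \<in> frontier (honeycomb D0).
          (\<exists>n. is_outward_normal (honeycomb D0) x n) \<longrightarrow>
          K_adj k1 k2 D0 (- \<epsilon>) \<omega> \<phi> x =
            K_adj_red k1 k2 D0 (- k1 - \<epsilon>) \<omega> \<phi>1 x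
          + K_adj_red k1 k2 D0 (- k2 - \<epsilon>) \<omega> \<phi>2 x
          + K_adj_red k1 k2 D0 (- 0 - \<epsilon>) \<omega> \<phi>3 x)))"
proof (intro exI[of _ 1] conjI allI impI ballI; (elim conjE)?)
  fix \<omega> :: complex and \<epsilon> :: "real^2" and \<phi>
  assume \<phi>: "\<phi> \<in> L2 (frontier (honeycomb D0))"
  \<comment> \<open>The quasi-momentum \<open>\<epsilon>\<close> takes the place of
    \<open>e\<close>; the three quasi-momenta of the reduced potentials are then the vectors
    \<open>alpha j\<close>.\<close>
  interpret crystal k1 k2 \<epsilon> D0
    by unfold_locales (use assms in \<open>auto simp: image_def\<close>)
  show "\<exists>\<phi>1 \<phi>2 \<phi>3. qp_decomposition k1 k2 D0 \<epsilon> \<phi> \<phi>1 \<phi>2 \<phi>3"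
    by (rule qp_decomposition_exists[OF \<phi>])
  {
    fix \<phi>1 \<phi>2 \<phi>3 \<psi>1 \<psi>2 \<psi>3
    assume 1: "qp_decomposition k1 k2 D0 \<epsilon> \<phi> \<phi>1 \<phi>2 \<phi>3"
      and 2: "qp_decomposition k1 k2 D0 \<epsilon> \<phi> \<psi>1 \<psi>2 \<psi>3"
    have "eq_ae_on bdry (triple \<phi>1 \<phi>2 \<phi>3 j) (triple \<psi>1 \<psi>2 \<psi>3 j)" if "j \<in> classes" for j
      by (rule decomposition_unique[OF qp_decompositionD(2,3)[OF 1] qp_decompositionD(2,3)[OF 2] that])
    from this[of "(1, 0)"] this[of "(0, 1)"] this[of "(0, 0)"]
    show "eq_ae_on bdry \<phi>1 \<psi>1" "eq_ae_on bdry \<phi>2 \<psi>2" "eq_ae_on bdry \<phi>3 \<psi>3"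
      by (simp_all add: classes_def triple_simps)
  }
  fix \<phi>1 \<phi>2 \<phi>3 x
  assume d: "qp_decomposition k1 k2 D0 \<epsilon> \<phi> \<phi>1 \<phi>2 \<phi>3" and x: "x \<in> bdry"
  have "S_D k1 k2 D0 \<epsilon> \<omega> \<phi> x = (\<Sum>j\<in>classes. S_red k1 k2 D0 (alpha j) \<omega> (triple \<phi>1 \<phi>2 \<phi>3 j) x)"
    by (rule single_layer_identity[OF \<phi> qp_decompositionD[OF d] x])
  then show "S_D k1 k2 D0 \<epsilon> \<omega> \<phi> x = S_red k1 k2 D0 (k1 + \<epsilon>) \<omega> \<phi>1 x
      + S_red k1 k2 D0 (k2 + \<epsilon>) \<omega> \<phi>2 x + S_red k1 k2 D0 (0 + \<epsilon>) \<omega> \<phi>3 x"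
    unfolding sum_classes alpha_simps triple_simps .
  assume "\<exists>n. is_outward_normal (honeycomb D0) x n"
  then obtain n where n: "is_outward_normal (honeycomb D0) x n" ..
  have neg: "- alpha (1, 0) = - k1 - \<epsilon>" "- alpha (0, 1) = - k2 - \<epsilon>" "- alpha (0, 0) = - 0 - \<epsilon>"
    by (simp_all add: alpha_simps)
  have "K_adj k1 k2 D0 (- \<epsilon>) \<omega> \<phi> x
      = (\<Sum>j\<in>classes. K_adj_red k1 k2 D0 (- alpha j) \<omega> (triple \<phi>1 \<phi>2 \<phi>3 j) x)"
    by (rule normal_layer_identity[OF \<phi> qp_decompositionD[OF d] x n])
  then show "K_adj k1 k2 D0 (- \<epsilon>) \<omega> \<phi> x = K_adj_red k1 k2 D0 (- k1 - \<epsilon>) \<omega> \<phi>1 x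
      + K_adj_red k1 k2 D0 (- k2 - \<epsilon>) \<omega> \<phi>2 x + K_adj_red k1 k2 D0 (- 0 - \<epsilon>) \<omega> \<phi>3 x"
    unfolding sum_classes neg triple_simps .
qed simp_all

end
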